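(* Let $(X,\mu)$ be a connected non-oriented weighted graph with $X$ countably infinite, with bounded geometry and $\sup_{x\in X}\sum_{y\in X}\mu(x,y)<+\infty$. For any $p\in[0,1]$ let $Y^a$ (all of $X$ with the open edges) and, when $p$ is greater than the critical percolation probability $p_c$, $Y^c$ (the infinite cluster) be the random weighted subgraphs given by Bernoulli bond percolation of parameter $p$ on $X$; for a sequence $\{p_n\}_{n\in\mathbb N}$ in $[0,1]$ let $Y^a_n$, $Y^c_n$ be the corresponding random subgraphs obtained from independent Bernoulli bond percolations with parameters $p_n$. Then: (1) If $\sum_n(1-p_n)<+\infty$, then $\lambda_s(Y_n^a)\to\lambda_s(X)$ almost surely as $n\to\infty$. (2) If $(X,\mu)$ is quasi-transitive, then $\lambda_s(Y^a)=\lambda_s(X)$ almost surely. (3) If $X=\mathbb Z^d$ with $d\ge2$ and $\sum_n(1-p_n)<+\infty$, then $\lambda_s(Y_n^c)\to\lambda_s(\mathbb Z^d)$ almost surely as $n\to\infty$ (here $p_n>p_c$ for all sufficiently large $n$, so $\lambda_s(Y^c_n)$ is defined eventually). (4) If $X=\mathbb Z^d$ with $d\ge2$, $\mu$ is translation invariant and $p>p_c$, then $\lambda_s(Y^c)=\lambda_s(\mathbb Z^d)$ almost surely.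
   Context: A weighted graph $(X,\mu)$ is a set $X$ with a function $\mu:X\times X\to[0,+\infty)$; the edges are the pairs $(x,y)$ with $\mu(x,y)>0$, and the edge set is $\mathcal E(X)$. It is non-oriented if $\mu(x,y)>0\iff\mu(y,x)>0$ (the weights need not be symmetric). Bounded geometry means $\sup_{x}|\{y:\mu(x,y)>0\}|<+\infty$. Connected means that for all $x,y$ there is $n$ with $\mu^{(n)}(x,y)>0$, where $\mu^{(n)}$ is the $n$-th power of the matrix $\mu$. $(X,\mu)$ is quasi-transitive if there is a finite partition of $X$ such that for all $x,y$ in the same class there is a bijection $\gamma$ of $X$ with $\gamma(x)=y$ and $\mu(\gamma(a),\gamma(b))=\mu(a,b)$ for all $a,b\in X$. When $X=\mathbb Z^d$, the graph is the usual nearest-neighbour lattice; $\mu$ is not required to be the simple random walk. For $\lambda>0$, the branching random walk (BRW) on a weighted graph $(X,\mu)$ is the continuous-time Markov process $\{\eta_t\}_{t\ge0}$ on $\mathbb N^X$ in which each particle lives an exponential time of parameter 1 and, while alive at $x$, places a new particle at $y$ at rate $\lambda\mu(x,y)$ for each $y$, independently of everything else. For a connected weighted graph, the strong critical parameter is $$\lambda_s(X)=\lambda_s(X,\mu):=\inf\{\lambda>0:\ \mathbb P^{\delta_{x_0}}(\exists\,\bar t:\ \eta_t(x_0)=0\ \forall t\ge\bar t)<1\},$$ where $x_0\in X$ is a fixed vertex (the value does not depend on it) and $\mathbb P^{\delta_{x_0}}$ is the law of the process started with one particle at $x_0$. Percolation: in Bernoulli bond percolation of parameter $p$, each (unoriented)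 edge is open independently with probability $p$. Any subgraph $(Y,\mathcal E(Y))$ of $(X,\mathcal E(X))$ is regarded as a weighted graph with weight function $\mathbf 1_{\mathcal E(Y)}\mu$. $Y^a$ is the random subgraph with vertex set $X$ and edge set the open edges, and $\lambda_s(Y^a):=\inf_{A}\lambda_s(A)$, where $A$ ranges over the connected components of $Y^a$. $p_c$ is the critical parameter of the percolation, assumed nontrivial whenever $Y^c$ is considered, and, for $p>p_c$, $Y^c$ is the infinite cluster (infinite connected component of open edges).
   Formalization: Part (2) is stated for 0 < p ≤ 1 only: at p = 0 all edges are closed, every component of Y^a is an isolated vertex, so λ_s(Y^a) = inf ∅ = +∞, whereas λ_s(X) is finite, and the claimed equality fails. *)

theory Defs
  imports "HOL-Probability.Probability"
begin

section \<open>Weighted graphs\<close>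

definition nonneg_weights :: "('a \<Rightarrow> 'a \<Rightarrow> real) \<Rightarrow> bool" where
  "nonneg_weights \<mu> \<longleftrightarrow> (\<forall>x y. 0 \<le> \<mu> x y)"

definition non_oriented :: "('a \<Rightarrow> 'a \<Rightarrow> real) \<Rightarrow> bool" where
  "non_oriented \<mu> \<longleftrightarrow> (\<forall>x y. 0 < \<mu> x y \<longleftrightarrow> 0 < \<mu> y x)"

definition bounded_geometry :: "('a \<Rightarrow> 'a \<Rightarrow> real) \<Rightarrow> bool" where
  "bounded_geometry \<mu> \<longleftrightarrow> (\<exists>N::nat. \<forall>x. finite {y. 0 < \<mu> x y} \<and> card {y. 0 < \<mu> x y} \<le> N)"

definition bounded_rates :: "('a \<Rightarrow> 'a \<Rightarrow> real) \<Rightarrow> bool" where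
  "bounded_rates \<mu> \<longleftrightarrow> (\<exists>K. \<forall>x. \<mu> x summable_on UNIV \<and> (\<Sum>\<^sub>\<infinity>y. \<mu> x y) \<le> K)"

primrec weight_power :: "('a \<Rightarrow> 'a \<Rightarrow> real) \<Rightarrow> nat \<Rightarrow> 'a \<Rightarrow> 'a \<Rightarrow> real" where
  "weight_power \<mu> 0 x y = (if x = y then 1 else 0)"
| "weight_power \<mu> (Suc n) x y = (\<Sum>\<^sub>\<infinity>w. \<mu> x w * weight_power \<mu> n w y)"

definition connected_weights :: "('a \<Rightarrow> 'a \<Rightarrow> real) \<Rightarrow> bool" where
  "connected_weights \<mu> \<longleftrightarrow> (\<forall>x y. \<exists>n. 0 < weight_power \<mu> n x y)"

definition quasi_transitive :: "('a \<Rightarrow> 'a \<Rightarrow> real) \<Rightarrow> bool" where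
  "quasi_transitive \<mu> \<longleftrightarrow>
     (\<exists>P. finite P \<and> partition_on UNIV P \<and>
        (\<forall>A\<in>P. \<forall>x\<in>A. \<forall>y\<in>A. \<exists>\<gamma>. bij \<gamma> \<and> \<gamma> x = y \<and> (\<forall>a b. \<mu> (\<gamma> a) (\<gamma> b) = \<mu> a b)))"

definition nearest_neighbour :: "(int ^ 'd \<Rightarrow> int ^ 'd \<Rightarrow> real) \<Rightarrow> bool" where
  "nearest_neighbour \<mu> \<longleftrightarrow> (\<forall>x y. 0 < \<mu> x y \<longleftrightarrow> (\<Sum>i\<in>UNIV. \<bar>x $ i - y $ i\<bar>) = 1)"

definition translation_invariant :: "('a::plus \<Rightarrow> 'a \<Rightarrow> real) \<Rightarrow> bool" where
  "translation_invariant \<mu> \<longleftrightarrow> (\<forall>x y z. \<mu> (x + z) (y + z) = \<mu> x y)"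

section \<open>The branching random walk\<close>

text \<open>
  The process started from one particle at \<open>x0\<close> is realised through its genealogy. The label
  \<open>(y, k) # u\<close> stands for the \<open>k\<close>-th particle (counting from 0) that particle \<open>u\<close> places at \<open>y\<close>,
  and \<open>[]\<close> stands for the initial particle. All randomness comes from independent exponential
  variables of parameter 1: \<open>\<omega> (u, None)\<close> is the lifetime of \<open>u\<close>, and the numbers
  \<open>\<omega> (u, Some (y, i))\<close>, divided by \<open>lam * \<mu> x y\<close> where \<open>x\<close> is the position of \<open>u\<close>, are the successive
  waiting times of the Poisson process of rate \<open>lam * \<mu> x y\<close> along which \<open>u\<close> places particles at \<open>y\<close>.
\<close>

type_synonym 'a particle = "('a \<times> nat) list"
type_synonym 'a clocks = "'a particle \<times> ('a \<times> nat) option \<Rightarrow> real"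

definition clock_space :: "'a clocks measure" where
  "clock_space = PiM UNIV (\<lambda>_. density lborel (\<lambda>t. ennreal (exponential_density 1 t)))"

fun position :: "'a \<Rightarrow> 'a particle \<Rightarrow> 'a" where
  "position x0 [] = x0"
| "position x0 ((y, k) # u) = y"

definition lifetime :: "'a clocks \<Rightarrow> 'a particle \<Rightarrow> real" where
  "lifetime \<omega> u = \<omega> (u, None)"

text \<open>The age at which \<open>u\<close> would place its \<open>k\<close>-th particle at \<open>y\<close>; only used if \<open>\<mu>\<close> is positive there.\<close>

definition birth_age ::
  "real \<Rightarrow> ('a \<Rightarrow> 'a \<Rightarrow> real) \<Rightarrow> 'a \<Rightarrow> 'a clocks \<Rightarrow> 'a particle \<Rightarrow> 'a \<Rightarrow> nat \<Rightarrow> real" where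
  "birth_age lam \<mu> x0 \<omega> u y k = (\<Sum>i\<le>k. \<omega> (u, Some (y, i))) / (lam * \<mu> (position x0 u) y)"

fun birth_time ::
  "real \<Rightarrow> ('a \<Rightarrow> 'a \<Rightarrow> real) \<Rightarrow> 'a \<Rightarrow> 'a clocks \<Rightarrow> 'a particle \<Rightarrow> real" where
  "birth_time lam \<mu> x0 \<omega> [] = 0"
| "birth_time lam \<mu> x0 \<omega> ((y, k) # u) = birth_time lam \<mu> x0 \<omega> u + birth_age lam \<mu> x0 \<omega> u y k"

fun is_born ::
  "real \<Rightarrow> ('a \<Rightarrow> 'a \<Rightarrow> real) \<Rightarrow> 'a \<Rightarrow> 'a clocks \<Rightarrow> 'a particle \<Rightarrow> bool" where
  "is_born lam \<mu> x0 \<omega> [] = True"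
| "is_born lam \<mu> x0 \<omega> ((y, k) # u) \<longleftrightarrow>
     is_born lam \<mu> x0 \<omega> u \<and> 0 < \<mu> (position x0 u) y \<and> birth_age lam \<mu> x0 \<omega> u y k < lifetime \<omega> u"

definition alive_at ::
  "real \<Rightarrow> ('a \<Rightarrow> 'a \<Rightarrow> real) \<Rightarrow> 'a \<Rightarrow> 'a clocks \<Rightarrow> real \<Rightarrow> 'a \<Rightarrow> 'a particle set" where
  "alive_at lam \<mu> x0 \<omega> t x =
     {u. is_born lam \<mu> x0 \<omega> u \<and> position x0 u = x \<and>
         birth_time lam \<mu> x0 \<omega> u \<le> t \<and> t < birth_time lam \<mu> x0 \<omega> u + lifetime \<omega> u}"

text \<open>
  The number of particles at \<open>x\<close> at time \<open>t\<close>. It is almost surely finite when the rates are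
  bounded; the value \<open>\<infinity>\<close> only prevents an infinite population from being counted as 0.
\<close>

definition brw ::
  "real \<Rightarrow> ('a \<Rightarrow> 'a \<Rightarrow> real) \<Rightarrow> 'a \<Rightarrow> 'a clocks \<Rightarrow> real \<Rightarrow> 'a \<Rightarrow> enat" where
  "brw lam \<mu> x0 \<omega> t x =
     (if finite (alive_at lam \<mu> x0 \<omega> t x) then enat (card (alive_at lam \<mu> x0 \<omega> t x)) else \<infinity>)"

definition local_extinction_prob :: "real \<Rightarrow> ('a \<Rightarrow> 'a \<Rightarrow> real) \<Rightarrow> 'a \<Rightarrow> real" where
  "local_extinction_prob lam \<mu> x0 =
     measure clock_space {\<omega> \<in> space clock_space. \<exists>T. \<forall>t\<ge>T. brw lam \<mu> x0 \<omega> t x0 = 0}"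

text \<open>
  The strong critical parameter of a connected graph with vertex set \<open>V\<close>, where \<open>\<mu>\<close> vanishes on
  pairs leaving \<open>V\<close>. The starting vertex is an arbitrary fixed element of \<open>V\<close>; the value is \<open>\<infinity>\<close>
  if there is never local survival, as on an isolated vertex.
\<close>

definition strong_critical :: "'a set \<Rightarrow> ('a \<Rightarrow> 'a \<Rightarrow> real) \<Rightarrow> ereal" where
  "strong_critical V \<mu> =
     (let x0 = (SOME x. x \<in> V) in Inf {ereal lam | lam. 0 < lam \<and> local_extinction_prob lam \<mu> x0 < 1})"

section \<open>Bernoulli bond percolation\<close>

text \<open>Unoriented edges are sets \<open>{x, y}\<close>; a loop at \<open>x\<close> is the singleton \<open>{x}\<close>.\<close>

definition edges :: "('a \<Rightarrow> 'a \<Rightarrow> real) \<Rightarrow> 'a set set" where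
  "edges \<mu> = {{x, y} | x y. 0 < \<mu> x y}"

definition percolation :: "('a \<Rightarrow> 'a \<Rightarrow> real) \<Rightarrow> real \<Rightarrow> ('a set \<Rightarrow> bool) measure" where
  "percolation \<mu> p = PiM (edges \<mu>) (\<lambda>_. measure_pmf (bernoulli_pmf p))"

definition percolation_seq :: "('a \<Rightarrow> 'a \<Rightarrow> real) \<Rightarrow> (nat \<Rightarrow> real) \<Rightarrow> (nat \<Rightarrow> 'a set \<Rightarrow> bool) measure" where
  "percolation_seq \<mu> p = PiM UNIV (\<lambda>n. percolation \<mu> (p n))"

definition open_edges :: "('a \<Rightarrow> 'a \<Rightarrow> real) \<Rightarrow> ('a set \<Rightarrow> bool) \<Rightarrow> 'a set set" where
  "open_edges \<mu> \<omega> = {e \<in> edges \<mu>. \<omega> e}"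

definition components :: "'a set set \<Rightarrow> 'a set set" where
  "components F = UNIV // {(x, y). {x, y} \<in> F}\<^sup>*"

definition infinite_clusters :: "'a set set \<Rightarrow> 'a set set" where
  "infinite_clusters F = {A \<in> components F. infinite A}"

definition subgraph_weights :: "'a set set \<Rightarrow> ('a \<Rightarrow> 'a \<Rightarrow> real) \<Rightarrow> 'a \<Rightarrow> 'a \<Rightarrow> real" where
  "subgraph_weights F \<mu> x y = indicator F {x, y} * \<mu> x y"

text \<open>The parameter of the component \<open>A\<close> of the graph with edge set \<open>F\<close>.\<close>

definition strong_critical_component :: "('a \<Rightarrow> 'a \<Rightarrow> real) \<Rightarrow> 'a set set \<Rightarrow> 'a set \<Rightarrow> ereal" where
  "strong_critical_component \<mu> F A = strong_critical A (subgraph_weights {e \<in> F. e \<subseteq> A} \<mu>)"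

definition strong_critical_all :: "('a \<Rightarrow> 'a \<Rightarrow> real) \<Rightarrow> 'a set set \<Rightarrow> ereal" where
  "strong_critical_all \<mu> F = (INF A\<in>components F. strong_critical_component \<mu> F A)"

definition critical_prob :: "('a \<Rightarrow> 'a \<Rightarrow> real) \<Rightarrow> real" where
  "critical_prob \<mu> =
     Sup {p \<in> {0..1}. measure (percolation \<mu> p)
            {\<omega> \<in> space (percolation \<mu> p). infinite_clusters (open_edges \<mu> \<omega>) \<noteq> {}} = 0}"

end

theory Submission
  imports Defs
begin

text \<open>
  The expected number of particles that are ever placed at \<open>x\<close> by a particle started at \<open>x\<close> is
  \<open>\<Sum>n. lam ^ n * weight_power w n x x\<close>. If this sum converges, the process dies out locally. If one
  term with \<open>n \<ge> 1\<close> exceeds 1, an embedded supercritical Galton-Watson process survives. Hence the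
  strong critical parameter is the infimum of all \<open>lam\<close> such that
  \<open>1 < lam ^ n * weight_power w n x x\<close> for some \<open>n\<close>. This condition involves only the finitely many
  edges used by the walks of length \<open>n\<close> from \<open>x\<close>, so it passes to every subgraph containing them (or
  an automorphic copy of them), while subgraphs can only have a larger parameter.

  The percolation statements reduce to finding such finite patterns. For summable \<open>1 - p n\<close> every
  finite pattern is eventually open by Borel-Cantelli; on the lattice a Peierls estimate shows that
  eventually every infinite cluster contains the origin. In the quasi-transitive case there are
  infinitely many disjoint, hence independent, copies of a pattern. In the translation-invariant case
  the exploration of an infinite cluster meets infinitely many fresh places for a copy, so no
  uniqueness of the infinite cluster is needed.
\<close>

section \<open>Events that depend on few coordinates\<close>

text \<open>A single \<open>n\<close> suffices as a witness because return weights are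
  supermultiplicative, so no limit theorem for subgraphs enters. Extinction and survival are
  separated only away from the critical value, which is enough for an infimum. On the lattice the
  two statements meet different obstacles. Without translation invariance a good pattern is known
  only at a prescribed vertex, so the infinite cluster must be shown to contain that vertex; this is
  where \<open>p n\<close> close to 1 and contours are used. With translation invariance the place
  is free, but the event that a cluster is infinite reads all edges, and conditioning on it would
  spoil independence. The exploration therefore asks only whether the revealed part of the cluster
  touches the boundary of the revealed box. Contours in general dimension are handled without planar
  duality: a parity argument modulo 2 chains the edges of a minimal cut. Since
  \<open>critical_prob\<close> is a supremum, percolation above it has positive probability by
  definition, and the zero-one law raises this to 1.\<close>

definition depends_on :: "'i set \<Rightarrow> (('i \<Rightarrow> 'b) \<Rightarrow> bool) \<Rightarrow> bool" where
  "depends_on J A \<longleftrightarrow> (\<forall>\<omega> \<omega>'. (\<forall>i\<in>J. \<omega> i = \<omega>' i) \<longrightarrow> A \<omega> = A \<omega>')"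

lemma depends_onI: "(\<And>\<omega> \<omega>'. (\<And>i. i \<in> J \<Longrightarrow> \<omega> i = \<omega>' i) \<Longrightarrow> A \<omega> \<Longrightarrow> A \<omega>') \<Longrightarrow> depends_on J A"
  unfolding depends_on_def by (metis (no_types))

lemma depends_onD: "depends_on J A \<Longrightarrow> (\<And>i. i \<in> J \<Longrightarrow> \<omega> i = \<omega>' i) \<Longrightarrow> A \<omega> \<longleftrightarrow> A \<omega>'"
  unfolding depends_on_def by blast

lemma depends_on_mono: "depends_on J A \<Longrightarrow> J \<subseteq> K \<Longrightarrow> depends_on K A"
  unfolding depends_on_def by blast

lemma indep_vars_coordinates:
  assumes "\<And>i. i \<in> I \<Longrightarrow> prob_space (M i)"
  shows "prob_space.indep_vars (PiM I M) M (\<lambda>i \<omega>. \<omega> i) I"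
proof (cases "I = {}")
  case True
  interpret prob_space "PiM I M" using assms by (intro prob_space_PiM)
  show ?thesis using True unfolding indep_vars_def indep_sets_def by blast
next
  case False
  interpret prob_space "PiM I M" using assms by (intro prob_space_PiM)
  have "distr (PiM I M) (PiM I M) (\<lambda>x. \<lambda>i\<in>I. x i) = distr (PiM I M) (PiM I M) (\<lambda>x. x)"
    by (intro distr_cong) (auto simp: space_PiM restrict_PiE_iff PiE_restrict)
  also have "\<dots> = PiM I (\<lambda>i. distr (PiM I M) (M i) (\<lambda>\<omega>. \<omega> i))"
    using assms by (simp cong: PiM_cong add: distr_PiM_component)
  finally show ?thesis
    by (subst indep_vars_iff_distr_eq_PiM') (use False in auto)
qed

text \<open>Independence is available for restrictions of the configuration to disjoint coordinate
  sets. To read \<open>A j\<close> as an event about such a restriction, \<open>ext\<close> fills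
  the coordinates outside \<open>K j\<close> from a fixed point \<open>z\<close>; dependence on
  \<open>K j\<close> alone makes this harmless.\<close>

lemma prob_indep_family:
  assumes M: "\<And>i. i \<in> I \<Longrightarrow> prob_space (M i)"
    and "finite L" and K: "\<And>j. j \<in> L \<Longrightarrow> K j \<subseteq> I" "disjoint_family_on K L"
    and A: "\<And>j. j \<in> L \<Longrightarrow> {\<omega> \<in> space (PiM I M). A j \<omega>} \<in> sets (PiM I M)"
    and dep: "\<And>j. j \<in> L \<Longrightarrow> depends_on (K j) (A j)"
  shows "measure (PiM I M) {\<omega> \<in> space (PiM I M). \<forall>j\<in>L. A j \<omega>}
           = (\<Prod>j\<in>L. measure (PiM I M) {\<omega> \<in> space (PiM I M). A j \<omega>})"
proof (cases "L = {}")
  case True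
  interpret prob_space "PiM I M" using M by (intro prob_space_PiM)
  show ?thesis using True prob_space by simp
next
  case False
  interpret prob_space "PiM I M" using M by (intro prob_space_PiM)
  obtain z where z: "z \<in> space (PiM I M)" using not_empty by blast
  define ext where "ext J \<eta> = (\<lambda>i\<in>I. if i \<in> J then \<eta> i else z i)" for J and \<eta> :: "'a \<Rightarrow> 'b"
  have ext: "ext (K j) \<in> PiM (K j) M \<rightarrow>\<^sub>M PiM I M" if "j \<in> L" for j
  proof -
    have "(\<lambda>\<eta>. if i \<in> K j then \<eta> i else z i) \<in> PiM (K j) M \<rightarrow>\<^sub>M M i" if "i \<in> I" for i
      using that PiE_mem[OF z[unfolded space_PiM]] by (cases "i \<in> K j") (auto intro!: measurable_const)
    then show ?thesis unfolding ext_def by (intro measurable_restrict) auto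
  qed
  define B where "B j = ext (K j) -` {\<omega> \<in> space (PiM I M). A j \<omega>} \<inter> space (PiM (K j) M)" for j
  have B: "B j \<in> sets (PiM (K j) M)" if "j \<in> L" for j
    unfolding B_def using measurable_sets[OF ext A] that by blast
  have ind: "indep_vars (\<lambda>j. PiM (K j) M) (\<lambda>j \<omega>. restrict (\<lambda>i. \<omega> i) (K j)) L"
    by (rule indep_vars_restrict[OF indep_vars_coordinates]) (use M K in auto)
  have pre: "(\<lambda>\<omega>. restrict (\<lambda>i. \<omega> i) (K j)) -` B j \<inter> space (PiM I M) = {\<omega> \<in> space (PiM I M). A j \<omega>}"
    if j: "j \<in> L" for j
  proof -
    have "A j (ext (K j) (restrict \<omega> (K j))) \<longleftrightarrow> A j \<omega>" for \<omega>
      by (rule depends_onD[OF dep[OF j]]) (use K(1)[OF j] in \<open>auto simp: ext_def\<close>)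
    moreover have "restrict \<omega> (K j) \<in> space (PiM (K j) M)" if "\<omega> \<in> space (PiM I M)" for \<omega>
      using that K(1)[OF j] by (auto simp: space_PiM PiE_iff)
    ultimately show ?thesis
      using measurable_space[OF ext[OF j]] by (auto simp: B_def)
  qed
  have "prob (\<Inter>j\<in>L. (\<lambda>\<omega>. restrict (\<lambda>i. \<omega> i) (K j)) -` B j \<inter> space (PiM I M))
     = (\<Prod>j\<in>L. prob ((\<lambda>\<omega>. restrict (\<lambda>i. \<omega> i) (K j)) -` B j \<inter> space (PiM I M)))"
    by (rule indep_varsD[OF ind]) (use False assms(2) B in auto)
  moreover have "(\<Inter>j\<in>L. (\<lambda>\<omega>. restrict (\<lambda>i. \<omega> i) (K j)) -` B j \<inter> space (PiM I M))
      = {\<omega> \<in> space (PiM I M). \<forall>j\<in>L. A j \<omega>}"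
    using False pre by auto
  ultimately show ?thesis using pre by (simp cong: prod.cong)
qed

lemma prob_indep_pair:
  assumes M: "\<And>i. i \<in> I \<Longrightarrow> prob_space (M i)"
    and K: "J \<subseteq> I" "K \<subseteq> I" "J \<inter> K = {}"
    and A: "{\<omega> \<in> space (PiM I M). A \<omega>} \<in> sets (PiM I M)" "depends_on J A"
    and B: "{\<omega> \<in> space (PiM I M). B \<omega>} \<in> sets (PiM I M)" "depends_on K B"
  shows "measure (PiM I M) {\<omega> \<in> space (PiM I M). A \<omega> \<and> B \<omega>}
    = measure (PiM I M) {\<omega> \<in> space (PiM I M). A \<omega>} * measure (PiM I M) {\<omega> \<in> space (PiM I M). B \<omega>}"
proof -
  have "measure (PiM I M) {\<omega> \<in> space (PiM I M). \<forall>j\<in>UNIV. (if j then A else B) \<omega>}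
     = (\<Prod>j\<in>UNIV. measure (PiM I M) {\<omega> \<in> space (PiM I M). (if j then A else B) \<omega>})"
    by (rule prob_indep_family[where K = "\<lambda>j. if j then J else K"])
       (use assms in \<open>auto simp: disjoint_family_on_def\<close>)
  moreover have "(\<forall>j\<in>UNIV. (if j then A else B) \<omega>) \<longleftrightarrow> A \<omega> \<and> B \<omega>" for \<omega>
    by (auto split: if_splits)
  ultimately show ?thesis by (simp only: UNIV_bool) (simp add: mult.commute)
qed

section \<open>Powers of weights\<close>

text \<open>It turns the infinite sums in \<open>weight_power\<close> into finite ones and passes to
  every subgraph.\<close>

definition finite_rows :: "('a \<Rightarrow> 'a \<Rightarrow> real) \<Rightarrow> bool" where
  "finite_rows w \<longleftrightarrow> (\<forall>x. finite {y. 0 < w x y})"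

lemma weight_power_Suc_sum:
  assumes "nonneg_weights w" "finite S" "{y. 0 < w x y} \<subseteq> S"
  shows "weight_power w (Suc n) x z = (\<Sum>y\<in>S. w x y * weight_power w n y z)"
proof -
  have "w x y = 0" if "y \<notin> S" for y
    using that assms unfolding nonneg_weights_def by (metis (mono_tags) less_eq_real_def mem_Collect_eq subsetD)
  then have "(\<Sum>\<^sub>\<infinity>y. w x y * weight_power w n y z) = (\<Sum>\<^sub>\<infinity>y\<in>S. w x y * weight_power w n y z)"
    by (intro infsum_cong_neutral) auto
  then show ?thesis using assms by simp
qed

lemma weight_power_nonneg:
  assumes "nonneg_weights w"
  shows "0 \<le> weight_power w n x y"
proof (induction n arbitrary: x)
  case (Suc n)
  show ?case unfolding weight_power.simps
    by (intro infsum_nonneg mult_nonneg_nonneg) (use assms Suc in \<open>auto simp: nonneg_weights_def\<close>)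
qed simp

lemma weight_power_mono:
  assumes "nonneg_weights w" "nonneg_weights w'" "finite_rows w'" "\<And>x y. w x y \<le> w' x y"
  shows "weight_power w n x z \<le> weight_power w' n x z"
proof (induction n arbitrary: x)
  case (Suc n)
  let ?S = "{y. 0 < w' x y}"
  have S: "finite ?S" using assms unfolding finite_rows_def by auto
  have sub: "{y. 0 < w x y} \<subseteq> ?S" using assms(4) by (auto intro: less_le_trans)
  show ?case
    unfolding weight_power_Suc_sum[OF assms(1) S sub] weight_power_Suc_sum[OF assms(2) S order_refl]
    by (intro sum_mono mult_mono Suc assms weight_power_nonneg)
       (use assms in \<open>auto simp: nonneg_weights_def\<close>)
qed simp

text \<open>The left side counts only those walks from \<open>x\<close> to \<open>z\<close> that are
  at \<open>y\<close> after \<open>m\<close> steps.\<close>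

lemma weight_power_add_ge:
  assumes "nonneg_weights w" "finite_rows w"
  shows "weight_power w m x y * weight_power w n y z \<le> weight_power w (m + n) x z"
proof (induction m arbitrary: x)
  case 0
  show ?case using weight_power_nonneg[OF assms(1)] by auto
next
  case (Suc m)
  let ?S = "{y. 0 < w x y}"
  have S: "finite ?S" using assms unfolding finite_rows_def by auto
  have "weight_power w (Suc m) x y * weight_power w n y z
      = (\<Sum>v\<in>?S. w x v * (weight_power w m v y * weight_power w n y z))"
    unfolding weight_power_Suc_sum[OF assms(1) S order_refl] by (simp add: sum_distrib_left mult_ac)
  also have "\<dots> \<le> (\<Sum>v\<in>?S. w x v * weight_power w (m + n) v z)"
    by (intro sum_mono mult_left_mono Suc) auto
  also have "\<dots> = weight_power w (Suc m + n) x z"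
    unfolding add_Suc weight_power_Suc_sum[OF assms(1) S order_refl] ..
  finally show ?case .
qed

lemma weight_power_mult_ge:
  assumes "nonneg_weights w" "finite_rows w"
  shows "weight_power w n x x ^ k \<le> weight_power w (k * n) x x"
proof (induction k)
  case (Suc k)
  have "weight_power w n x x ^ Suc k \<le> weight_power w n x x * weight_power w (k * n) x x"
    using Suc weight_power_nonneg[OF assms(1)] by (simp add: mult_left_mono)
  also have "\<dots> \<le> weight_power w (Suc k * n) x x"
    using weight_power_add_ge[OF assms, of n x x "k * n" x] by simp
  finally show ?case .
qed simp

lemma weight_power_pos_imp_path:
  assumes "nonneg_weights w" "finite_rows w" "0 < weight_power w n x y"
  shows "(x, y) \<in> {(a, b). 0 < w a b}\<^sup>*"
  using assms(3)
proof (induction n arbitrary: x)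
  case 0 then show ?case by (auto split: if_splits)
next
  case (Suc n)
  have "(\<Sum>v\<in>{v. 0 < w x v}. w x v * weight_power w n v y) > 0"
    using Suc.prems assms weight_power_Suc_sum[OF assms(1) _ order_refl, of x n y]
    by (auto simp: finite_rows_def)
  then obtain v where "0 < w x v" "w x v * weight_power w n v y > 0"
    by (metis (no_types, lifting) mem_Collect_eq not_le sum_nonpos)
  then have "0 < weight_power w n v y" by (simp add: zero_less_mult_iff)
  from Suc.IH[OF this] \<open>0 < w x v\<close> show ?case by (auto intro: converse_rtrancl_into_rtrancl)
qed

lemma path_imp_weight_power_pos:
  assumes "nonneg_weights w" "finite_rows w" "(x, y) \<in> {(a, b). 0 < w a b}\<^sup>*"
  shows "\<exists>n. 0 < weight_power w n x y"
  using assms(3)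
proof (induction rule: converse_rtrancl_induct)
  case base then show ?case by (intro exI[of _ 0]) simp
next
  case (step u v)
  then obtain n where n: "0 < weight_power w n v y" by auto
  have S: "finite {v. 0 < w u v}" using assms unfolding finite_rows_def by auto
  have "0 < weight_power w (Suc n) u y"
    unfolding weight_power_Suc_sum[OF assms(1) S order_refl]
    by (rule sum_pos2[OF S, of v])
       (use step n weight_power_nonneg[OF assms(1)] in \<open>auto simp: less_imp_le\<close>)
  then show ?case by blast
qed

subsection \<open>The first-moment critical value\<close>

text \<open>The reciprocal of the supremum, over n at least 1, of the n-th roots of the return
  weights at \<open>x\<close>. The index 0 never qualifies because its term equals 1; without any
  return the value is infinite.\<close>

definition first_moment_critical :: "('a \<Rightarrow> 'a \<Rightarrow> real) \<Rightarrow> 'a \<Rightarrow> ereal" where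
  "first_moment_critical w x = Inf {ereal lam | lam. 0 < lam \<and> (\<exists>n. 1 < lam ^ n * weight_power w n x x)}"

lemma first_moment_critical_mono:
  assumes "nonneg_weights w" "nonneg_weights w'" "finite_rows w'" "\<And>x y. w x y \<le> w' x y"
  shows "first_moment_critical w' x \<le> first_moment_critical w x"
  unfolding first_moment_critical_def
proof (rule Inf_superset_mono, clarify)
  fix lam n assume "0 < (lam::real)" "1 < lam ^ n * weight_power w n x x"
  moreover have "lam ^ n * weight_power w n x x \<le> lam ^ n * weight_power w' n x x"
    by (intro mult_left_mono weight_power_mono assms) (use \<open>0 < lam\<close> in auto)
  ultimately show "\<exists>lam'. ereal lam = ereal lam' \<and> 0 < lam' \<and> (\<exists>n. 1 < lam' ^ n * weight_power w' n x x)"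
    by (metis less_le_trans)
qed

text \<open>Go from \<open>y\<close> to \<open>x\<close>, run the good loop at \<open>x\<close>
  \<open>k\<close> times, and go back. The detour costs a fixed factor \<open>c\<close>, which a
  large power of a number above 1 outweighs.\<close>

lemma first_moment_critical_le:
  assumes "nonneg_weights w" "finite_rows w"
    and "(x, y) \<in> {(a, b). 0 < w a b}\<^sup>*" "(y, x) \<in> {(a, b). 0 < w a b}\<^sup>*"
  shows "first_moment_critical w y \<le> first_moment_critical w x"
  unfolding first_moment_critical_def
proof (rule Inf_superset_mono, clarify)
  fix lam n assume lam: "0 < (lam::real)" "1 < lam ^ n * weight_power w n x x"
  obtain a where a: "0 < weight_power w a y x" using path_imp_weight_power_pos[OF assms(1,2,4)] by auto
  obtain b where b: "0 < weight_power w b x y" using path_imp_weight_power_pos[OF assms(1,2,3)] by auto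
  define c where "c = lam ^ (a + b) * (weight_power w a y x * weight_power w b x y)"
  have c: "0 < c" using a b lam by (simp add: c_def)
  obtain k where k: "1 / c < (lam ^ n * weight_power w n x x) ^ k" using real_arch_pow[OF lam(2)] by blast
  have "1 < c * (lam ^ n * weight_power w n x x) ^ k" using k c by (simp add: field_simps)
  also have "\<dots> = lam ^ (a + k * n + b) * (weight_power w a y x * weight_power w n x x ^ k * weight_power w b x y)"
    by (simp add: c_def power_add power_mult power_mult_distrib mult_ac flip: power_mult)
  also have "\<dots> \<le> lam ^ (a + k * n + b) * weight_power w (a + k * n + b) y y"
  proof (intro mult_left_mono)
    have "weight_power w a y x * weight_power w n x x ^ k \<le> weight_power w a y x * weight_power w (k * n) x x"
      by (intro mult_left_mono weight_power_mult_ge assms) (use a in auto)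
    also have "\<dots> \<le> weight_power w (a + k * n) y x" by (rule weight_power_add_ge[OF assms(1,2)])
    finally have "weight_power w a y x * weight_power w n x x ^ k * weight_power w b x y
       \<le> weight_power w (a + k * n) y x * weight_power w b x y"
      by (intro mult_right_mono) (use b in auto)
    also have "\<dots> \<le> weight_power w (a + k * n + b) y y" by (rule weight_power_add_ge[OF assms(1,2)])
    finally show "weight_power w a y x * weight_power w n x x ^ k * weight_power w b x y
       \<le> weight_power w (a + k * n + b) y y" .
  qed (use lam in auto)
  finally show "\<exists>lam'. ereal lam = ereal lam' \<and> 0 < lam' \<and> (\<exists>n. 1 < lam' ^ n * weight_power w n y y)"
    using lam by blast
qed

subsection \<open>Edges explored by short walks\<close>

primrec walk_edges :: "('a \<Rightarrow> 'a \<Rightarrow> real) \<Rightarrow> nat \<Rightarrow> 'a \<Rightarrow> 'a set set" where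
  "walk_edges w 0 x = {}"
| "walk_edges w (Suc n) x = (\<Union>y\<in>{y. 0 < w x y}. insert {x, y} (walk_edges w n y))"

lemma finite_walk_edges: "finite_rows w \<Longrightarrow> finite (walk_edges w n x)"
  by (induction n arbitrary: x) (auto simp: finite_rows_def)

lemma walk_edges_subset: "walk_edges w n x \<subseteq> edges w"
  by (induction n arbitrary: x) (auto simp: edges_def)

lemma walk_edges_automorphism:
  assumes "bij \<gamma>" "\<And>a b. w (\<gamma> a) (\<gamma> b) = w a b"
  shows "walk_edges w n (\<gamma> x) = (`) \<gamma> ` walk_edges w n x"
proof (induction n arbitrary: x)
  case (Suc n)
  have "{y. 0 < w (\<gamma> x) y} = \<gamma> ` {y. 0 < w x y}"
    using assms(2) bij_is_surj[OF assms(1)] by (auto simp: image_iff) (metis surjD)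
  then show ?case using Suc by (auto simp: image_UN)
qed simp

lemma subgraph_weights_nonneg: "nonneg_weights w \<Longrightarrow> nonneg_weights (subgraph_weights F w)"
  by (auto simp: nonneg_weights_def subgraph_weights_def)

lemma subgraph_weights_le: "nonneg_weights w \<Longrightarrow> subgraph_weights F w x y \<le> w x y"
  by (auto simp: nonneg_weights_def subgraph_weights_def indicator_def)

lemma subgraph_weights_pos_iff: "0 < subgraph_weights F w x y \<longleftrightarrow> {x, y} \<in> F \<and> 0 < w x y"
  by (auto simp: subgraph_weights_def indicator_def)

lemma subgraph_weights_finite_rows: "finite_rows w \<Longrightarrow> finite_rows (subgraph_weights F w)"
  unfolding finite_rows_def subgraph_weights_pos_iff by (auto elim!: allE intro: rev_finite_subset)

lemma weight_power_subgraph_eq: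
  assumes "nonneg_weights w" "finite_rows w" "walk_edges w n x \<subseteq> F"
  shows "weight_power (subgraph_weights F w) n x z = weight_power w n x z"
  using assms(3)
proof (induction n arbitrary: x)
  case (Suc n)
  let ?S = "{y. 0 < w x y}"
  have S: "finite ?S" using assms unfolding finite_rows_def by auto
  have sub: "{y. 0 < subgraph_weights F w x y} \<subseteq> ?S" by (auto simp: subgraph_weights_pos_iff)
  have "subgraph_weights F w x y * weight_power (subgraph_weights F w) n y z = w x y * weight_power w n y z"
    if "y \<in> ?S" for y
  proof -
    have "{x, y} \<in> F" "walk_edges w n y \<subseteq> F" using Suc.prems that by auto
    then show ?thesis using Suc.IH[of y] by (simp add: subgraph_weights_def[of F w x y])
  qed
  then show ?case
    unfolding weight_power_Suc_sum[OF assms(1) S order_refl]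
      weight_power_Suc_sum[OF subgraph_weights_nonneg[OF assms(1)] S sub]
    by (intro sum.cong) auto
qed simp

text \<open>Walks along \<open>F\<close> cannot leave a set closed under \<open>F\<close>. Thus a
  pattern that is open in the whole configuration is already present in the component of its base
  point.\<close>

lemma walk_edges_component:
  assumes "x \<in> A" "walk_edges w n x \<subseteq> F" "\<And>y z. y \<in> A \<Longrightarrow> {y, z} \<in> F \<Longrightarrow> z \<in> A"
  shows "walk_edges w n x \<subseteq> {e \<in> F. e \<subseteq> A}"
  using assms(1,2)
proof (induction n arbitrary: x)
  case (Suc n)
  have "insert {x, y} (walk_edges w n y) \<subseteq> {e \<in> F. e \<subseteq> A}" if "0 < w x y" for y
  proof -
    have "{x, y} \<in> F" "walk_edges w n y \<subseteq> F" using Suc.prems that by auto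
    then show ?thesis using Suc assms(3) by blast
  qed
  then show ?case by auto
qed simp

section \<open>Local extinction of the branching random walk\<close>

abbreviation clock_measure :: "real measure" where
  "clock_measure \<equiv> density lborel (\<lambda>t. ennreal (exponential_density 1 t))"

lemma prob_space_clock: "prob_space clock_measure"
  using prob_space_exponential_density[of 1] by simp

interpretation clock_space: prob_space clock_space
  unfolding clock_space_def by (intro prob_space_PiM prob_space_clock)

lemma space_clock_space [simp]: "space clock_space = UNIV"
  by (simp add: clock_space_def space_PiM)

lemma measurable_clock [measurable]: "(\<lambda>\<omega>. \<omega> i) \<in> borel_measurable clock_space"
proof -
  have "(\<lambda>\<omega>. \<omega> i) \<in> clock_space \<rightarrow>\<^sub>M clock_measure"
    unfolding clock_space_def by (rule measurable_component_singleton) simp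
  then show ?thesis by (simp cong: measurable_cong_sets)
qed

lemma emeasure_clock_gt:
  assumes "0 \<le> a"
  shows "emeasure clock_measure {a<..} = ennreal (exp (- a))"
proof -
  interpret M: prob_space clock_measure by (rule prob_space_clock)
  have "distributed clock_measure lborel (\<lambda>x. x) (exponential_density 1)"
    by (auto simp: distributed_def intro!: measure_eqI simp: distr_id2)
  from M.exponential_distributedD_gt[OF this assms]
  show ?thesis by (simp add: M.emeasure_eq_measure greaterThan_def)
qed

lemma AE_clock_pos: "AE \<omega> in (clock_space :: 'a::countable clocks measure). \<forall>i. 0 < \<omega> i"
proof -
  interpret M: prob_space clock_measure by (rule prob_space_clock)
  have "emeasure clock_measure {0<..} = 1" using emeasure_clock_gt[of 0] by simp
  then have "AE x in clock_measure. x \<in> {0<..}"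
    by (intro M.AE_prob_1) (simp add: M.emeasure_eq_measure)
  then have "AE \<omega> in (clock_space :: 'a clocks measure). 0 < \<omega> i" for i
    unfolding clock_space_def by (intro AE_PiM_component prob_space_clock) auto
  then show ?thesis unfolding AE_all_countable by blast
qed

text \<open>The chance that a waiting time of rate \<open>r\<close> ends before an independent
  lifetime of rate 1; each of the \<open>k + 1\<close> waiting times before a birth contributes one
  such factor.\<close>

lemma nn_integral_clock_exp:
  assumes "0 < r"
  shows "(\<integral>\<^sup>+x. ennreal (exp (- (x / r))) \<partial>clock_measure) = ennreal (r / (1 + r))"
proof -
  \<comment> \<open>The two exponents add up to \<open>l\<close>, so the integrand is 1 /
    \<open>l\<close> times the exponential density of parameter \<open>l\<close>.\<close>
  define l where "l = 1 + 1 / r"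
  have l: "0 < l" using assms by (simp add: l_def add_pos_pos)
  interpret E: prob_space "density lborel (exponential_density l)"
    by (rule prob_space_exponential_density[OF l])
  have "(\<integral>\<^sup>+x. ennreal (exponential_density l x) \<partial>lborel) = 1"
    using E.emeasure_space_1 by (simp add: emeasure_density)
  have "(\<integral>\<^sup>+x. ennreal (exp (- (x / r))) \<partial>clock_measure)
      = (\<integral>\<^sup>+x. ennreal (exponential_density 1 x) * ennreal (exp (- (x / r))) \<partial>lborel)"
    by (subst nn_integral_density) auto
  also have "\<dots> = (\<integral>\<^sup>+x. ennreal (1 / l) * ennreal (exponential_density l x) \<partial>lborel)"
  proof (intro nn_integral_cong)
    fix x :: real
    have "exponential_density 1 x * exp (- (x / r)) = 1 / l * exponential_density l x"
      using l by (simp add: exponential_density_def l_def flip: exp_add) (simp add: field_simps)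
    then show "ennreal (exponential_density 1 x) * ennreal (exp (- (x / r))) = ennreal (1 / l) * ennreal (exponential_density l x)"
      using l by (simp flip: ennreal_mult')
  qed
  also have "\<dots> = ennreal (1 / l)"
    using \<open>_ = 1\<close> by (simp add: nn_integral_cmult)
  also have "1 / l = r / (1 + r)" using assms by (simp add: l_def field_simps)
  finally show ?thesis .
qed

text \<open>
  With rate \<open>r\<close>, the \<open>k\<close>-th birth comes before the death of the parent with the probability that
  the \<open>k + 1\<close> first events of two competing Poisson processes of rates \<open>r\<close> and \<open>1\<close> belong to the
  first process.
\<close>

definition birth_prob :: "real \<Rightarrow> nat \<Rightarrow> real" where
  "birth_prob r k = (if 0 < r then (r / (1 + r)) ^ Suc k else 0)"

lemma birth_prob_nonneg: "0 \<le> birth_prob r k"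
  by (simp add: birth_prob_def)

text \<open>A geometric series: a parent placing particles at rate \<open>r\<close> during a
  lifetime of mean 1 has \<open>r\<close> of them on average.\<close>

lemma birth_prob_sums:
  assumes "0 \<le> r"
  shows "(\<Sum>k. ennreal (birth_prob r k)) = ennreal r"
proof (cases "r = 0")
  case False
  then have r: "0 < r" using assms by simp
  have "(\<lambda>k. (r / (1 + r)) * (r / (1 + r)) ^ k) sums ((r / (1 + r)) * (1 / (1 - r / (1 + r))))"
    by (intro sums_mult geometric_sums) (use r in auto)
  also have "(r / (1 + r)) * (1 / (1 - r / (1 + r))) = r" using r by (simp add: field_simps)
  finally have "birth_prob r sums r" using r by (simp add: birth_prob_def[abs_def])
  then show ?thesis using birth_prob_nonneg suminf_ennreal_eq by blast
qed (simp add: birth_prob_def)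

text \<open>Integrate over the birth age \<open>?X\<close> first. The lifetime, independent of it,
  exceeds it with probability exp(- \<open>?X\<close>), which factors over the independent waiting
  times.\<close>

lemma prob_birth:
  fixes u :: "'a::countable particle"
  assumes "0 < r"
  shows "measure clock_space {\<omega>. (\<Sum>i\<le>k. \<omega> (u, Some (y, i))) / r < \<omega> (u, None)} = birth_prob r k"
proof -
  have less_sets: "{p :: real \<times> real. fst p < snd p} \<in> sets (borel \<Otimes>\<^sub>M borel)"
    unfolding borel_prod by (intro borel_open open_Collect_less continuous_intros)
  let ?X = "\<lambda>\<omega>::'a clocks. (\<Sum>i\<le>k. \<omega> (u, Some (y, i))) / r" and ?T = "\<lambda>\<omega>::'a clocks. \<omega> (u, None)"
  let ?I = "(\<lambda>i. (u, Some (y, i))) ` {..k}"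
  have coord: "clock_space.indep_vars (\<lambda>_. clock_measure) (\<lambda>i \<omega>. \<omega> i) (UNIV :: ('a particle \<times> ('a \<times> nat) option) set)"
    unfolding clock_space_def by (rule indep_vars_coordinates) (rule prob_space_clock)
  then have borel: "clock_space.indep_vars (\<lambda>_. borel) (\<lambda>i \<omega>. \<omega> i) (UNIV :: ('a particle \<times> ('a \<times> nat) option) set)"
    by (rule clock_space.indep_vars_compose2) simp
  have "clock_space.indep_var (PiM ?I (\<lambda>_. borel)) (\<lambda>\<omega>. restrict (\<lambda>i. \<omega> i) ?I)
          (PiM {(u, None)} (\<lambda>_. borel)) (\<lambda>\<omega>. restrict (\<lambda>i. \<omega> i) {(u, None)})"
    by (rule clock_space.indep_var_restrict[OF borel]) auto
  then have "clock_space.indep_var borel ((\<lambda>\<eta>. (\<Sum>i\<le>k. \<eta> (u, Some (y, i))) / r) \<circ> (\<lambda>\<omega>. restrict (\<lambda>i. \<omega> i) ?I))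
      borel ((\<lambda>\<eta>. \<eta> (u, None)) \<circ> (\<lambda>\<omega>. restrict (\<lambda>i. \<omega> i) {(u, None)}))"
    by (rule clock_space.indep_var_compose) (auto intro!: borel_measurable_divide borel_measurable_sum measurable_component_singleton)
  then have ind: "clock_space.indep_var borel ?X borel ?T" by (simp add: comp_def)
  have T: "distr clock_space borel ?T = clock_measure"
  proof -
    have "distr clock_space borel ?T = distr clock_space clock_measure ?T"
      by (intro distr_cong) auto
    also have "\<dots> = clock_measure"
      unfolding clock_space_def using prob_space_clock by (intro distr_PiM_component) auto
    finally show ?thesis .
  qed
  interpret T: prob_space clock_measure by (rule prob_space_clock)
  interpret D: prob_space "distr clock_space borel ?X" by (intro clock_space.prob_space_distr) simp
  have "emeasure clock_space {\<omega>. ?X \<omega> < ?T \<omega>} = emeasure (distr clock_space (borel \<Otimes>\<^sub>M borel) (\<lambda>\<omega>. (?X \<omega>, ?T \<omega>))) {p. fst p < snd p}"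
    by (subst emeasure_distr[OF _ less_sets]) (auto intro!: arg_cong[where f = "emeasure clock_space"])
  also have "\<dots> = emeasure (distr clock_space borel ?X \<Otimes>\<^sub>M clock_measure) {p. fst p < snd p}"
    using ind T by (simp add: clock_space.indep_var_distribution_eq)
  also have "\<dots> = (\<integral>\<^sup>+x. emeasure clock_measure {x<..} \<partial>distr clock_space borel ?X)"
  proof (subst T.emeasure_pair_measure_alt)
    note less_sets
    also have "sets (borel \<Otimes>\<^sub>M borel) = sets (distr clock_space borel ?X \<Otimes>\<^sub>M clock_measure)"
      by (intro sets_pair_measure_cong) auto
    finally show "{p. fst p < snd p} \<in> sets (distr clock_space borel ?X \<Otimes>\<^sub>M clock_measure)" .
  qed (auto intro!: nn_integral_cong arg_cong2[where f = emeasure])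
  also have "\<dots> = (\<integral>\<^sup>+\<omega>. emeasure clock_measure {?X \<omega><..} \<partial>clock_space)"
  proof (rule nn_integral_distr)
    have "(\<lambda>x. emeasure clock_measure (Pair x -` {p :: real \<times> real. fst p < snd p})) \<in> borel_measurable borel"
    proof (rule T.measurable_emeasure_Pair)
      note less_sets
      also have "sets (borel \<Otimes>\<^sub>M borel) = sets (borel \<Otimes>\<^sub>M clock_measure)"
        by (intro sets_pair_measure_cong) auto
      finally show "{p :: real \<times> real. fst p < snd p} \<in> sets (borel \<Otimes>\<^sub>M clock_measure)" .
    qed
    then show "(\<lambda>x. emeasure clock_measure {x<..}) \<in> borel_measurable (distr clock_space borel ?X)"
      by (simp add: vimage_def greaterThan_def cong: measurable_cong_sets)
  qed simp
  also have "\<dots> = (\<integral>\<^sup>+\<omega>. (\<Prod>i\<in>?I. ennreal (exp (- (\<omega> i / r)))) \<partial>clock_space)"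
  proof (rule nn_integral_cong_AE, use AE_clock_pos in eventually_elim)
    fix \<omega> :: "'a clocks" assume pos: "\<forall>i. 0 < \<omega> i"
    have nonneg: "0 \<le> ?X \<omega>"
      using assms by (intro divide_nonneg_nonneg sum_nonneg less_imp_le[OF pos[rule_format]]) simp
    have "- ?X \<omega> = (\<Sum>i\<in>?I. - (\<omega> i / r))"
      by (subst sum.reindex) (auto simp: inj_on_def sum_negf sum_divide_distrib)
    then show "emeasure clock_measure {?X \<omega><..} = (\<Prod>i\<in>?I. ennreal (exp (- (\<omega> i / r))))"
      by (simp only: emeasure_clock_gt[OF nonneg]) (simp add: exp_sum prod_ennreal del: sum_negf)
  qed
  also have "\<dots> = (\<Prod>i\<in>?I. (\<integral>\<^sup>+\<omega>. ennreal (exp (- (\<omega> i / r))) \<partial>clock_space))"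
  proof (rule clock_space.indep_vars_nn_integral)
    show "clock_space.indep_vars (\<lambda>_. borel) (\<lambda>i \<omega>. ennreal (exp (- (\<omega> i / r)))) ?I"
      by (rule clock_space.indep_vars_compose2[OF clock_space.indep_vars_subset[OF borel]]) auto
  qed auto
  also have "\<dots> = (\<Prod>i\<in>?I. ennreal (r / (1 + r)))"
  proof (rule prod.cong[OF refl])
    fix i :: "'a particle \<times> ('a \<times> nat) option"
    have "(\<integral>\<^sup>+\<omega>. ennreal (exp (- (\<omega> i / r))) \<partial>clock_space)
       = (\<integral>\<^sup>+x. ennreal (exp (- (x / r))) \<partial>distr clock_space clock_measure (\<lambda>\<omega>. \<omega> i))"
      using measurable_clock[of i] by (subst nn_integral_distr) (auto cong: measurable_cong_sets)
    also have "distr clock_space clock_measure (\<lambda>\<omega>. \<omega> i) = clock_measure"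
      unfolding clock_space_def using prob_space_clock by (intro distr_PiM_component) auto
    finally show "(\<integral>\<^sup>+\<omega>. ennreal (exp (- (\<omega> i / r))) \<partial>clock_space) = ennreal (r / (1 + r))"
      using nn_integral_clock_exp[OF assms] by simp
  qed
  also have "\<dots> = ennreal (birth_prob r k)"
    using assms by (simp add: birth_prob_def card_image inj_on_def ennreal_power del: power_Suc)
  finally show ?thesis
    by (simp add: clock_space.emeasure_eq_measure birth_prob_nonneg)
qed

subsection \<open>Births\<close>

lemma measurable_birth_age [measurable]:
  "(\<lambda>\<omega>. birth_age lam w x \<omega> u y k) \<in> borel_measurable clock_space"
  unfolding birth_age_def by measurable

lemma measurable_birth_time [measurable]:
  "(\<lambda>\<omega>. birth_time lam w x \<omega> u) \<in> borel_measurable clock_space"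
  by (induction u) auto

lemma measurable_lifetime [measurable]: "(\<lambda>\<omega>. lifetime \<omega> u) \<in> borel_measurable clock_space"
  unfolding lifetime_def by measurable

lemma measurable_is_born [measurable]: "Measurable.pred clock_space (\<lambda>\<omega>. is_born lam w x \<omega> u)"
proof (induction u)
  case (Cons a u)
  note [measurable] = Cons
  show ?case by (cases a) simp
qed simp

lemma sets_is_born: "{\<omega>. is_born lam w x \<omega> u} \<in> sets clock_space"
  using measurable_is_born[of lam w x u] by (simp add: pred_def)

lemma birth_age_cong: "(\<And>i. \<omega> (u, Some i) = \<omega>' (u, Some i)) \<Longrightarrow> birth_age lam w x \<omega> u y k = birth_age lam w x \<omega>' u y k"
  unfolding birth_age_def by (intro arg_cong2[where f = "(/)"] sum.cong refl) blast

text \<open>The birth of \<open>u\<close> reads only clocks of its proper ancestors, whose labels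
  are strictly shorter. Hence it is independent of the clocks of \<open>u\<close> itself and of all
  its descendants.\<close>

lemma births_cong:
  assumes "\<And>v ob. length v < length u \<Longrightarrow> \<omega> (v, ob) = \<omega>' (v, ob)"
  shows "birth_time lam w x \<omega> u = birth_time lam w x \<omega>' u \<and> is_born lam w x \<omega> u = is_born lam w x \<omega>' u"
  using assms
proof (induction u)
  case (Cons a u)
  obtain y k where a: "a = (y, k)" by fastforce
  have eq: "\<omega> (u, ob) = \<omega>' (u, ob)" for ob by (rule Cons.prems) simp
  have IH: "birth_time lam w x \<omega> u = birth_time lam w x \<omega>' u \<and> is_born lam w x \<omega> u = is_born lam w x \<omega>' u"
    by (rule Cons.IH) (rule Cons.prems, simp)
  show ?case
    using IH birth_age_cong[of \<omega> u \<omega>', OF eq] eq[of None] by (simp add: a lifetime_def)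
qed simp

lemma depends_on_births:
  "depends_on {(v, ob). length v < length u} (\<lambda>\<omega>. is_born lam w x \<omega> u \<and> d \<le> birth_time lam w x \<omega> u)"
proof (rule depends_onI)
  fix \<omega> \<omega>' :: "'a clocks"
  assume eq: "\<And>i. i \<in> {(v, ob). length v < length u} \<Longrightarrow> \<omega> i = \<omega>' i"
    and "is_born lam w x \<omega> u \<and> d \<le> birth_time lam w x \<omega> u"
  moreover have "birth_time lam w x \<omega> u = birth_time lam w x \<omega>' u \<and> is_born lam w x \<omega> u = is_born lam w x \<omega>' u"
    by (rule births_cong) (rule eq, simp)
  ultimately show "is_born lam w x \<omega>' u \<and> d \<le> birth_time lam w x \<omega>' u" by metis
qed

lemma depends_on_is_born:
  "depends_on {(v, ob). length v < length u} (\<lambda>\<omega>. is_born lam w x \<omega> u)"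
proof (rule depends_onI)
  fix \<omega> \<omega>' :: "'a clocks"
  assume eq: "\<And>i. i \<in> {(v, ob). length v < length u} \<Longrightarrow> \<omega> i = \<omega>' i" and "is_born lam w x \<omega> u"
  moreover have "birth_time lam w x \<omega> u = birth_time lam w x \<omega>' u \<and> is_born lam w x \<omega> u = is_born lam w x \<omega>' u"
    by (rule births_cong) (rule eq, simp)
  ultimately show "is_born lam w x \<omega>' u" by metis
qed

fun born_prob :: "real \<Rightarrow> ('a \<Rightarrow> 'a \<Rightarrow> real) \<Rightarrow> 'a \<Rightarrow> 'a particle \<Rightarrow> real" where
  "born_prob lam w x [] = 1"
| "born_prob lam w x ((y, k) # u) = born_prob lam w x u * birth_prob (lam * w (position x u) y) k"

lemma born_prob_nonneg: "0 \<le> born_prob lam w x u"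
  by (induction lam w x u rule: born_prob.induct) (auto simp: birth_prob_nonneg)

lemma prob_is_born:
  fixes x :: "'a::countable"
  assumes "0 < lam" "nonneg_weights w"
  shows "measure clock_space {\<omega>. is_born lam w x \<omega> u} = born_prob lam w x u"
proof (induction u)
  case Nil then show ?case using clock_space.prob_space by simp
next
  case (Cons a u)
  obtain y k where a: "a = (y, k)" by fastforce
  let ?r = "lam * w (position x u) y"
  let ?B = "\<lambda>\<omega>. 0 < w (position x u) y \<and> birth_age lam w x \<omega> u y k < lifetime \<omega> u"
  have "measure clock_space {\<omega> \<in> space clock_space. is_born lam w x \<omega> u \<and> ?B \<omega>}
    = measure clock_space {\<omega> \<in> space clock_space. is_born lam w x \<omega> u}
      * measure clock_space {\<omega> \<in> space clock_space. ?B \<omega>}"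
    unfolding clock_space_def
  proof (rule prob_indep_pair[OF prob_space_clock, where J = "{(v, ob). length v < length u}" and K = "{(v, ob). v = u}"])
    show "{\<omega> \<in> space (PiM UNIV (\<lambda>_. clock_measure)). is_born lam w x \<omega> u} \<in> sets (PiM UNIV (\<lambda>_. clock_measure))"
      using measurable_is_born[of lam w x u] unfolding clock_space_def pred_def .
    have "Measurable.pred clock_space ?B" by measurable
    then show "{\<omega> \<in> space (PiM UNIV (\<lambda>_. clock_measure)). ?B \<omega>} \<in> sets (PiM UNIV (\<lambda>_. clock_measure))"
      unfolding clock_space_def pred_def .
    show "depends_on {(v, ob). v = u} ?B"
    proof (rule depends_onI)
      fix \<omega> \<omega>' :: "'a clocks"
      assume eq: "\<And>i. i \<in> {(v, ob). v = u} \<Longrightarrow> \<omega> i = \<omega>' i" and B: "?B \<omega>"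
      have "\<omega> (u, ob) = \<omega>' (u, ob)" for ob by (rule eq) simp
      then show "?B \<omega>'"
        using B birth_age_cong[of \<omega> u \<omega>' lam w x y k] unfolding lifetime_def by metis
    qed
  qed (auto simp: depends_on_is_born)
  moreover have "measure clock_space {\<omega> \<in> space clock_space. ?B \<omega>} = birth_prob ?r k"
  proof (cases "0 < w (position x u) y")
    case True
    then show ?thesis using prob_birth[of ?r u y k] assms by (simp add: birth_age_def lifetime_def)
  next
    case False
    then show ?thesis using assms by (simp add: birth_prob_def zero_less_mult_iff)
  qed
  ultimately show ?case using Cons by (simp add: a)
qed

lemma position_append: "position x (v @ u) = position (position x u) v"
  by (induction v) auto

lemma born_prob_append: "born_prob lam w x (v @ u) = born_prob lam w (position x u) v * born_prob lam w x u"
  by (induction v) (auto simp: position_append)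

subsection \<open>Expected number of particles\<close>

text \<open>Labels grow at the head, so the last entry belongs to the ancestor in the first
  generation. Splitting it off removes the first step of the trajectory, as the recursion of
  \<open>weight_power\<close> does.\<close>

lemma nn_integral_particles_Suc:
  fixes f :: "'a particle \<Rightarrow> ennreal"
  assumes "f [] = 0"
  shows "(\<integral>\<^sup>+u. f u \<partial>count_space UNIV)
    = (\<integral>\<^sup>+y. (\<Sum>k. \<integral>\<^sup>+v. f (v @ [(y, k)]) \<partial>count_space UNIV) \<partial>count_space UNIV)"
proof -
  have bij: "bij_betw (\<lambda>(y, k, v). v @ [(y, k)]) UNIV {u :: 'a particle. u \<noteq> []}"
  proof (rule bij_betwI')
    fix u :: "'a particle" assume "u \<in> {u. u \<noteq> []}"
    then show "\<exists>z\<in>UNIV. u = (case z of (y, k, v) \<Rightarrow> v @ [(y, k)])"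
      by (cases u rule: rev_cases) auto
  qed auto
  have "(\<integral>\<^sup>+u. f u \<partial>count_space UNIV) = (\<integral>\<^sup>+u. f u * indicator {u. u \<noteq> []} u \<partial>count_space UNIV)"
    using assms by (intro nn_integral_cong) (auto simp: indicator_def)
  also have "\<dots> = (\<integral>\<^sup>+u. f u \<partial>count_space {u. u \<noteq> []})"
    by (subst nn_integral_count_space_indicator) auto
  also have "\<dots> = (\<integral>\<^sup>+z. f (case z of (y, k, v) \<Rightarrow> v @ [(y, k)]) \<partial>count_space UNIV)"
    by (rule nn_integral_bij_count_space[OF bij, symmetric])
  also have "\<dots> = (\<integral>\<^sup>+y. \<integral>\<^sup>+z. f (case (y, z) of (y, k, v) \<Rightarrow> v @ [(y, k)]) \<partial>count_space UNIV \<partial>count_space UNIV)"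
    by (rule nn_integral_fst_count_space[symmetric])
  also have "\<dots> = (\<integral>\<^sup>+y. \<integral>\<^sup>+k. \<integral>\<^sup>+v. f (case (y, k, v) of (y, k, v) \<Rightarrow> v @ [(y, k)]) \<partial>count_space UNIV \<partial>count_space UNIV \<partial>count_space UNIV)"
    by (intro nn_integral_cong nn_integral_fst_count_space[symmetric])
  also have "\<dots> = (\<integral>\<^sup>+y. (\<Sum>k. \<integral>\<^sup>+v. f (v @ [(y, k)]) \<partial>count_space UNIV) \<partial>count_space UNIV)"
    by (simp add: nn_integral_count_space_nat)
  finally show ?thesis .
qed

definition particles :: "nat \<Rightarrow> 'a \<Rightarrow> 'a \<Rightarrow> 'a particle set" where
  "particles n x y = {u. length u = n \<and> position x u = y}"

text \<open>Summing over the birth ranks \<open>k\<close> replaces the children at \<open>z\<close>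
  of a parent at \<open>x\<close> by their mean \<open>lam * w x z\<close>; what remains is the
  recursion of \<open>weight_power\<close>.\<close>

lemma expected_particles:
  assumes "0 < lam" "nonneg_weights w" "finite_rows w"
  shows "(\<integral>\<^sup>+u. ennreal (born_prob lam w x u) * indicator (particles n x y) u \<partial>count_space UNIV)
    = ennreal (lam ^ n * weight_power w n x y)"
proof (induction n arbitrary: x)
  case 0
  have "(\<integral>\<^sup>+u. ennreal (born_prob lam w x u) * indicator (particles 0 x y) u \<partial>count_space UNIV)
    = (\<integral>\<^sup>+u. (if x = y then 1 else 0) * indicator {[] :: 'a particle} u \<partial>count_space UNIV)"
    by (intro nn_integral_cong) (auto simp: indicator_def particles_def)
  then show ?case by (simp add: nn_integral_count_space_indicator one_ennreal_def[symmetric])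
next
  case (Suc n)
  let ?S = "{z. 0 < w x z}"
  have S: "finite ?S" using assms unfolding finite_rows_def by auto
  have mem: "v @ [(z, k)] \<in> particles (Suc n) x y \<longleftrightarrow> v \<in> particles n z y" for v z k
    by (auto simp: particles_def position_append)
  have "(\<integral>\<^sup>+u. ennreal (born_prob lam w x u) * indicator (particles (Suc n) x y) u \<partial>count_space UNIV)
    = (\<integral>\<^sup>+z. (\<Sum>k. \<integral>\<^sup>+v. ennreal (born_prob lam w x (v @ [(z, k)]))
          * indicator (particles (Suc n) x y) (v @ [(z, k)]) \<partial>count_space UNIV) \<partial>count_space UNIV)"
    by (rule nn_integral_particles_Suc) (simp add: particles_def)
  also have "\<dots> = (\<integral>\<^sup>+z. (\<Sum>k. \<integral>\<^sup>+v. ennreal (birth_prob (lam * w x z) k) * (ennreal (born_prob lam w z v)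
          * indicator (particles n z y) v) \<partial>count_space UNIV) \<partial>count_space UNIV)"
    by (intro nn_integral_cong arg_cong[where f = suminf] ext)
       (auto simp: born_prob_append indicator_def mem born_prob_nonneg birth_prob_nonneg ennreal_mult mult.commute)
  also have "\<dots> = (\<integral>\<^sup>+z. (\<Sum>k. ennreal (birth_prob (lam * w x z) k) * ennreal (lam ^ n * weight_power w n z y)) \<partial>count_space UNIV)"
    by (simp add: nn_integral_cmult Suc)
  also have "\<dots> = (\<integral>\<^sup>+z. ennreal (lam * w x z) * ennreal (lam ^ n * weight_power w n z y) \<partial>count_space UNIV)"
    using assms by (intro nn_integral_cong) (simp add: birth_prob_sums nonneg_weights_def)
  also have "\<dots> = (\<Sum>z\<in>?S. ennreal (lam * w x z) * ennreal (lam ^ n * weight_power w n z y))"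
  proof (rule nn_integral_count_space'[OF S])
    show "ennreal (lam * w x z) * ennreal (lam ^ n * weight_power w n z y) = 0" if "z \<notin> ?S" for z
    proof -
      have "w x z = 0" using that assms(2) by (simp add: nonneg_weights_def not_less antisym)
      then show ?thesis by simp
    qed
  qed auto
  also have "\<dots> = (\<Sum>z\<in>?S. ennreal (lam * lam ^ n * (w x z * weight_power w n z y)))"
    using assms by (intro sum.cong) (auto simp: mult_ac weight_power_nonneg simp flip: ennreal_mult)
  also have "\<dots> = ennreal (lam ^ Suc n * weight_power w (Suc n) x y)"
    unfolding weight_power_Suc_sum[OF assms(2) S order_refl]
    using assms by (subst sum_ennreal) (auto simp: sum_distrib_left weight_power_nonneg intro!: mult_nonneg_nonneg)
  finally show ?case .
qed

text \<open>The uncountable quantifiers over times must go. \<open>T\<close> may be a natural number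
  \<open>m\<close>, and a label contributes after \<open>m\<close> exactly when the larger of
  \<open>m\<close> and its birth time precedes its death. The maximum also covers a label with
  nonpositive lifetime, which is never alive.\<close>

lemma measurable_local_extinction:
  fixes x :: "'a::countable"
  shows "Measurable.pred clock_space (\<lambda>\<omega>. \<exists>T. \<forall>t\<ge>T. brw lam w x \<omega> t x = 0)"
proof -
  have "(\<exists>T. \<forall>t\<ge>T. brw lam w x \<omega> t x = 0) \<longleftrightarrow>
    (\<exists>m::nat. \<forall>u. is_born lam w x \<omega> u \<longrightarrow> position x u = x \<longrightarrow>
       birth_time lam w x \<omega> u + lifetime \<omega> u \<le> max (real m) (birth_time lam w x \<omega> u))" (is "?L \<longleftrightarrow> ?R") for \<omega>
  proof
    have zero: "brw lam w x \<omega> t x = 0 \<longleftrightarrow> alive_at lam w x \<omega> t x = {}" for t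
      by (auto simp: brw_def zero_enat_def)
    {
      assume ?L
      then obtain T where T: "\<And>t. t \<ge> T \<Longrightarrow> alive_at lam w x \<omega> t x = {}" using zero by blast
      obtain m :: nat where m: "T \<le> real m" using real_arch_simple by blast
      have "birth_time lam w x \<omega> u + lifetime \<omega> u \<le> max (real m) (birth_time lam w x \<omega> u)"
        if "is_born lam w x \<omega> u" "position x u = x" for u
      proof (rule ccontr)
        assume "\<not> ?thesis"
        then have "u \<in> alive_at lam w x \<omega> (max (real m) (birth_time lam w x \<omega> u)) x"
          using that by (auto simp: alive_at_def)
        then show False using T m by (metis empty_iff max.coboundedI1)
      qed
      then show ?R by blast
    next
      assume ?R
      then obtain m :: nat where m: "\<And>u. is_born lam w x \<omega> u \<Longrightarrow> position x u = x \<Longrightarrow>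
       birth_time lam w x \<omega> u + lifetime \<omega> u \<le> max (real m) (birth_time lam w x \<omega> u)" by blast
      have "alive_at lam w x \<omega> t x = {}" if "t \<ge> real m" for t
        using m that unfolding alive_at_def by fastforce
      then show ?L using zero by blast
    }
  qed
  then have eq: "(\<lambda>\<omega>. \<exists>T. \<forall>t\<ge>T. brw lam w x \<omega> t x = 0) = (\<lambda>\<omega>. \<exists>m::nat. \<forall>u. is_born lam w x \<omega> u \<longrightarrow>
      position x u = x \<longrightarrow> birth_time lam w x \<omega> u + lifetime \<omega> u \<le> max (real m) (birth_time lam w x \<omega> u))"
    by (rule ext)
  have "Measurable.pred clock_space (\<lambda>\<omega>. is_born lam w x \<omega> u \<longrightarrow> position x u = x \<longrightarrow>
      birth_time lam w x \<omega> u + lifetime \<omega> u \<le> max (real m) (birth_time lam w x \<omega> u))" for u and m :: nat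
  proof -
    have "(\<lambda>\<omega>. birth_time lam w x \<omega> u + lifetime \<omega> u) \<in> borel_measurable clock_space"
      by (intro borel_measurable_add measurable_birth_time measurable_lifetime)
    moreover have "(\<lambda>\<omega>. max (real m) (birth_time lam w x \<omega> u)) \<in> borel_measurable clock_space"
      by (intro borel_measurable_max borel_measurable_const measurable_birth_time)
    ultimately have "Measurable.pred clock_space (\<lambda>\<omega>. birth_time lam w x \<omega> u + lifetime \<omega> u \<le> max (real m) (birth_time lam w x \<omega> u))"
      unfolding pred_def by (rule borel_measurable_le)
    then show ?thesis by (intro pred_intros_logic measurable_is_born measurable_const) simp_all
  qed
  then show ?thesis unfolding eq by (intro pred_intros_countable)
qed

text \<open>By Tonelli the sum is the expected number of labels ever born at \<open>x\<close>. So
  almost surely there are finitely many of them, and finitely many particles have a last time of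
  death.\<close>

lemma local_extinction_prob_eq_1:
  fixes x :: "'a::countable"
  assumes "0 < lam" "nonneg_weights w" "finite_rows w"
    and "summable (\<lambda>n. lam ^ n * weight_power w n x x)"
  shows "local_extinction_prob lam w x = 1"
proof -
  let ?S = "{u. position x u = x}"
  have cnt: "countable (UNIV :: 'a particle set)" by simp
  have "(\<integral>\<^sup>+\<omega>. \<integral>\<^sup>+u. indicator {\<omega>. is_born lam w x \<omega> u} \<omega> * indicator ?S u \<partial>count_space UNIV \<partial>clock_space)
     = (\<integral>\<^sup>+u. \<integral>\<^sup>+\<omega>. indicator {\<omega>. is_born lam w x \<omega> u} \<omega> * indicator ?S u \<partial>clock_space \<partial>count_space UNIV)"
    by (rule nn_integral_count_space_nn_integral[OF cnt])
       (intro borel_measurable_times_ennreal borel_measurable_indicator sets_is_born borel_measurable_const)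
  also have "\<dots> = (\<integral>\<^sup>+u. ennreal (born_prob lam w x u) * indicator ?S u \<partial>count_space UNIV)"
  proof (rule nn_integral_cong)
    fix u :: "'a particle"
    have "emeasure clock_space {\<omega>. is_born lam w x \<omega> u} = ennreal (born_prob lam w x u)"
      by (simp only: clock_space.emeasure_eq_measure prob_is_born[OF assms(1,2)])
    then show "(\<integral>\<^sup>+\<omega>. indicator {\<omega>. is_born lam w x \<omega> u} \<omega> * indicator ?S u \<partial>clock_space)
        = ennreal (born_prob lam w x u) * indicator ?S u"
      by (subst nn_integral_multc) (simp_all only: nn_integral_indicator sets_is_born borel_measurable_indicator)
  qed
  also have "\<dots> = (\<integral>\<^sup>+u. (\<Sum>n. ennreal (born_prob lam w x u) * indicator (particles n x x) u) \<partial>count_space UNIV)"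
  proof (rule nn_integral_cong)
    fix u :: "'a particle"
    have "(\<Sum>n. ennreal (born_prob lam w x u) * indicator (particles n x x) u)
       = (\<Sum>n\<in>{length u}. ennreal (born_prob lam w x u) * indicator (particles n x x) u)"
      by (rule suminf_finite) (auto simp: particles_def)
    then show "ennreal (born_prob lam w x u) * indicator ?S u = (\<Sum>n. ennreal (born_prob lam w x u) * indicator (particles n x x) u)"
      by (simp add: particles_def indicator_def)
  qed
  also have "\<dots> = (\<Sum>n. ennreal (lam ^ n * weight_power w n x x))"
    by (subst nn_integral_suminf) (simp_all only: expected_particles[OF assms(1-3)] measurable_count_space_eq1 UNIV_I Pi_UNIV space_borel)
  also have "\<dots> < \<infinity>"
  proof -
    have "(\<Sum>n. ennreal (lam ^ n * weight_power w n x x)) = ennreal (\<Sum>n. lam ^ n * weight_power w n x x)"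
      by (rule suminf_ennreal_eq[OF _ summable_sums[OF assms(4)]])
         (intro mult_nonneg_nonneg zero_le_power less_imp_le[OF assms(1)] weight_power_nonneg assms(2))
    then show ?thesis by (simp only: infinity_ennreal_def ennreal_less_top)
  qed
  finally have "AE \<omega> in clock_space. (\<integral>\<^sup>+u. indicator {\<omega>. is_born lam w x \<omega> u} \<omega> * indicator ?S u \<partial>count_space UNIV) \<noteq> \<infinity>"
  proof (intro nn_integral_PInf_AE)
    interpret C: sigma_finite_measure "count_space (UNIV :: 'a particle set)"
      by (rule sigma_finite_measure_count_space_countable[OF cnt])
    have f: "(\<lambda>\<omega>. indicator {\<omega>. is_born lam w x \<omega> u} \<omega> * indicator ?S u :: ennreal) \<in> borel_measurable clock_space" for u
      by (intro borel_measurable_times_ennreal borel_measurable_indicator sets_is_born borel_measurable_const)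
    have "(\<lambda>p. indicator {\<omega>. is_born lam w x \<omega> (snd p)} (fst p) * indicator ?S (snd p) :: ennreal)
        \<in> borel_measurable (clock_space \<Otimes>\<^sub>M count_space UNIV)"
      by (rule measurable_compose_countable[OF measurable_compose[OF measurable_fst f] measurable_snd])
    then show "(\<lambda>\<omega>. \<integral>\<^sup>+u. indicator {\<omega>. is_born lam w x \<omega> u} \<omega> * indicator ?S u \<partial>count_space UNIV) \<in> borel_measurable clock_space"
      by (intro C.borel_measurable_nn_integral) (simp only: case_prod_beta')
  qed simp
  then have "AE \<omega> in clock_space. \<exists>T. \<forall>t\<ge>T. brw lam w x \<omega> t x = 0"
  proof eventually_elim
    case (elim \<omega>)
    let ?B = "{u. is_born lam w x \<omega> u \<and> position x u = x}"
    have "(\<integral>\<^sup>+u. indicator {\<omega>. is_born lam w x \<omega> u} \<omega> * indicator ?S u \<partial>count_space UNIV) = (\<integral>\<^sup>+u. indicator ?B u \<partial>count_space UNIV)"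
      by (intro nn_integral_cong) (auto simp: indicator_def)
    then have "emeasure (count_space UNIV) ?B \<noteq> \<infinity>" using elim by simp
    then have fin: "finite ?B" by (auto simp: emeasure_count_space split: if_splits)
    define T where "T = Max (insert 0 ((\<lambda>u. birth_time lam w x \<omega> u + lifetime \<omega> u) ` ?B))"
    have "alive_at lam w x \<omega> t x = {}" if "t \<ge> T" for t
    proof -
      have "birth_time lam w x \<omega> u + lifetime \<omega> u \<le> t" if "u \<in> ?B" for u
        using that fin \<open>t \<ge> T\<close> by (auto simp: T_def)
      then show ?thesis by (fastforce simp: alive_at_def)
    qed
    then show ?case by (intro exI[of _ T]) (simp add: brw_def zero_enat_def)
  qed
  then show ?thesis
    unfolding local_extinction_prob_def
    by (subst clock_space.prob_Collect_eq_1) (use measurable_local_extinction[of lam w x] in \<open>simp_all only: pred_def\<close>)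
qed

subsection \<open>Local survival\<close>

text \<open>A finite set of labels gives the embedded process bounded offspring, as the
  second-moment estimate requires. It exists because the sum over countably many labels is the
  supremum of its finite partial sums.\<close>

lemma finite_particles_expectation:
  fixes x :: "'a::countable"
  assumes "0 < lam" "nonneg_weights w" "finite_rows w" "1 < lam ^ n * weight_power w n x y"
  obtains L where "finite L" "L \<subseteq> particles n x y" "1 < (\<Sum>u\<in>L. born_prob lam w x u)"
proof -
  define f where "f u = ennreal (born_prob lam w x u) * indicator (particles n x y) u" for u
  let ?S = "range (to_nat :: 'a particle \<Rightarrow> nat)"
  have "(\<integral>\<^sup>+u. f u \<partial>count_space UNIV) = (\<integral>\<^sup>+m. f (from_nat m) \<partial>count_space ?S)"
    using nn_integral_bij_count_space[of "to_nat :: 'a particle \<Rightarrow> nat" UNIV ?S "\<lambda>m. f (from_nat m)"]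
    by (simp add: bij_betw_def)
  also have "\<dots> = (\<Sum>m. f (from_nat m) * indicator ?S m)"
    by (subst nn_integral_count_space_nat[symmetric], subst nn_integral_count_space_indicator) auto
  also have "\<dots> = (SUP N. \<Sum>m<N. f (from_nat m) * indicator ?S m)"
    by (rule suminf_eq_SUP)
  finally have "ennreal (lam ^ n * weight_power w n x y) = (SUP N. \<Sum>m<N. f (from_nat m) * indicator ?S m)"
    unfolding f_def expected_particles[OF assms(1-3)] .
  moreover have "1 < ennreal (lam ^ n * weight_power w n x y)"
    using assms(4) by simp
  ultimately have "1 < (SUP N. \<Sum>m<N. f (from_nat m) * indicator ?S m)" by simp
  then obtain N where N: "1 < (\<Sum>m<N. f (from_nat m) * indicator ?S m)"
    unfolding less_SUP_iff by blast
  define L where "L = from_nat ` ({..<N} \<inter> ?S) \<inter> particles n x y"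
  have inj: "inj_on (from_nat :: nat \<Rightarrow> 'a particle) ({..<N} \<inter> ?S)"
    by (rule inj_onI) auto
  have "(\<Sum>m<N. f (from_nat m) * indicator ?S m) = (\<Sum>m\<in>{..<N} \<inter> ?S. f (from_nat m))"
    by (intro sum.mono_neutral_cong_right) (auto simp: indicator_def)
  also have "\<dots> = (\<Sum>u\<in>from_nat ` ({..<N} \<inter> ?S). f u)"
    by (subst sum.reindex[OF inj]) simp
  also have "\<dots> = (\<Sum>u\<in>L. ennreal (born_prob lam w x u))"
    by (intro sum.mono_neutral_cong_right) (auto simp: L_def f_def)
  also have "\<dots> = ennreal (\<Sum>u\<in>L. born_prob lam w x u)"
    by (intro sum_ennreal born_prob_nonneg)
  finally have "1 < (\<Sum>u\<in>L. born_prob lam w x u)"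
    using N by (simp add: ennreal_1[symmetric] ennreal_less_iff del: ennreal_1)
  then show ?thesis by (intro that[of L]) (auto simp: L_def)
qed

lemma birth_time_pos:
  assumes "\<And>i. 0 < \<omega> i" "0 < lam" "is_born lam w x \<omega> u"
  shows "0 \<le> birth_time lam w x \<omega> u \<and> (u \<noteq> [] \<longrightarrow> 0 < birth_time lam w x \<omega> u)"
  using assms(3)
proof (induction u)
  case (Cons a u)
  obtain y k where a: "a = (y, k)" by fastforce
  have "0 < (\<Sum>i\<le>k. \<omega> (u, Some (y, i)))" by (intro sum_pos assms) auto
  then have "0 < birth_age lam w x \<omega> u y k"
    using Cons.prems assms(2) by (simp add: a birth_age_def)
  then show ?case using Cons by (simp add: a)
qed simp

text \<open>A particle other than the initial one is almost surely born at a strictly positive time,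
  so demanding a small delay costs nothing in the limit.\<close>

lemma tendsto_prob_late_birth:
  fixes x :: "'a::countable"
  assumes "0 < lam" "nonneg_weights w" "u \<noteq> []"
  shows "(\<lambda>j. measure clock_space {\<omega>. is_born lam w x \<omega> u \<and> 1 / real (Suc j) \<le> birth_time lam w x \<omega> u})
    \<longlonglongrightarrow> born_prob lam w x u"
proof -
  let ?A = "\<lambda>j. {\<omega>. is_born lam w x \<omega> u \<and> 1 / real (Suc j) \<le> birth_time lam w x \<omega> u}"
  have meas: "?A j \<in> sets clock_space" for j
  proof -
    have "Measurable.pred clock_space (\<lambda>\<omega>. is_born lam w x \<omega> u \<and> 1 / real (Suc j) \<le> birth_time lam w x \<omega> u)"
      by measurable
    then show ?thesis by (simp add: pred_def)
  qed
  have "incseq ?A"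
  proof (rule incseq_SucI)
    fix j
    have "1 / real (Suc (Suc j)) \<le> 1 / real (Suc j)" by (simp add: field_simps)
    then show "?A j \<subseteq> ?A (Suc j)" by (auto intro: order_trans)
  qed
  then have "(\<lambda>j. measure clock_space (?A j)) \<longlonglongrightarrow> measure clock_space (\<Union>j. ?A j)"
    by (intro clock_space.finite_Lim_measure_incseq) (use meas in auto)
  also have "measure clock_space (\<Union>j. ?A j) = measure clock_space {\<omega>. is_born lam w x \<omega> u}"
  proof (rule clock_space.finite_measure_eq_AE)
    show "AE \<omega> in clock_space. (\<omega> \<in> (\<Union>j. ?A j)) = (\<omega> \<in> {\<omega>. is_born lam w x \<omega> u})"
      using AE_clock_pos
    proof eventually_elim
      case (elim \<omega>)
      have "\<exists>j. 1 / real (Suc j) \<le> birth_time lam w x \<omega> u" if "is_born lam w x \<omega> u"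
      proof -
        have "0 < birth_time lam w x \<omega> u"
          using birth_time_pos[of \<omega> lam w x u] elim that assms by blast
        then show ?thesis using reals_Archimedean[of "birth_time lam w x \<omega> u"]
          by (auto simp: inverse_eq_divide intro: less_imp_le)
      qed
      then show ?case by auto
    qed
  qed (use meas sets_is_born in auto)
  also have "\<dots> = born_prob lam w x u" by (rule prob_is_born[OF assms(1,2)])
  finally show ?thesis .
qed

section \<open>The branching property and the embedded Galton-Watson process\<close>

definition shift_clocks :: "'a particle \<Rightarrow> 'a clocks \<Rightarrow> 'a clocks" where
  "shift_clocks v \<omega> = (\<lambda>(u, ob). \<omega> (u @ v, ob))"

text \<open>Appending \<open>v\<close> is an injection of labels, and a product of identical laws is
  invariant under restriction along an injection. So the subtree of \<open>v\<close> evolves like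
  the whole process.\<close>

lemma
  fixes v :: "'a particle"
  shows distr_shift: "distr clock_space clock_space (shift_clocks v) = clock_space"
  and measurable_shift: "shift_clocks v \<in> clock_space \<rightarrow>\<^sub>M clock_space"
proof -
  let ?f = "\<lambda>(u, ob :: ('a \<times> nat) option). (u @ v, ob)"
  have eq: "(\<lambda>\<omega>. \<lambda>n\<in>UNIV. \<omega> (?f n)) = shift_clocks v"
    by (auto simp: shift_clocks_def fun_eq_iff)
  have "distr (PiM UNIV (\<lambda>_. clock_measure)) (PiM UNIV (\<lambda>_. clock_measure))
      (\<lambda>\<omega>. \<lambda>n\<in>UNIV. \<omega> (?f n)) = PiM UNIV (\<lambda>_. clock_measure)"
    by (rule distr_PiM_reindex[where M = "\<lambda>_. clock_measure"]) (auto simp: inj_on_def intro: prob_space_clock)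
  then show "distr clock_space clock_space (shift_clocks v) = clock_space"
    unfolding eq clock_space_def .
  show "shift_clocks v \<in> clock_space \<rightarrow>\<^sub>M clock_space"
    unfolding eq[symmetric] clock_space_def
    by (intro measurable_restrict measurable_component_singleton) simp
qed

lemma shift_births:
  "birth_time lam w x \<omega> (u @ v) = birth_time lam w x \<omega> v + birth_time lam w (position x v) (shift_clocks v \<omega>) u \<and>
   (is_born lam w x \<omega> (u @ v) \<longleftrightarrow> is_born lam w x \<omega> v \<and> is_born lam w (position x v) (shift_clocks v \<omega>) u)"
proof (induction u)
  case (Cons a u)
  obtain y k where a: "a = (y, k)" by fastforce
  have "birth_age lam w (position x v) (shift_clocks v \<omega>) u y k = birth_age lam w x \<omega> (u @ v) y k"
    "lifetime (shift_clocks v \<omega>) u = lifetime \<omega> (u @ v)"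
    by (simp_all add: birth_age_def lifetime_def shift_clocks_def position_append)
  then show ?case using Cons by (simp add: a position_append)
qed simp

text \<open>
  A Galton-Watson process embedded in the branching random walk: only the particles with label in
  \<open>L\<close> relative to their ancestor, and with a delay of at least \<open>d\<close> after it, are kept. The delay
  makes survival of this process force births at arbitrarily late times.
\<close>

primrec lineage :: "real \<Rightarrow> ('a \<Rightarrow> 'a \<Rightarrow> real) \<Rightarrow> 'a \<Rightarrow> real \<Rightarrow> 'a particle set \<Rightarrow> nat \<Rightarrow> 'a clocks \<Rightarrow> bool" where
  "lineage lam w x d L 0 \<omega> = True"
| "lineage lam w x d L (Suc m) \<omega> =
     (\<exists>v\<in>L. (is_born lam w x \<omega> v \<and> d \<le> birth_time lam w x \<omega> v) \<and> lineage lam w x d L m (shift_clocks v \<omega>))"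

lemma pred_late_birth: "Measurable.pred clock_space (\<lambda>\<omega>. is_born lam w x \<omega> v \<and> d \<le> birth_time lam w x \<omega> v)"
  by measurable

lemma measurable_lineage:
  assumes "finite L"
  shows "Measurable.pred clock_space (lineage lam w x d L m)"
proof (induction m)
  case (Suc m)
  have "Measurable.pred clock_space (\<lambda>\<omega>. lineage lam w x d L m (shift_clocks v \<omega>))" for v
    by (rule measurable_compose[OF measurable_shift Suc])
  then show ?case unfolding lineage.simps
    by (intro pred_intros_finite pred_intros_logic pred_late_birth assms)
qed simp

lemma lineage_imp_late_birth:
  assumes "L \<subseteq> particles n x x" "lineage lam w x d L m \<omega>"
  shows "\<exists>u. is_born lam w x \<omega> u \<and> position x u = x \<and> real m * d \<le> birth_time lam w x \<omega> u"
  using assms(2)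
proof (induction m arbitrary: \<omega>)
  case 0 show ?case by (intro exI[of _ "[]"]) simp
next
  case (Suc m)
  then obtain v where v: "v \<in> L" "is_born lam w x \<omega> v" "d \<le> birth_time lam w x \<omega> v"
    "lineage lam w x d L m (shift_clocks v \<omega>)" by auto
  then have pos: "position x v = x" using assms(1) by (auto simp: particles_def)
  from Suc.IH[OF v(4)] obtain u where "is_born lam w x (shift_clocks v \<omega>) u" "position x u = x"
    "real m * d \<le> birth_time lam w x (shift_clocks v \<omega>) u" by blast
  then show ?case using shift_births[of lam w x \<omega> u v] v pos
    by (intro exI[of _ "u @ v"]) (auto simp: position_append algebra_simps)
qed

lemma prob_shift:
  assumes "Measurable.pred clock_space P"
  shows "measure clock_space {\<omega>. P (shift_clocks v \<omega>)} = measure clock_space {\<omega>. P \<omega>}"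
proof -
  have "measure clock_space {\<omega>. P \<omega>} = measure (distr clock_space clock_space (shift_clocks v)) {\<omega>. P \<omega>}"
    by (simp add: distr_shift)
  also have "\<dots> = measure clock_space {\<omega>. P (shift_clocks v \<omega>)}"
    using assms by (subst measure_distr[OF measurable_shift]) (auto simp: pred_def vimage_def)
  finally show ?thesis ..
qed

lemma depends_on_shift: "depends_on {(u @ v, ob) | u ob. True} (\<lambda>\<omega>. P (shift_clocks v \<omega>))"
proof (rule depends_onI)
  fix \<omega> \<omega>' :: "'a clocks"
  assume "\<And>i. i \<in> {(u @ v, ob) | u ob. True} \<Longrightarrow> \<omega> i = \<omega>' i" and P: "P (shift_clocks v \<omega>)"
  then have "shift_clocks v \<omega> = shift_clocks v \<omega>'" by (auto simp: shift_clocks_def fun_eq_iff)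
  then show "P (shift_clocks v \<omega>')" using P by simp
qed

lemma prob_clock_indep:
  assumes "Measurable.pred clock_space A" "Measurable.pred clock_space B"
    and "depends_on J A" "depends_on K B" "J \<inter> K = {}"
  shows "measure clock_space {\<omega>. A \<omega> \<and> B \<omega>} = measure clock_space {\<omega>. A \<omega>} * measure clock_space {\<omega>. B \<omega>}"
proof -
  have "measure clock_space {\<omega> \<in> space clock_space. A \<omega> \<and> B \<omega>}
    = measure clock_space {\<omega> \<in> space clock_space. A \<omega>} * measure clock_space {\<omega> \<in> space clock_space. B \<omega>}"
    unfolding clock_space_def
    by (rule prob_indep_pair[OF prob_space_clock _ _ assms(5) _ assms(3) _ assms(4)])
       (use assms(1,2) in \<open>simp_all only: pred_def clock_space_def subset_UNIV\<close>)
  then show ?thesis by simp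
qed

text \<open>The second-moment method in linear form: the right side is 1 - (1 - c k)^2. Taking
  expectations and then the best \<open>c\<close> gives the Cauchy-Schwarz bound for the probability
  that \<open>k\<close> is positive, without dividing by a second moment.\<close>

lemma second_moment_bound:
  fixes c :: real
  shows "(if 0 < k then 1 else 0) \<ge> 2 * c * real k - c\<^sup>2 * (real k)\<^sup>2"
proof -
  have "0 \<le> (1 - c * real k)\<^sup>2" by simp
  then show ?thesis by (auto simp: power2_eq_square algebra_simps)
qed

text \<open>\<open>N\<close> counts the labels in \<open>L\<close> that are born late and have a
  subtree surviving \<open>m\<close> generations. Its mean is \<open>a * s\<close>. Labels in
  \<open>L\<close> have equal length, so distinct ones own disjoint sets of clocks, and each
  off-diagonal pair contributes at most the square of \<open>s\<close>.\<close>

lemma prob_lineage_Suc_ge: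
  fixes x :: "'a::countable" and c lam d :: real and w :: "'a \<Rightarrow> 'a \<Rightarrow> real" and m :: nat
  assumes "finite L" "L \<subseteq> particles n x x" "0 \<le> c"
  defines "s \<equiv> measure clock_space {\<omega>. lineage lam w x d L m \<omega>}"
    and "a \<equiv> (\<Sum>v\<in>L. measure clock_space {\<omega>. is_born lam w x \<omega> v \<and> d \<le> birth_time lam w x \<omega> v})"
  shows "2 * c * (a * s) - c\<^sup>2 * (a * s + (real (card L))\<^sup>2 * s\<^sup>2)
      \<le> measure clock_space {\<omega>. lineage lam w x d L (Suc m) \<omega>}"
proof -
  let ?P = "measure clock_space"
  let ?G = "\<lambda>v \<omega>. is_born lam w x \<omega> v \<and> d \<le> birth_time lam w x \<omega> v"
  let ?S = "\<lambda>v \<omega>. lineage lam w x d L m (shift_clocks v \<omega>)"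
  define A where "A v = {\<omega>. ?G v \<omega> \<and> ?S v \<omega>}" for v
  have len: "length v = n" if "v \<in> L" for v using that assms(2) by (auto simp: particles_def)
  have mS: "Measurable.pred clock_space (?S v)" for v
    by (rule measurable_compose[OF measurable_shift measurable_lineage[OF assms(1)]])
  have A: "A v \<in> sets clock_space" for v
  proof -
    have "Measurable.pred clock_space (\<lambda>\<omega>. ?G v \<omega> \<and> ?S v \<omega>)"
      by (intro pred_intros_logic pred_late_birth mS)
    then show ?thesis by (simp add: pred_def A_def)
  qed
  have S: "?P {\<omega>. ?S v \<omega>} = s" for v
    unfolding s_def by (rule prob_shift[OF measurable_lineage[OF assms(1)]])
  have PA: "?P (A v) = ?P {\<omega>. ?G v \<omega>} * s" if "v \<in> L" for v
    unfolding A_def S[symmetric, of v]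
    by (rule prob_clock_indep[OF pred_late_birth mS depends_on_births depends_on_shift]) auto
  have PAA: "?P (A v \<inter> A v') \<le> s\<^sup>2" if "v \<in> L" "v' \<in> L" "v \<noteq> v'" for v v'
  proof -
    have "?P (A v \<inter> A v') \<le> ?P {\<omega>. ?S v \<omega> \<and> ?S v' \<omega>}"
    proof (rule clock_space.finite_measure_mono)
      have "Measurable.pred clock_space (\<lambda>\<omega>. ?S v \<omega> \<and> ?S v' \<omega>)" by (intro pred_intros_logic mS)
      then show "{\<omega>. ?S v \<omega> \<and> ?S v' \<omega>} \<in> sets clock_space" by (simp add: pred_def)
    qed (auto simp: A_def)
    also have "\<dots> = ?P {\<omega>. ?S v \<omega>} * ?P {\<omega>. ?S v' \<omega>}"
      by (rule prob_clock_indep[OF mS mS depends_on_shift depends_on_shift])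
         (use that len[OF that(1)] len[OF that(2)] in \<open>auto simp: append_eq_append_conv\<close>)
    finally show ?thesis by (simp add: S power2_eq_square)
  qed
  have sumA: "(\<Sum>v\<in>L. ?P (A v)) = a * s"
    unfolding a_def sum_distrib_right by (intro sum.cong PA) auto
  define N where "N \<omega> = card {v \<in> L. \<omega> \<in> A v}" for \<omega>
  have N1: "real (N \<omega>) = (\<Sum>v\<in>L. indicator (A v) \<omega>)" for \<omega>
    using assms(1) by (simp add: N_def indicator_def sum.If_cases Int_def)
  have N2: "(real (N \<omega>))\<^sup>2 = (\<Sum>v\<in>L. \<Sum>v'\<in>L. indicator (A v \<inter> A v') \<omega>)" for \<omega>
    unfolding N1 power2_eq_square by (simp add: sum_product indicator_inter_arith)
  have int1: "integrable clock_space (indicat_real B)" if "B \<in> sets clock_space" for B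
    using that by (simp add: clock_space.emeasure_eq_measure)
  have "(\<Sum>v\<in>L. \<Sum>v'\<in>L. ?P (A v \<inter> A v')) \<le> (\<Sum>v\<in>L. \<Sum>v'\<in>L. (if v' = v then ?P (A v) else 0) + s\<^sup>2)"
    using PAA by (intro sum_mono) auto
  also have "\<dots> = a * s + (real (card L))\<^sup>2 * s\<^sup>2"
    using assms(1) sumA by (simp add: sum.distrib power2_eq_square algebra_simps)
  finally have pairs: "(\<Sum>v\<in>L. \<Sum>v'\<in>L. ?P (A v \<inter> A v')) \<le> a * s + (real (card L))\<^sup>2 * s\<^sup>2" .
  have i1: "integrable clock_space (\<lambda>\<omega>. real (N \<omega>))"
    unfolding N1 using A int1 by (intro Bochner_Integration.integrable_sum) auto
  have i2: "integrable clock_space (\<lambda>\<omega>. (real (N \<omega>))\<^sup>2)"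
    unfolding N2 by (intro Bochner_Integration.integrable_sum int1 sets.Int A)
  have e1: "(\<integral>\<omega>. real (N \<omega>) \<partial>clock_space) = a * s"
    unfolding N1 using A int1 by (subst Bochner_Integration.integral_sum) (auto simp: sumA)
  have e2: "(\<integral>\<omega>. (real (N \<omega>))\<^sup>2 \<partial>clock_space) = (\<Sum>v\<in>L. \<Sum>v'\<in>L. ?P (A v \<inter> A v'))"
  proof -
    have "(\<integral>\<omega>. (real (N \<omega>))\<^sup>2 \<partial>clock_space) = (\<Sum>v\<in>L. \<integral>\<omega>. (\<Sum>v'\<in>L. indicator (A v \<inter> A v') \<omega>) \<partial>clock_space)"
      unfolding N2 by (intro Bochner_Integration.integral_sum Bochner_Integration.integrable_sum int1 sets.Int A)
    also have "\<dots> = (\<Sum>v\<in>L. \<Sum>v'\<in>L. \<integral>\<omega>. indicator (A v \<inter> A v') \<omega> \<partial>clock_space)"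
      by (intro sum.cong refl Bochner_Integration.integral_sum int1 sets.Int A)
    finally show ?thesis by simp
  qed
  have "2 * c * (a * s) - c\<^sup>2 * (a * s + (real (card L))\<^sup>2 * s\<^sup>2) \<le> 2 * c * (a * s) - c\<^sup>2 * (\<Sum>v\<in>L. \<Sum>v'\<in>L. ?P (A v \<inter> A v'))"
    using pairs by (simp add: mult_left_mono)
  also have "\<dots> = (\<integral>\<omega>. 2 * c * real (N \<omega>) - c\<^sup>2 * (real (N \<omega>))\<^sup>2 \<partial>clock_space)"
    using i1 i2 by (simp add: e1 e2)
  also have "\<dots> \<le> (\<integral>\<omega>. indicator {\<omega>. lineage lam w x d L (Suc m) \<omega>} \<omega> \<partial>clock_space)"
  proof (rule integral_mono)
    show "integrable clock_space (\<lambda>\<omega>. 2 * c * real (N \<omega>) - c\<^sup>2 * (real (N \<omega>))\<^sup>2)" using i1 i2 by simp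
    show "integrable clock_space (indicat_real {\<omega>. lineage lam w x d L (Suc m) \<omega>})"
      by (rule int1) (use measurable_lineage[OF assms(1), of lam w x d "Suc m"] in \<open>simp only: pred_def space_clock_space UNIV_I simp_thms\<close>)
    fix \<omega>
    have "0 < N \<omega> \<longleftrightarrow> lineage lam w x d L (Suc m) \<omega>"
      using assms(1) by (auto simp: N_def card_gt_0_iff A_def)
    then show "2 * c * real (N \<omega>) - c\<^sup>2 * (real (N \<omega>))\<^sup>2 \<le> indicator {\<omega>. lineage lam w x d L (Suc m) \<omega>} \<omega>"
      using second_moment_bound[of c "N \<omega>"]
      by (cases "0 < N \<omega>") (simp_all del: lineage.simps add: indicator_def)
  qed
  also have "\<dots> = ?P {\<omega>. lineage lam w x d L (Suc m) \<omega>}" by simp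
  finally show ?thesis .
qed

lemma prob_lineage_bounded_below:
  fixes x :: "'a::countable"
  assumes "finite L" "L \<subseteq> particles n x x"
    and "1 < (\<Sum>v\<in>L. measure clock_space {\<omega>. is_born lam w x \<omega> v \<and> d \<le> birth_time lam w x \<omega> v})"
  obtains \<sigma> where "0 < \<sigma>" "\<And>m. \<sigma> \<le> measure clock_space {\<omega>. lineage lam w x d L m \<omega>}"
proof -
  define a where "a = (\<Sum>v\<in>L. measure clock_space {\<omega>. is_born lam w x \<omega> v \<and> d \<le> birth_time lam w x \<omega> v})"
  define b where "b = (real (card L))\<^sup>2"
  have a: "1 < a" using assms(3) by (simp add: a_def)
  have "L \<noteq> {}" using assms(3) by auto
  then have b: "0 < b" using assms(1) by (simp add: b_def card_gt_0_iff)
  \<comment> \<open>With the best \<open>c\<close> the recursion sends \<open>s\<close> to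
    \<open>a * a * s / (a + b * s)\<close>, which increases in \<open>s\<close> and has the fixed
    point \<open>(a * a - a) / b\<close>. So a lower bound not above this point is preserved; the
    minimum with 1 serves generation 0.\<close>
  define \<sigma> where "\<sigma> = min 1 ((a\<^sup>2 - a) / b)"
  have aa: "a < a\<^sup>2" using a by (simp add: power2_eq_square)
  have \<sigma>: "0 < \<sigma>" "\<sigma> \<le> 1" using aa b by (auto simp: \<sigma>_def)
  have \<sigma>b: "\<sigma> * b \<le> a\<^sup>2 - a" using b by (simp add: \<sigma>_def min_def field_simps)
  have "\<sigma> \<le> measure clock_space {\<omega>. lineage lam w x d L m \<omega>}" for m
  proof (induction m)
    case 0
    have "measure clock_space (UNIV :: 'a clocks set) = 1"
      by (rule clock_space.prob_space[unfolded space_clock_space])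
    then show ?case using \<sigma> by simp
  next
    case (Suc m)
    define s where "s = measure clock_space {\<omega>. lineage lam w x d L m \<omega>}"
    have s: "\<sigma> \<le> s" using Suc by (simp add: s_def)
    \<comment> \<open>The maximiser of the quadratic in \<open>c\<close> from
      \<open>prob_lineage_Suc_ge\<close>.\<close>
    define c where "c = a / (a + b * s)"
    have pos: "0 < a + b * s" using a b s \<sigma> by (simp add: add_pos_nonneg)
    have c: "0 \<le> c" using a pos by (simp add: c_def)
    have "\<sigma> * (b * s) \<le> (a\<^sup>2 - a) * s" using mult_right_mono[OF \<sigma>b, of s] s \<sigma> by (simp add: mult_ac)
    moreover have "\<sigma> * a \<le> s * a" using s a by (intro mult_right_mono) auto
    ultimately have "\<sigma> * (a + b * s) \<le> a * a * s" by (simp add: algebra_simps power2_eq_square)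
    then have "\<sigma> \<le> a * a * s / (a + b * s)" using pos by (simp add: field_simps)
    also have "\<dots> = c * s * a" by (simp add: c_def)
    also have "\<dots> = c * s * (2 * a - c * (a + b * s))" using pos by (simp add: c_def)
    also have "\<dots> = 2 * c * (a * s) - c\<^sup>2 * (a * s + b * s\<^sup>2)" by (simp add: algebra_simps power2_eq_square)
    also have "\<dots> \<le> measure clock_space {\<omega>. lineage lam w x d L (Suc m) \<omega>}"
      using prob_lineage_Suc_ge[OF assms(1,2) c, of lam w d m] unfolding a_def b_def s_def .
    finally show ?case .
  qed
  then show ?thesis using that \<sigma> by blast
qed

text \<open>The events \<open>E m\<close> decrease and all have probability at least \<sigma>, hence
  so has their intersection. There births at \<open>x\<close> occur arbitrarily late, and a newborn
  is alive at its own birth time because lifetimes are almost surely positive.\<close>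

lemma local_extinction_prob_less_1:
  fixes x :: "'a::countable"
  assumes "0 < lam" "nonneg_weights w" "finite_rows w" "1 < lam ^ n * weight_power w n x x"
  shows "local_extinction_prob lam w x < 1"
proof -
  obtain L where L: "finite L" "L \<subseteq> particles n x x" "1 < (\<Sum>u\<in>L. born_prob lam w x u)"
    using finite_particles_expectation[OF assms] by blast
  have "n \<noteq> 0" using assms(4) by (intro notI) simp
  then have ne: "u \<noteq> []" if "u \<in> L" for u using that L(2) by (auto simp: particles_def)
  have "(\<lambda>j. \<Sum>v\<in>L. measure clock_space {\<omega>. is_born lam w x \<omega> v \<and> 1 / real (Suc j) \<le> birth_time lam w x \<omega> v})
     \<longlonglongrightarrow> (\<Sum>v\<in>L. born_prob lam w x v)"
    by (intro tendsto_sum tendsto_prob_late_birth assms ne)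
  then have "\<forall>\<^sub>F j in sequentially. 1 < (\<Sum>v\<in>L. measure clock_space {\<omega>. is_born lam w x \<omega> v \<and> 1 / real (Suc j) \<le> birth_time lam w x \<omega> v})"
    using L(3) by (rule order_tendstoD)
  then obtain j where j: "1 < (\<Sum>v\<in>L. measure clock_space {\<omega>. is_born lam w x \<omega> v \<and> 1 / real (Suc j) \<le> birth_time lam w x \<omega> v})"
    by (auto simp: eventually_sequentially)
  define d where "d = 1 / real (Suc j)"
  have d: "0 < d" by (simp add: d_def)
  obtain \<sigma> where \<sigma>: "0 < \<sigma>" "\<And>m. \<sigma> \<le> measure clock_space {\<omega>. lineage lam w x d L m \<omega>}"
    using prob_lineage_bounded_below[OF L(1,2) j] unfolding d_def by blast
  define E where "E m = {\<omega>. \<exists>u. is_born lam w x \<omega> u \<and> position x u = x \<and> real m * d \<le> birth_time lam w x \<omega> u}" for m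
  have E: "E m \<in> sets clock_space" for m
  proof -
    have "Measurable.pred clock_space (\<lambda>\<omega>. is_born lam w x \<omega> u \<and> position x u = x \<and> real m * d \<le> birth_time lam w x \<omega> u)" for u
      by (cases "position x u = x") (simp_all add: pred_late_birth)
    then have "Measurable.pred clock_space (\<lambda>\<omega>. \<exists>u. is_born lam w x \<omega> u \<and> position x u = x \<and> real m * d \<le> birth_time lam w x \<omega> u)"
      by (intro pred_intros_countable)
    then show ?thesis by (simp add: pred_def E_def)
  qed
  have "\<sigma> \<le> measure clock_space (E m)" for m
    by (rule order_trans[OF \<sigma>(2) clock_space.finite_measure_mono[OF _ E]])
       (use lineage_imp_late_birth[OF L(2)] in \<open>auto simp: E_def\<close>)
  moreover have "decseq E"
  proof (rule decseq_SucI)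
    fix m
    have "real m * d \<le> real (Suc m) * d" using d by simp
    then show "E (Suc m) \<subseteq> E m" unfolding E_def by (auto intro: order_trans)
  qed
  then have "(\<lambda>m. measure clock_space (E m)) \<longlonglongrightarrow> measure clock_space (\<Inter>m. E m)"
    by (intro clock_space.finite_Lim_measure_decseq) (use E in auto)
  ultimately have PE: "\<sigma> \<le> measure clock_space (\<Inter>m. E m)"
    by (intro LIMSEQ_le_const) auto
  have I: "(\<Inter>m. E m) \<in> sets clock_space" using E by (intro sets.countable_INT) auto
  let ?X = "{\<omega> \<in> space clock_space. \<exists>T. \<forall>t\<ge>T. brw lam w x \<omega> t x = 0}"
  have X: "?X \<in> sets clock_space" using measurable_local_extinction[of lam w x] unfolding pred_def .
  have "AE \<omega> in clock_space. \<omega> \<in> ?X \<longrightarrow> \<omega> \<in> space clock_space - (\<Inter>m. E m)"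
    using AE_clock_pos
  proof eventually_elim
    case (elim \<omega>)
    show ?case
    proof (rule impI, rule DiffI)
      assume "\<omega> \<in> ?X"
      then obtain T where T: "\<And>t. t \<ge> T \<Longrightarrow> brw lam w x \<omega> t x = 0" by auto
      obtain m where m: "T < real m * d" using reals_Archimedean3[OF d] by blast
      show "\<omega> \<notin> (\<Inter>m. E m)"
      proof
        assume "\<omega> \<in> (\<Inter>m. E m)"
        then obtain u where u: "is_born lam w x \<omega> u" "position x u = x" "real m * d \<le> birth_time lam w x \<omega> u"
          by (auto simp: E_def)
        then have "u \<in> alive_at lam w x \<omega> (birth_time lam w x \<omega> u) x"
          using elim by (auto simp: alive_at_def lifetime_def)
        moreover have "alive_at lam w x \<omega> (birth_time lam w x \<omega> u) x = {}"
          using T[of "birth_time lam w x \<omega> u"] u m by (auto simp: brw_def zero_enat_def split: if_splits)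
        ultimately show False by simp
      qed
    qed simp
  qed
  then have "measure clock_space ?X \<le> measure clock_space (space clock_space - (\<Inter>m. E m))"
    by (rule clock_space.finite_measure_mono_AE) (rule sets.compl_sets[OF I])
  also have "\<dots> = 1 - measure clock_space (\<Inter>m. E m)"
    by (rule clock_space.prob_compl[OF I])
  finally show ?thesis using PE \<sigma>(1) unfolding local_extinction_prob_def by linarith
qed

subsection \<open>The critical value as a growth rate\<close>

text \<open>If no term exceeds 1 at some \<open>lam'\<close> above \<open>lam\<close>, then at
  \<open>lam\<close> the terms are dominated by the powers of \<open>lam / lam'\<close>, so their
  sum converges and extinction follows. Behaviour at the critical value stays open, and the infimum
  does not see it.\<close>

lemma Inf_extinction_eq:
  fixes x :: "'a::countable"
  assumes "nonneg_weights w" "finite_rows w"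
  shows "Inf {ereal lam | lam. 0 < lam \<and> local_extinction_prob lam w x < 1} = first_moment_critical w x"
proof (rule antisym)
  show "Inf {ereal lam | lam. 0 < lam \<and> local_extinction_prob lam w x < 1} \<le> first_moment_critical w x"
    unfolding first_moment_critical_def
  proof (rule Inf_superset_mono, clarify)
    fix lam n assume "0 < (lam::real)" "1 < lam ^ n * weight_power w n x x"
    then have "local_extinction_prob lam w x < 1" by (rule local_extinction_prob_less_1[OF _ assms])
    with \<open>0 < lam\<close> show "\<exists>lam'. ereal lam = ereal lam' \<and> 0 < lam' \<and> local_extinction_prob lam' w x < 1"
      by blast
  qed
  show "first_moment_critical w x \<le> Inf {ereal lam | lam. 0 < lam \<and> local_extinction_prob lam w x < 1}"
  proof (rule Inf_greatest, clarify)
    fix lam :: real assume lam: "0 < lam" "local_extinction_prob lam w x < 1"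
    have le: "first_moment_critical w x \<le> ereal lam'" if "lam < lam'" for lam'
    proof -
      have pos: "0 < lam'" using that lam by simp
      have "\<exists>n. 1 < lam' ^ n * weight_power w n x x"
      proof (rule ccontr)
        assume "\<not> ?thesis"
        then have le: "lam' ^ n * weight_power w n x x \<le> 1" for n by (simp add: not_less)
        have "summable (\<lambda>n. lam ^ n * weight_power w n x x)"
        proof (rule summable_comparison_test)
          show "summable (\<lambda>n. (lam / lam') ^ n)" using that lam by (intro summable_geometric) auto
          have "norm (lam ^ n * weight_power w n x x) \<le> (lam / lam') ^ n" for n
          proof -
            have "lam ^ n * weight_power w n x x = (lam / lam') ^ n * (lam' ^ n * weight_power w n x x)"
              using pos by (simp add: power_divide)
            also have "\<dots> \<le> (lam / lam') ^ n * 1" by (intro mult_left_mono le) (use lam pos in auto)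
            finally have "lam ^ n * weight_power w n x x \<le> (lam / lam') ^ n" by simp
            moreover have "0 \<le> lam ^ n * weight_power w n x x"
              by (intro mult_nonneg_nonneg zero_le_power less_imp_le[OF lam(1)] weight_power_nonneg[OF assms(1)])
            ultimately show ?thesis unfolding real_norm_def by linarith
          qed
          then show "\<exists>N. \<forall>n\<ge>N. norm (lam ^ n * weight_power w n x x) \<le> (lam / lam') ^ n" by blast
        qed
        from local_extinction_prob_eq_1[OF lam(1) assms this] lam(2) show False by linarith
      qed
      then show ?thesis unfolding first_moment_critical_def using pos by (intro Inf_lower) blast
    qed
    show "first_moment_critical w x \<le> ereal lam"
    proof (rule ereal_le_epsilon2)
      fix e :: real assume "0 < e"
      then show "first_moment_critical w x \<le> ereal lam + ereal e"
        using le[of "lam + e"] by simp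
    qed
  qed
qed

text \<open>Connectedness inside \<open>V\<close> makes the value independent of the vertex chosen
  by \<open>SOME\<close>, so any convenient \<open>x\<close> can serve as base point.\<close>

lemma strong_critical_eq:
  fixes w :: "'a::countable \<Rightarrow> 'a \<Rightarrow> real"
  assumes "nonneg_weights w" "finite_rows w" "x \<in> V"
    and "\<And>x y. x \<in> V \<Longrightarrow> y \<in> V \<Longrightarrow> (x, y) \<in> {(a, b). 0 < w a b}\<^sup>*"
  shows "strong_critical V w = first_moment_critical w x"
proof -
  have "(SOME x. x \<in> V) \<in> V" using assms(3) by (rule someI)
  then have "first_moment_critical w (SOME x. x \<in> V) = first_moment_critical w x"
    by (intro antisym first_moment_critical_le[OF assms(1,2)] assms(4) assms(3))
  then show ?thesis
    unfolding strong_critical_def Let_def using Inf_extinction_eq[OF assms(1,2)] by simp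
qed

section \<open>Percolation on a weighted graph\<close>

abbreviation adjacency :: "'a set set \<Rightarrow> ('a \<times> 'a) set" where
  "adjacency F \<equiv> {(x, y). {x, y} \<in> F}"

lemma sym_adjacency: "sym (adjacency F)"
  by (auto simp: sym_def insert_commute)

lemma equiv_adjacency: "equiv UNIV ((adjacency F)\<^sup>*)"
  by (intro equivI sym_rtrancl sym_adjacency trans_rtrancl refl_rtrancl) simp

lemma component_eq: "A \<in> components F \<Longrightarrow> x \<in> A \<Longrightarrow> A = (adjacency F)\<^sup>* `` {x}"
  unfolding components_def using equiv_adjacency[of F]
  by (metis (no_types, lifting) Image_singleton_iff equiv_class_eq quotientE)

lemma cluster_in_components: "(adjacency F)\<^sup>* `` {x} \<in> components F"
  unfolding components_def by (rule quotientI) simp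

lemma component_nonempty: "A \<in> components F \<Longrightarrow> \<exists>x. x \<in> A"
  unfolding components_def by (auto elim!: quotientE)

lemma component_closed: "A \<in> components F \<Longrightarrow> x \<in> A \<Longrightarrow> {x, y} \<in> F \<Longrightarrow> y \<in> A"
  using component_eq[of A F x] by (auto intro: r_into_rtrancl)

lemma weight_power_automorphism:
  assumes "bij \<gamma>" "\<And>a b. w (\<gamma> a) (\<gamma> b) = w a b"
  shows "weight_power w n (\<gamma> a) (\<gamma> b) = weight_power w n a b"
proof (induction n arbitrary: a)
  case 0 then show ?case using bij_is_inj[OF assms(1)] by (auto simp: inj_eq)
next
  case (Suc n)
  have "(\<Sum>\<^sub>\<infinity>v. w (\<gamma> a) v * weight_power w n v (\<gamma> b))
      = (\<Sum>\<^sub>\<infinity>v. w (\<gamma> a) (\<gamma> v) * weight_power w n (\<gamma> v) (\<gamma> b))"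
    by (rule infsum_reindex_bij_betw[OF assms(1), symmetric])
  then show ?case by (simp add: assms(2) Suc)
qed

locale weighted_graph =
  fixes \<mu> :: "'a::countable \<Rightarrow> 'a \<Rightarrow> real"
  assumes nonneg: "nonneg_weights \<mu>" and rows: "finite_rows \<mu>"
    and sym: "non_oriented \<mu>" and conn: "connected_weights \<mu>"
begin

lemma edge_pos: "{x, y} \<in> edges \<mu> \<longleftrightarrow> 0 < \<mu> x y"
  using sym by (auto simp: edges_def non_oriented_def doubleton_eq_iff)

lemma open_edges_subset: "open_edges \<mu> \<omega> \<subseteq> edges \<mu>"
  by (auto simp: open_edges_def)

lemma positive_path: "(x, y) \<in> {(a, b). 0 < \<mu> a b}\<^sup>*"
  using conn weight_power_pos_imp_path[OF nonneg rows] unfolding connected_weights_def by metis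

lemma strong_critical_UNIV: "strong_critical UNIV \<mu> = first_moment_critical \<mu> x"
  by (rule strong_critical_eq[OF nonneg rows UNIV_I positive_path])

text \<open>The base point is free, so it can be put where an open copy of the pattern will be
  found.\<close>

lemma strong_critical_less_witness:
  assumes "strong_critical UNIV \<mu> < a"
  obtains lam n where "0 < lam" "ereal lam < a" "1 < lam ^ n * weight_power \<mu> n x x"
  using assms unfolding strong_critical_UNIV[of x] first_moment_critical_def Inf_less_iff by blast

lemma component_connected:
  assumes "F \<subseteq> edges \<mu>" "A \<in> components F" "x \<in> A" "y \<in> A"
  shows "(x, y) \<in> {(a, b). 0 < subgraph_weights {e \<in> F. e \<subseteq> A} \<mu> a b}\<^sup>*"
proof -
  have "(x, y) \<in> (adjacency F)\<^sup>*" using component_eq[OF assms(2,3)] assms(4) by blast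
  then show ?thesis
  proof (induction rule: rtrancl_induct)
    case (step y z)
    have "y \<in> A" "z \<in> A" using step component_eq[OF assms(2,3)] by (auto intro: rtrancl_into_rtrancl)
    moreover have "0 < \<mu> y z" using step assms(1) edge_pos by auto
    ultimately have "(y, z) \<in> {(a, b). 0 < subgraph_weights {e \<in> F. e \<subseteq> A} \<mu> a b}"
      using step by (simp add: subgraph_weights_pos_iff)
    with step show ?case by (rule_tac rtrancl_into_rtrancl)
  qed simp
qed

lemma strong_critical_component_eq:
  assumes "F \<subseteq> edges \<mu>" "A \<in> components F" "x \<in> A"
  shows "strong_critical_component \<mu> F A = first_moment_critical (subgraph_weights {e \<in> F. e \<subseteq> A} \<mu>) x"
  unfolding strong_critical_component_def
  by (intro strong_critical_eq subgraph_weights_nonneg subgraph_weights_finite_rows nonneg rows assms(3)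
      component_connected[OF assms(1,2)])

lemma strong_critical_component_ge:
  assumes "F \<subseteq> edges \<mu>" "A \<in> components F"
  shows "strong_critical UNIV \<mu> \<le> strong_critical_component \<mu> F A"
proof -
  obtain x where "x \<in> A" using component_nonempty[OF assms(2)] by blast
  then show ?thesis
    unfolding strong_critical_component_eq[OF assms \<open>x \<in> A\<close>] strong_critical_UNIV[of x]
    by (intro first_moment_critical_mono subgraph_weights_nonneg subgraph_weights_le nonneg rows)
qed

lemma strong_critical_component_le:
  assumes "F \<subseteq> edges \<mu>" "A \<in> components F" "x \<in> A" "walk_edges \<mu> n x \<subseteq> F"
    and "0 < lam" "1 < lam ^ n * weight_power \<mu> n x x"
  shows "strong_critical_component \<mu> F A \<le> ereal lam"
proof -
  let ?E = "{e \<in> F. e \<subseteq> A}"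
  have "walk_edges \<mu> n x \<subseteq> ?E"
    by (rule walk_edges_component[OF assms(3,4) component_closed[OF assms(2)]])
  then have "weight_power (subgraph_weights ?E \<mu>) n x x = weight_power \<mu> n x x"
    by (rule weight_power_subgraph_eq[OF nonneg rows])
  then show ?thesis
    unfolding strong_critical_component_eq[OF assms(1-3)] first_moment_critical_def
    using assms(5,6) by (intro Inf_lower) (metis (mono_tags, lifting) mem_Collect_eq)
qed

lemma strong_critical_all_ge: "F \<subseteq> edges \<mu> \<Longrightarrow> strong_critical UNIV \<mu> \<le> strong_critical_all \<mu> F"
  unfolding strong_critical_all_def by (intro INF_greatest strong_critical_component_ge)

lemma strong_critical_all_le:
  assumes "F \<subseteq> edges \<mu>" "walk_edges \<mu> n x \<subseteq> F" "0 < lam" "1 < lam ^ n * weight_power \<mu> n x x"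
  shows "strong_critical_all \<mu> F \<le> ereal lam"
proof -
  let ?A = "(adjacency F)\<^sup>* `` {x}"
  have "strong_critical_all \<mu> F \<le> strong_critical_component \<mu> F ?A"
    unfolding strong_critical_all_def by (intro INF_lower cluster_in_components)
  also have "\<dots> \<le> ereal lam"
    by (rule strong_critical_component_le[OF assms(1) cluster_in_components _ assms(2-4)]) simp
  finally show ?thesis .
qed

subsection \<open>Bernoulli percolation\<close>

lemma prob_space_percolation: "prob_space (percolation \<mu> p)"
  unfolding percolation_def by (intro prob_space_PiM measure_pmf.prob_space_axioms)

lemma countable_edges: "countable (edges \<mu>)"
proof -
  have "edges \<mu> \<subseteq> (\<lambda>(x, y). {x, y}) ` UNIV" by (auto simp: edges_def)
  then show ?thesis by (rule countable_subset) simp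
qed

lemma pred_open:
  assumes "e \<in> edges \<mu>"
  shows "Measurable.pred (percolation \<mu> p) (\<lambda>\<omega>. \<omega> e)"
proof -
  have "(\<lambda>\<omega>. \<omega> e) \<in> percolation \<mu> p \<rightarrow>\<^sub>M measure_pmf (bernoulli_pmf p)"
    unfolding percolation_def by (rule measurable_component_singleton[OF assms])
  then show ?thesis by (simp cong: measurable_cong_sets)
qed

lemma pred_open_edges: "Measurable.pred (percolation \<mu> p) (\<lambda>\<omega>. e \<in> open_edges \<mu> \<omega>)"
  by (cases "e \<in> edges \<mu>") (auto simp: open_edges_def pred_open)

text \<open>\<open>P\<close> is a finite union of cylinders, one for each set \<open>S\<close> of
  open edges within \<open>E\<close> that satisfies it when everything else is closed.\<close>

lemma pred_finitely_many_edges: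
  assumes "finite E" "E \<subseteq> edges \<mu>" "depends_on E P"
  shows "Measurable.pred (percolation \<mu> p) P"
proof -
  have "P \<omega> \<longleftrightarrow> (\<exists>S\<in>{S \<in> Pow E. P (\<lambda>e. e \<in> S)}. \<forall>e\<in>E. \<omega> e = (e \<in> S))" for \<omega>
  proof
    assume "P \<omega>"
    moreover have "P \<omega> = P (\<lambda>e. e \<in> {e \<in> E. \<omega> e})" by (rule depends_onD[OF assms(3)]) simp
    ultimately show "\<exists>S\<in>{S \<in> Pow E. P (\<lambda>e. e \<in> S)}. \<forall>e\<in>E. \<omega> e = (e \<in> S)"
      by (intro bexI[of _ "{e \<in> E. \<omega> e}"]) auto
  next
    assume "\<exists>S\<in>{S \<in> Pow E. P (\<lambda>e. e \<in> S)}. \<forall>e\<in>E. \<omega> e = (e \<in> S)"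
    then obtain S where S: "P (\<lambda>e. e \<in> S)" "\<forall>e\<in>E. \<omega> e = (e \<in> S)" by blast
    have "P \<omega> = P (\<lambda>e. e \<in> S)" by (rule depends_onD[OF assms(3)]) (rule S(2)[rule_format])
    then show "P \<omega>" using S(1) by (rule iffD2)
  qed
  then have eq: "P = (\<lambda>\<omega>. \<exists>S\<in>{S \<in> Pow E. P (\<lambda>e. e \<in> S)}. \<forall>e\<in>E. \<omega> e = (e \<in> S))" by (rule ext)
  have fin: "finite {S \<in> Pow E. P (\<lambda>e. e \<in> S)}" using assms(1) by simp
  have "Measurable.pred (percolation \<mu> p) (\<lambda>\<omega>. \<omega> e = (e \<in> S))" if "e \<in> E" for e S
    using pred_open[OF subsetD[OF assms(2) that], of p] by (cases "e \<in> S") simp_all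
  then have "Measurable.pred (percolation \<mu> p) (\<lambda>\<omega>. \<forall>e\<in>E. \<omega> e = (e \<in> S))" for S
    by (rule pred_intros_finite(3)[OF assms(1)])
  then have "Measurable.pred (percolation \<mu> p) (\<lambda>\<omega>. \<exists>S\<in>{S \<in> Pow E. P (\<lambda>e. e \<in> S)}. \<forall>e\<in>E. \<omega> e = (e \<in> S))"
    by (rule pred_intros_finite(4)[OF fin])
  then show ?thesis by (rule ssubst[OF eq, of "Measurable.pred (percolation \<mu> p)"])
qed

lemma sets_percolation_pred:
  "Measurable.pred (percolation \<mu> p) P \<Longrightarrow> {\<omega> \<in> space (percolation \<mu> p). P \<omega>} \<in> sets (percolation \<mu> p)"
  by (simp add: pred_def)

lemma prob_percolation_family:
  assumes "finite L" "\<And>j. j \<in> L \<Longrightarrow> K j \<subseteq> edges \<mu>" "disjoint_family_on K L"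
    and "\<And>j. j \<in> L \<Longrightarrow> Measurable.pred (percolation \<mu> p) (A j)"
    and "\<And>j. j \<in> L \<Longrightarrow> depends_on (K j) (A j)"
  shows "measure (percolation \<mu> p) {\<omega> \<in> space (percolation \<mu> p). \<forall>j\<in>L. A j \<omega>}
           = (\<Prod>j\<in>L. measure (percolation \<mu> p) {\<omega> \<in> space (percolation \<mu> p). A j \<omega>})"
  unfolding percolation_def
  by (rule prob_indep_family[OF measure_pmf.prob_space_axioms assms(1-3) _ assms(5)])
     (use assms(4) in \<open>simp_all only: percolation_def pred_def\<close>)

lemma prob_percolation_pair:
  assumes "J \<subseteq> edges \<mu>" "K \<subseteq> edges \<mu>" "J \<inter> K = {}"
    and "Measurable.pred (percolation \<mu> p) A" "depends_on J A"
    and "Measurable.pred (percolation \<mu> p) B" "depends_on K B"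
  shows "measure (percolation \<mu> p) {\<omega> \<in> space (percolation \<mu> p). A \<omega> \<and> B \<omega>}
    = measure (percolation \<mu> p) {\<omega> \<in> space (percolation \<mu> p). A \<omega>}
      * measure (percolation \<mu> p) {\<omega> \<in> space (percolation \<mu> p). B \<omega>}"
  unfolding percolation_def
  by (rule prob_indep_pair[OF measure_pmf.prob_space_axioms assms(1-3) _ assms(5) _ assms(7)])
     (use assms(4,6) in \<open>simp_all only: percolation_def pred_def\<close>)

lemma prob_edge:
  assumes "e \<in> edges \<mu>" "p \<in> {0..1}"
  shows "measure (percolation \<mu> p) {\<omega> \<in> space (percolation \<mu> p). \<omega> e = b} = (if b then p else 1 - p)"
proof -
  have "measure (percolation \<mu> p) {\<omega> \<in> space (percolation \<mu> p). \<omega> e = b}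
    = measure (distr (percolation \<mu> p) (measure_pmf (bernoulli_pmf p)) (\<lambda>\<omega>. \<omega> e)) {b}"
    unfolding percolation_def
    by (subst measure_distr[OF measurable_component_singleton[OF assms(1)]])
       (auto intro!: arg_cong2[where f = measure])
  also have "\<dots> = measure (measure_pmf (bernoulli_pmf p)) {b}"
    unfolding percolation_def
    by (subst distr_PiM_component[OF measure_pmf.prob_space_axioms assms(1)]) simp
  also have "\<dots> = pmf (bernoulli_pmf p) b" by (simp add: measure_pmf_single)
  finally show ?thesis using assms(2) by (cases b) auto
qed

lemma prob_edges_state:
  assumes "finite E" "E \<subseteq> edges \<mu>" "p \<in> {0..1}"
  shows "measure (percolation \<mu> p) {\<omega> \<in> space (percolation \<mu> p). \<forall>e\<in>E. \<omega> e = b}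
    = (if b then p else 1 - p) ^ card E"
proof -
  have "measure (percolation \<mu> p) {\<omega> \<in> space (percolation \<mu> p). \<forall>e\<in>E. \<omega> e = b}
    = (\<Prod>e\<in>E. measure (percolation \<mu> p) {\<omega> \<in> space (percolation \<mu> p). \<omega> e = b})"
  proof (rule prob_percolation_family[where K = "\<lambda>e. {e}"])
    show dep: "depends_on {e} (\<lambda>\<omega>. \<omega> e = b)" if "e \<in> E" for e by (rule depends_onI) auto
    show "Measurable.pred (percolation \<mu> p) (\<lambda>\<omega>. \<omega> e = b)" if "e \<in> E" for e
      by (rule pred_finitely_many_edges[OF _ _ dep[OF that]]) (use assms(2) that in auto)
  qed (use assms in \<open>auto simp: disjoint_family_on_def\<close>)
  also have "\<dots> = (\<Prod>e\<in>E. if b then p else 1 - p)"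
    using assms(2) by (intro prod.cong refl prob_edge assms(3)) auto
  finally show ?thesis by simp
qed

section \<open>Sequences of independent percolations with summable closing probabilities\<close>

lemma prob_percolation_seq:
  assumes "Measurable.pred (percolation \<mu> (p n)) Q"
  shows "{\<omega> \<in> space (percolation_seq \<mu> p). Q (\<omega> n)} \<in> sets (percolation_seq \<mu> p)"
    and "measure (percolation_seq \<mu> p) {\<omega> \<in> space (percolation_seq \<mu> p). Q (\<omega> n)}
      = measure (percolation \<mu> (p n)) {\<eta> \<in> space (percolation \<mu> (p n)). Q \<eta>}"
proof -
  have comp: "(\<lambda>\<omega>. \<omega> n) \<in> percolation_seq \<mu> p \<rightarrow>\<^sub>M percolation \<mu> (p n)"
    unfolding percolation_seq_def by (rule measurable_component_singleton) simp
  show "{\<omega> \<in> space (percolation_seq \<mu> p). Q (\<omega> n)} \<in> sets (percolation_seq \<mu> p)"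
    using measurable_compose[OF comp assms] unfolding pred_def .
  have "measure (percolation \<mu> (p n)) {\<eta> \<in> space (percolation \<mu> (p n)). Q \<eta>}
    = measure (distr (percolation_seq \<mu> p) (percolation \<mu> (p n)) (\<lambda>\<omega>. \<omega> n)) {\<eta> \<in> space (percolation \<mu> (p n)). Q \<eta>}"
    unfolding percolation_seq_def by (subst distr_PiM_component[OF prob_space_percolation]) auto
  also have "\<dots> = measure (percolation_seq \<mu> p) {\<omega> \<in> space (percolation_seq \<mu> p). Q (\<omega> n)}"
    by (subst measure_distr[OF comp sets_percolation_pred[OF assms]])
       (use measurable_space[OF comp] in \<open>auto intro!: arg_cong2[where f = measure]\<close>)
  finally show "measure (percolation_seq \<mu> p) {\<omega> \<in> space (percolation_seq \<mu> p). Q (\<omega> n)}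
      = measure (percolation \<mu> (p n)) {\<eta> \<in> space (percolation \<mu> (p n)). Q \<eta>}" ..
qed

lemma percolation_seq_borel_cantelli:
  assumes "\<And>n. Measurable.pred (percolation \<mu> (p n)) (Q n)"
    and "summable (\<lambda>n. measure (percolation \<mu> (p n)) {\<eta> \<in> space (percolation \<mu> (p n)). Q n \<eta>})"
  shows "AE \<omega> in percolation_seq \<mu> p. \<forall>\<^sub>F n in sequentially. \<not> Q n (\<omega> n)"
proof -
  interpret P: prob_space "percolation_seq \<mu> p"
    unfolding percolation_seq_def by (intro prob_space_PiM prob_space_percolation)
  have "AE \<omega> in percolation_seq \<mu> p. \<forall>\<^sub>F n in sequentially.
      \<omega> \<in> space (percolation_seq \<mu> p) - {\<omega> \<in> space (percolation_seq \<mu> p). Q n (\<omega> n)}"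
    by (rule borel_cantelli_AE1)
       (use assms in \<open>simp_all add: prob_percolation_seq P.emeasure_eq_measure\<close>)
  then show ?thesis
    by eventually_elim (auto elim: eventually_mono)
qed

lemma AE_eventually_open:
  assumes "\<And>n. p n \<in> {0..1}" "summable (\<lambda>n. 1 - p n)"
  shows "AE \<omega> in percolation_seq \<mu> p. \<forall>e\<in>edges \<mu>. \<forall>\<^sub>F n in sequentially. e \<in> open_edges \<mu> (\<omega> n)"
proof (subst AE_ball_countable[OF countable_edges], rule ballI)
  fix e assume e: "e \<in> edges \<mu>"
  have "AE \<omega> in percolation_seq \<mu> p. \<forall>\<^sub>F n in sequentially. \<not> \<omega> n e = False"
  proof (rule percolation_seq_borel_cantelli)
    show "Measurable.pred (percolation \<mu> (p n)) (\<lambda>\<omega>. \<omega> e = False)" for n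
      using pred_open[OF e, of "p n"] by simp
    show "summable (\<lambda>n. measure (percolation \<mu> (p n)) {\<eta> \<in> space (percolation \<mu> (p n)). \<eta> e = False})"
      unfolding prob_edge[OF e assms(1)] using assms(2) by simp
  qed
  then show "AE \<omega> in percolation_seq \<mu> p. \<forall>\<^sub>F n in sequentially. e \<in> open_edges \<mu> (\<omega> n)"
    using e by (simp add: open_edges_def)
qed

lemma eventually_finite_open:
  assumes "\<forall>e\<in>edges \<mu>. \<forall>\<^sub>F n in sequentially. e \<in> open_edges \<mu> (\<omega> n)" "finite E" "E \<subseteq> edges \<mu>"
  shows "\<forall>\<^sub>F n in sequentially. E \<subseteq> open_edges \<mu> (\<omega> n)"
  unfolding subset_iff Ball_def[symmetric]
  using assms by (subst eventually_ball_finite_distrib) auto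

theorem strong_critical_all_tendsto:
  assumes "\<And>n. p n \<in> {0..1}" "summable (\<lambda>n. 1 - p n)"
  shows "AE \<omega> in percolation_seq \<mu> p.
    (\<lambda>n. strong_critical_all \<mu> (open_edges \<mu> (\<omega> n))) \<longlonglongrightarrow> strong_critical UNIV \<mu>"
  using AE_eventually_open[OF assms]
proof eventually_elim
  case (elim \<omega>)
  show ?case
  proof (rule order_tendstoI)
    fix a assume "a < strong_critical UNIV \<mu>"
    then have "a < strong_critical_all \<mu> (open_edges \<mu> (\<omega> n))" for n
      using strong_critical_all_ge[OF open_edges_subset] by (rule less_le_trans)
    then show "\<forall>\<^sub>F n in sequentially. a < strong_critical_all \<mu> (open_edges \<mu> (\<omega> n))" by simp
  next
    fix a assume "strong_critical UNIV \<mu> < a"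
    \<comment> \<open>Any vertex can carry the pattern; \<open>undefined\<close> stands for an
      arbitrary one.\<close>
    then obtain lam n where lam: "0 < lam" "ereal lam < a" "1 < lam ^ n * weight_power \<mu> n undefined undefined"
      by (rule strong_critical_less_witness)
    have "\<forall>\<^sub>F k in sequentially. walk_edges \<mu> n undefined \<subseteq> open_edges \<mu> (\<omega> k)"
      by (rule eventually_finite_open[OF elim finite_walk_edges[OF rows] walk_edges_subset])
    then show "\<forall>\<^sub>F k in sequentially. strong_critical_all \<mu> (open_edges \<mu> (\<omega> k)) < a"
    proof (rule eventually_mono)
      fix k assume "walk_edges \<mu> n undefined \<subseteq> open_edges \<mu> (\<omega> k)"
      from strong_critical_all_le[OF open_edges_subset this lam(1,3)] lam(2)
      show "strong_critical_all \<mu> (open_edges \<mu> (\<omega> k)) < a" by (rule le_less_trans)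
    qed
  qed
qed

subsection \<open>Quasi-transitive graphs\<close>

lemma finite_relpow_Image: "finite (({(a, b). 0 < \<mu> a b} ^^ k) `` {v})"
proof (induction k)
  case (Suc k)
  have "({(a, b). 0 < \<mu> a b} ^^ Suc k) `` {v} = (\<Union>z\<in>({(a, b). 0 < \<mu> a b} ^^ k) `` {v}. {y. 0 < \<mu> z y})"
    by auto
  then show ?case using Suc rows by (simp add: finite_rows_def)
qed simp

lemma walk_edges_near:
  assumes "e \<in> walk_edges \<mu> n y" "v \<in> e"
  shows "\<exists>k\<le>n. (v, y) \<in> {(a, b). 0 < \<mu> a b} ^^ k"
  using assms
proof (induction n arbitrary: y)
  case (Suc n)
  then obtain z where z: "0 < \<mu> y z" "e = {y, z} \<or> e \<in> walk_edges \<mu> n z" by auto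
  have zy: "(z, y) \<in> {(a, b). 0 < \<mu> a b}" using z(1) sym by (simp add: non_oriented_def)
  from z(2) show ?case
  proof
    assume "e = {y, z}"
    then consider "v = y" | "v = z" using Suc.prems by auto
    then show ?thesis
    proof cases
      case 1 then show ?thesis by (intro exI[of _ 0]) simp
    next
      case 2 then show ?thesis using zy by (intro exI[of _ 1]) simp
    qed
  next
    assume "e \<in> walk_edges \<mu> n z"
    from Suc.IH[OF this Suc.prems(2)] obtain k where "k \<le> n" "(v, z) \<in> {(a, b). 0 < \<mu> a b} ^^ k" by blast
    then show ?thesis using zy by (intro exI[of _ "Suc k"]) auto
  qed
qed simp

text \<open>If walks of \<open>n\<close> steps from \<open>y\<close> can use an edge of
  \<open>E\<close>, then \<open>y\<close> is within distance \<open>n\<close> of an endpoint of that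
  edge, and balls are finite.\<close>

lemma finite_walk_edges_meeting:
  assumes "finite E" "E \<subseteq> edges \<mu>"
  shows "finite {y. walk_edges \<mu> n y \<inter> E \<noteq> {}}"
proof (rule finite_subset)
  show "{y. walk_edges \<mu> n y \<inter> E \<noteq> {}} \<subseteq> (\<Union>v\<in>\<Union>E. \<Union>k\<in>{..n}. ({(a, b). 0 < \<mu> a b} ^^ k) `` {v})"
  proof (rule subsetI)
    fix y assume "y \<in> {y. walk_edges \<mu> n y \<inter> E \<noteq> {}}"
    then obtain e where e: "e \<in> walk_edges \<mu> n y" "e \<in> E" by blast
    then obtain v where "v \<in> e" using assms(2) by (auto simp: edges_def)
    with walk_edges_near[OF e(1) this] e(2)
    show "y \<in> (\<Union>v\<in>\<Union>E. \<Union>k\<in>{..n}. ({(a, b). 0 < \<mu> a b} ^^ k) `` {v})" by auto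
  qed
  have "finite (\<Union>E)" using assms by (auto simp: edges_def)
  then show "finite (\<Union>v\<in>\<Union>E. \<Union>k\<in>{..n}. ({(a, b). 0 < \<mu> a b} ^^ k) `` {v})"
    by (intro finite_UN_I finite_relpow_Image) auto
qed

text \<open>Greedy choice: the patterns already chosen exclude only finitely many further base
  points.\<close>

lemma disjoint_walk_edges:
  assumes "infinite C"
  shows "\<exists>Y\<subseteq>C. finite Y \<and> card Y = m \<and> disjoint_family_on (walk_edges \<mu> n) Y"
proof (induction m)
  case 0 show ?case by (intro exI[of _ "{}"]) (auto simp: disjoint_family_on_def)
next
  case (Suc m)
  then obtain Y where Y: "Y \<subseteq> C" "finite Y" "card Y = m" "disjoint_family_on (walk_edges \<mu> n) Y" by blast
  let ?E = "\<Union>y\<in>Y. walk_edges \<mu> n y"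
  have "finite (Y \<union> {y. walk_edges \<mu> n y \<inter> ?E \<noteq> {}})"
    by (intro finite_UnI finite_walk_edges_meeting finite_UN_I UN_least Y(2) finite_walk_edges[OF rows] walk_edges_subset)
  then have "infinite (C - (Y \<union> {y. walk_edges \<mu> n y \<inter> ?E \<noteq> {}}))" by (rule Diff_infinite_finite[OF _ assms])
  then obtain z where "z \<in> C - (Y \<union> {y. walk_edges \<mu> n y \<inter> ?E \<noteq> {}})" using infinite_imp_nonempty by blast
  then have z: "z \<in> C" "z \<notin> Y" "\<And>y. y \<in> Y \<Longrightarrow> walk_edges \<mu> n z \<inter> walk_edges \<mu> n y = {}" by auto
  show ?case
    by (rule exI[of _ "insert z Y"]) (use Y z in \<open>auto simp: disjoint_family_on_def Int_commute\<close>)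
qed

lemma AE_open_copy:
  assumes "infinite C" "0 < p" "p \<le> 1"
    and card: "\<And>y. y \<in> C \<Longrightarrow> card (walk_edges \<mu> n y) = N"
  shows "AE \<omega> in percolation \<mu> p. \<exists>y\<in>C. walk_edges \<mu> n y \<subseteq> open_edges \<mu> \<omega>"
proof -
  interpret P: prob_space "percolation \<mu> p" by (rule prob_space_percolation)
  let ?A = "\<lambda>y \<omega>. \<not> (\<forall>e\<in>walk_edges \<mu> n y. \<omega> e)"
  have dep: "depends_on (walk_edges \<mu> n y) (?A y)" for y by (rule depends_onI) auto
  have meas: "Measurable.pred (percolation \<mu> p) (?A y)" for y
    by (rule pred_finitely_many_edges[OF finite_walk_edges[OF rows] walk_edges_subset dep])
  define B where "B = {\<omega> \<in> space (percolation \<mu> p). \<forall>y\<in>C. ?A y \<omega>}"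
  have B: "B \<in> sets (percolation \<mu> p)"
    unfolding B_def by (rule sets_percolation_pred, rule pred_intros_countable_bounded(3)) (rule meas)
  have le: "measure (percolation \<mu> p) B \<le> (1 - p ^ N) ^ m" for m
  proof -
    obtain Y where Y: "Y \<subseteq> C" "finite Y" "card Y = m" "disjoint_family_on (walk_edges \<mu> n) Y"
      using disjoint_walk_edges[OF assms(1)] by blast
    have "measure (percolation \<mu> p) B \<le> measure (percolation \<mu> p) {\<omega> \<in> space (percolation \<mu> p). \<forall>y\<in>Y. ?A y \<omega>}"
    proof (rule P.finite_measure_mono)
      show "B \<subseteq> {\<omega> \<in> space (percolation \<mu> p). \<forall>y\<in>Y. ?A y \<omega>}" using Y(1) by (auto simp: B_def)
      show "{\<omega> \<in> space (percolation \<mu> p). \<forall>y\<in>Y. ?A y \<omega>} \<in> sets (percolation \<mu> p)"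
        by (rule sets_percolation_pred, rule pred_intros_finite(3)[OF Y(2) meas])
    qed
    also have "\<dots> = (\<Prod>y\<in>Y. measure (percolation \<mu> p) {\<omega> \<in> space (percolation \<mu> p). ?A y \<omega>})"
      by (rule prob_percolation_family[OF Y(2) walk_edges_subset Y(4) meas dep])
    also have "\<dots> = (\<Prod>y\<in>Y. 1 - p ^ N)"
    proof (rule prod.cong[OF refl])
      fix y assume y: "y \<in> Y"
      let ?B = "{\<omega> \<in> space (percolation \<mu> p). \<forall>e\<in>walk_edges \<mu> n y. \<omega> e = True}"
      have p: "p \<in> {0..1}" using assms(2,3) by simp
      have "measure (percolation \<mu> p) ?B = p ^ N"
        unfolding prob_edges_state[OF finite_walk_edges[OF rows] walk_edges_subset p]
        using card y Y(1) by auto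
      moreover have "?B \<in> sets (percolation \<mu> p)"
        by (rule sets_percolation_pred,
            rule pred_finitely_many_edges[OF finite_walk_edges[OF rows] walk_edges_subset])
           (rule depends_onI, auto)
      moreover have "{\<omega> \<in> space (percolation \<mu> p). ?A y \<omega>} = space (percolation \<mu> p) - ?B" by auto
      ultimately show "measure (percolation \<mu> p) {\<omega> \<in> space (percolation \<mu> p). ?A y \<omega>} = 1 - p ^ N"
        by (simp only: P.prob_compl)
    qed
    also have "\<dots> = (1 - p ^ N) ^ m" using Y by simp
    finally show ?thesis .
  qed
  have "(\<lambda>m. (1 - p ^ N) ^ m) \<longlonglongrightarrow> 0"
    by (rule LIMSEQ_realpow_zero) (use assms in \<open>auto simp: power_le_one\<close>)
  then have "measure (percolation \<mu> p) B \<le> 0"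
    by (rule LIMSEQ_le_const) (use le in blast)
  then have "B \<in> null_sets (percolation \<mu> p)"
    using B measure_nonneg[of "percolation \<mu> p" B] by (simp add: null_sets_def P.emeasure_eq_measure)
  then have "AE \<omega> in percolation \<mu> p. \<omega> \<notin> B" by (rule AE_not_in)
  with AE_space show ?thesis
  proof eventually_elim
    case (elim \<omega>)
    then obtain y where "y \<in> C" "\<forall>e\<in>walk_edges \<mu> n y. \<omega> e" by (auto simp: B_def)
    then show ?case using walk_edges_subset[of \<mu> n y] by (intro bexI[of _ y]) (auto simp: open_edges_def)
  qed
qed

text \<open>One class of the finite partition is infinite, and automorphisms give all its vertices
  the same return weights and patterns of the same size. For \<open>p = 0\<close> the claim fails:
  almost surely all components are isolated vertices, whose parameter is infinite.\<close>

theorem strong_critical_all_quasi_transitive: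
  assumes "infinite (UNIV :: 'a set)" "0 < p" "p \<le> 1" "quasi_transitive \<mu>"
  shows "AE \<omega> in percolation \<mu> p. strong_critical_all \<mu> (open_edges \<mu> \<omega>) = strong_critical UNIV \<mu>"
proof -
  obtain P where P: "finite P" "partition_on UNIV P"
    and transitive: "\<forall>A\<in>P. \<forall>x\<in>A. \<forall>y\<in>A. \<exists>\<gamma>. bij \<gamma> \<and> \<gamma> x = y \<and> (\<forall>a b. \<mu> (\<gamma> a) (\<gamma> b) = \<mu> a b)"
    using assms(4) unfolding quasi_transitive_def by (elim exE conjE)
  have "\<exists>C\<in>P. infinite C"
  proof (rule ccontr)
    assume "\<not> ?thesis"
    then have "finite (\<Union>P)" by (intro finite_Union P(1)) auto
    then show False using P(2) assms(1) by (simp add: partition_on_def)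
  qed
  then obtain C where C: "C \<in> P" "infinite C" ..
  obtain x where x: "x \<in> C" using infinite_imp_nonempty[OF C(2)] by auto
  have wp: "weight_power \<mu> n y y = weight_power \<mu> n x x \<and> card (walk_edges \<mu> n y) = card (walk_edges \<mu> n x)"
    if "y \<in> C" for n y
  proof -
    obtain \<gamma> where \<gamma>: "bij \<gamma>" "\<gamma> x = y" "\<And>a b. \<mu> (\<gamma> a) (\<gamma> b) = \<mu> a b"
      using transitive[rule_format, OF C(1) x \<open>y \<in> C\<close>] by auto
    have "weight_power \<mu> n (\<gamma> a) (\<gamma> b) = weight_power \<mu> n a b" for a b
      by (rule weight_power_automorphism[of \<gamma> \<mu>, OF \<gamma>(1) \<gamma>(3)])
    moreover have "card (walk_edges \<mu> n (\<gamma> x)) = card (walk_edges \<mu> n x)"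
      unfolding walk_edges_automorphism[of \<gamma> \<mu>, OF \<gamma>(1) \<gamma>(3)]
      by (rule card_image, rule inj_onI) (simp only: inj_image_eq_iff[OF bij_is_inj[OF \<gamma>(1)]])
    ultimately show ?thesis unfolding \<gamma>(2)[symmetric] by blast
  qed
  \<comment> \<open>Rational thresholds \<open>q\<close> keep the union of the exceptional null sets
    countable.\<close>
  have "AE \<omega> in percolation \<mu> p. \<forall>q::rat. strong_critical UNIV \<mu> < ereal (of_rat q) \<longrightarrow>
      strong_critical_all \<mu> (open_edges \<mu> \<omega>) \<le> ereal (of_rat q)"
  proof (subst AE_all_countable, rule allI)
    fix q :: rat
    show "AE \<omega> in percolation \<mu> p. strong_critical UNIV \<mu> < ereal (of_rat q) \<longrightarrow>
      strong_critical_all \<mu> (open_edges \<mu> \<omega>) \<le> ereal (of_rat q)"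
    proof (cases "strong_critical UNIV \<mu> < ereal (of_rat q)")
      case True
      then obtain lam n where lam: "0 < lam" "ereal lam < ereal (of_rat q)" "1 < lam ^ n * weight_power \<mu> n x x"
        by (rule strong_critical_less_witness)
      have "AE \<omega> in percolation \<mu> p. \<exists>y\<in>C. walk_edges \<mu> n y \<subseteq> open_edges \<mu> \<omega>"
        by (rule AE_open_copy[OF C(2) assms(2,3) wp[THEN conjunct2]])
      then show ?thesis
      proof eventually_elim
        case (elim \<omega>)
        then obtain y where y: "y \<in> C" "walk_edges \<mu> n y \<subseteq> open_edges \<mu> \<omega>" by blast
        have le: "strong_critical_all \<mu> (open_edges \<mu> \<omega>) \<le> ereal lam"
          by (rule strong_critical_all_le[OF open_edges_subset y(2) lam(1)]) (simp only: wp[OF y(1), THEN conjunct1] lam(3))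
        show ?case by (rule impI) (rule order_trans[OF le less_imp_le[OF lam(2)]])
      qed
    qed simp
  qed
  then show ?thesis
  proof eventually_elim
    case (elim \<omega>)
    show ?case
    proof (rule antisym)
      show "strong_critical_all \<mu> (open_edges \<mu> \<omega>) \<le> strong_critical UNIV \<mu>"
      proof (rule ccontr)
        assume "\<not> ?thesis"
        then obtain q :: rat where "strong_critical UNIV \<mu> < ereal (of_rat q)"
          "ereal (of_rat q) < strong_critical_all \<mu> (open_edges \<mu> \<omega>)"
          using ereal_dense3[of "strong_critical UNIV \<mu>" "strong_critical_all \<mu> (open_edges \<mu> \<omega>)"]
          unfolding not_le by blast
        with elim[rule_format, of q] show False by simp
      qed
    qed (rule strong_critical_all_ge[OF open_edges_subset])
  qed
qed

end

section \<open>Infinite clusters\<close>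

lemma infinite_clusters_iff: "infinite_clusters F \<noteq> {} \<longleftrightarrow> (\<exists>x. infinite ((adjacency F)\<^sup>* `` {x}))"
proof
  assume "infinite_clusters F \<noteq> {}"
  then obtain A where A: "A \<in> components F" "infinite A" by (auto simp: infinite_clusters_def)
  obtain x where "x \<in> A" using component_nonempty[OF A(1)] ..
  then have "infinite ((adjacency F)\<^sup>* `` {x})" using A(2) component_eq[OF A(1)] by simp
  then show "\<exists>x. infinite ((adjacency F)\<^sup>* `` {x})" ..
next
  assume "\<exists>x. infinite ((adjacency F)\<^sup>* `` {x})"
  then obtain x where "infinite ((adjacency F)\<^sup>* `` {x})" ..
  then have "(adjacency F)\<^sup>* `` {x} \<in> infinite_clusters F"
    by (simp only: infinite_clusters_def mem_Collect_eq cluster_in_components simp_thms)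
  then show "infinite_clusters F \<noteq> {}" by auto
qed

lemma infinite_clusters_mono:
  assumes "F \<subseteq> F'" "infinite_clusters F \<noteq> {}"
  shows "infinite_clusters F' \<noteq> {}"
proof -
  obtain x where x: "infinite ((adjacency F)\<^sup>* `` {x})"
    using infinite_clusters_iff[THEN iffD1, OF assms(2)] ..
  have "adjacency F \<subseteq> adjacency F'" using assms(1) by auto
  then have "(adjacency F)\<^sup>* `` {x} \<subseteq> (adjacency F')\<^sup>* `` {x}" by (intro Image_mono rtrancl_mono order_refl)
  then have "infinite ((adjacency F')\<^sup>* `` {x})" using x by (rule infinite_super)
  then show ?thesis by (intro infinite_clusters_iff[THEN iffD2] exI)
qed

text \<open>On a path from \<open>x\<close> in \<open>F\<close>, the stretch after the last deleted
  edge runs in \<open>F'\<close>. So the cluster of \<open>x\<close> is covered by the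
  \<open>F'\<close>-clusters of the finitely many vertices in \<open>?Z\<close>, and one of these is
  infinite.\<close>

lemma infinite_clusters_delete_finite:
  assumes "F' \<subseteq> F" "finite (F - F')" "\<And>e. e \<in> F \<Longrightarrow> finite e" "infinite_clusters F \<noteq> {}"
  shows "infinite_clusters F' \<noteq> {}"
proof -
  obtain x where x: "infinite ((adjacency F)\<^sup>* `` {x})"
    using infinite_clusters_iff[THEN iffD1, OF assms(4)] ..
  let ?Z = "insert x (\<Union>(F - F'))"
  have fin: "finite ?Z" using assms(2,3) by auto
  have "\<exists>z\<in>?Z. (z, y) \<in> (adjacency F')\<^sup>*" if "(x, y) \<in> (adjacency F)\<^sup>*" for y
    using that
  proof (induction rule: rtrancl_induct)
    case (step y y')
    then obtain z where z: "z \<in> ?Z" "(z, y) \<in> (adjacency F')\<^sup>*" by blast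
    show ?case
    proof (cases "{y, y'} \<in> F'")
      case True
      then have "(z, y') \<in> (adjacency F')\<^sup>*" using z(2) by (auto intro: rtrancl_into_rtrancl)
      then show ?thesis using z(1) by (rule bexI)
    next
      case False
      then have "y' \<in> ?Z" using step.hyps by auto
      then show ?thesis by (intro bexI[of _ y'] rtrancl.rtrancl_refl)
    qed
  qed auto
  then have "(adjacency F)\<^sup>* `` {x} \<subseteq> (\<Union>z\<in>?Z. (adjacency F')\<^sup>* `` {z})" by fastforce
  then have "infinite (\<Union>z\<in>?Z. (adjacency F')\<^sup>* `` {z})" using x by (rule infinite_super)
  then obtain z where "infinite ((adjacency F')\<^sup>* `` {z})" using finite_UN_I[OF fin] by metis
  then show ?thesis by (intro infinite_clusters_iff[THEN iffD2] exI)
qed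

text \<open>Only countable quantifiers remain on the right, which makes infinitude of a random
  cluster a measurable event.\<close>

lemma infinite_to_nat_iff: "infinite (S :: 'a::countable set) \<longleftrightarrow> (\<forall>N. \<exists>y. N \<le> to_nat y \<and> y \<in> S)"
proof -
  have "infinite S \<longleftrightarrow> infinite (to_nat ` S)" by (simp add: finite_image_iff)
  also have "\<dots> \<longleftrightarrow> (\<forall>N. \<exists>m\<ge>N. m \<in> to_nat ` S)" by (rule infinite_nat_iff_unbounded_le)
  also have "\<dots> \<longleftrightarrow> (\<forall>N. \<exists>y. N \<le> to_nat y \<and> y \<in> S)" by (intro iff_allI) blast
  finally show ?thesis .
qed

context weighted_graph
begin

lemma pred_connected:
  "Measurable.pred (percolation \<mu> p) (\<lambda>\<omega>. (x, y) \<in> (adjacency (open_edges \<mu> \<omega>))\<^sup>*)"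
proof -
  have n: "Measurable.pred (percolation \<mu> p) (\<lambda>\<omega>. (x, y) \<in> adjacency (open_edges \<mu> \<omega>) ^^ n)" for n y
  proof (induction n arbitrary: y)
    case (Suc n)
    have "Measurable.pred (percolation \<mu> p)
        (\<lambda>\<omega>. (x, z) \<in> adjacency (open_edges \<mu> \<omega>) ^^ n \<and> {z, y} \<in> open_edges \<mu> \<omega>)" for z
      by (rule pred_intros_logic(3)[OF Suc pred_open_edges])
    then have "Measurable.pred (percolation \<mu> p)
        (\<lambda>\<omega>. \<exists>z. (x, z) \<in> adjacency (open_edges \<mu> \<omega>) ^^ n \<and> {z, y} \<in> open_edges \<mu> \<omega>)"
      by (rule pred_intros_countable(2))
    moreover have "(x, y) \<in> adjacency (open_edges \<mu> \<omega>) ^^ Suc n \<longleftrightarrow>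
        (\<exists>z. (x, z) \<in> adjacency (open_edges \<mu> \<omega>) ^^ n \<and> {z, y} \<in> open_edges \<mu> \<omega>)" for \<omega>
      by auto
    ultimately show ?case by (simp only:)
  qed (cases "x = y", simp_all)
  have "Measurable.pred (percolation \<mu> p) (\<lambda>\<omega>. \<exists>n. (x, y) \<in> adjacency (open_edges \<mu> \<omega>) ^^ n)"
    by (rule pred_intros_countable(2)) (rule n)
  then show ?thesis by (simp only: rtrancl_power)
qed

lemma pred_infinite_cluster:
  "Measurable.pred (percolation \<mu> p) (\<lambda>\<omega>. infinite ((adjacency (open_edges \<mu> \<omega>))\<^sup>* `` {x}))"
proof -
  have "Measurable.pred (percolation \<mu> p) (\<lambda>\<omega>. N \<le> to_nat y \<and> (x, y) \<in> (adjacency (open_edges \<mu> \<omega>))\<^sup>*)" for N y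
    by (cases "N \<le> to_nat y") (simp_all add: pred_connected)
  then have "Measurable.pred (percolation \<mu> p)
      (\<lambda>\<omega>. \<forall>N. \<exists>y. N \<le> to_nat y \<and> (x, y) \<in> (adjacency (open_edges \<mu> \<omega>))\<^sup>*)"
    by (rule pred_intros_countable(1)[OF pred_intros_countable(2)])
  then show ?thesis by (simp only: infinite_to_nat_iff Image_singleton_iff)
qed

definition percolates :: "('a set \<Rightarrow> bool) \<Rightarrow> bool" where
  "percolates \<omega> \<longleftrightarrow> infinite_clusters (open_edges \<mu> \<omega>) \<noteq> {}"

lemma pred_percolates: "Measurable.pred (percolation \<mu> p) percolates"
proof -
  have "percolates = (\<lambda>\<omega>. \<exists>x. infinite ((adjacency (open_edges \<mu> \<omega>))\<^sup>* `` {x}))"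
    by (rule ext) (simp only: percolates_def infinite_clusters_iff)
  moreover have "Measurable.pred (percolation \<mu> p) (\<lambda>\<omega>. \<exists>x. infinite ((adjacency (open_edges \<mu> \<omega>))\<^sup>* `` {x}))"
    by (rule pred_intros_countable(2)) (rule pred_infinite_cluster)
  ultimately show ?thesis by (simp only:)
qed

subsection \<open>The zero-one law for percolation\<close>

text \<open>Pass through the edges open in both configurations: they arise from the first by
  deleting finitely many edges, and the second contains them.\<close>

lemma depends_on_percolates:
  assumes "finite D"
  shows "depends_on (edges \<mu> - D) percolates"
proof (rule depends_onI)
  fix \<omega> \<omega>' :: "'a set \<Rightarrow> bool"
  assume eq: "\<And>e. e \<in> edges \<mu> - D \<Longrightarrow> \<omega> e = \<omega>' e" and perc: "percolates \<omega>"
  let ?F = "open_edges \<mu> \<omega> \<inter> open_edges \<mu> \<omega>'"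
  have "infinite_clusters ?F \<noteq> {}"
  proof (rule infinite_clusters_delete_finite)
    show "finite (open_edges \<mu> \<omega> - ?F)"
      by (rule finite_subset[OF _ assms]) (use eq in \<open>auto simp: open_edges_def\<close>)
    show "finite e" if "e \<in> open_edges \<mu> \<omega>" for e
      using that by (auto simp: open_edges_def edges_def)
  qed (use perc in \<open>simp_all only: percolates_def Int_lower1 not_False_eq_True\<close>)
  then show "percolates \<omega>'"
    unfolding percolates_def by (rule infinite_clusters_mono[rotated]) simp
qed

text \<open>The sigma algebra of the edges in \<open>K\<close>, given by predicates instead of
  generators, so that independence can be read off from
  \<open>prob_percolation_family\<close>.\<close>

definition coordinate_events :: "real \<Rightarrow> 'a set set \<Rightarrow> ('a set \<Rightarrow> bool) set set" where
  "coordinate_events p K = {X. \<exists>P. Measurable.pred (percolation \<mu> p) P \<and> depends_on K P \<and>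
     X = {\<omega> \<in> space (percolation \<mu> p). P \<omega>}}"

lemma coordinate_eventsI:
  "Measurable.pred (percolation \<mu> p) P \<Longrightarrow> depends_on K P \<Longrightarrow> {\<omega> \<in> space (percolation \<mu> p). P \<omega>} \<in> coordinate_events p K"
  by (simp only: coordinate_events_def mem_Collect_eq, rule exI[of _ P], intro conjI refl)

lemma coordinate_eventsE:
  assumes "X \<in> coordinate_events p K"
  obtains P where "Measurable.pred (percolation \<mu> p) P" "depends_on K P"
    "X = {\<omega> \<in> space (percolation \<mu> p). P \<omega>}"
  using assms by (simp only: coordinate_events_def mem_Collect_eq, elim exE conjE)

lemma sigma_algebra_coordinate_events: "sigma_algebra (space (percolation \<mu> p)) (coordinate_events p K)"
  unfolding sigma_algebra_iff2
proof (intro conjI ballI allI impI)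
  let ?S = "space (percolation \<mu> p)"
  show "coordinate_events p K \<subseteq> Pow ?S" by (auto elim!: coordinate_eventsE)
  have "{\<omega> \<in> ?S. False} \<in> coordinate_events p K"
    by (rule coordinate_eventsI) (simp_all add: depends_on_def)
  then show "{} \<in> coordinate_events p K" by simp
  fix X assume "X \<in> coordinate_events p K"
  then obtain P where P: "Measurable.pred (percolation \<mu> p) P" "depends_on K P" "X = {\<omega> \<in> ?S. P \<omega>}"
    by (rule coordinate_eventsE)
  have "depends_on K (\<lambda>\<omega>. \<not> P \<omega>)" using P(2) by (simp add: depends_on_def)
  then have "{\<omega> \<in> ?S. \<not> P \<omega>} \<in> coordinate_events p K"
    by (rule coordinate_eventsI[OF pred_intros_logic(2)[OF P(1)]])
  moreover have "?S - X = {\<omega> \<in> ?S. \<not> P \<omega>}" by (auto simp: P(3))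
  ultimately show "?S - X \<in> coordinate_events p K" by (simp only:)
next
  let ?S = "space (percolation \<mu> p)"
  fix X :: "nat \<Rightarrow> ('a set \<Rightarrow> bool) set" assume "range X \<subseteq> coordinate_events p K"
  then have "X i \<in> coordinate_events p K" for i by auto
  then have "\<exists>P. Measurable.pred (percolation \<mu> p) P \<and> depends_on K P \<and> X i = {\<omega> \<in> ?S. P \<omega>}" for i
    by (simp only: coordinate_events_def mem_Collect_eq)
  then have "\<forall>i. \<exists>P. Measurable.pred (percolation \<mu> p) P \<and> depends_on K P \<and> X i = {\<omega> \<in> ?S. P \<omega>}" ..
  then obtain P where P: "\<forall>i. Measurable.pred (percolation \<mu> p) (P i) \<and> depends_on K (P i) \<and> X i = {\<omega> \<in> ?S. P i \<omega>}"
    by (rule choice[THEN exE])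
  have meas: "Measurable.pred (percolation \<mu> p) (P i)" and dep: "depends_on K (P i)"
    and eq: "X i = {\<omega> \<in> ?S. P i \<omega>}" for i using P[rule_format, of i] by simp_all
  have "depends_on K (\<lambda>\<omega>. \<exists>i. P i \<omega>)"
  proof (rule depends_onI)
    fix \<omega> \<omega>' :: "'a set \<Rightarrow> bool"
    assume agree: "\<And>e. e \<in> K \<Longrightarrow> \<omega> e = \<omega>' e" and "\<exists>i. P i \<omega>"
    then obtain i where i: "P i \<omega>" by auto
    have "P i \<omega> = P i \<omega>'" by (rule depends_onD[OF dep agree])
    then have "P i \<omega>'" using i by simp
    then show "\<exists>i. P i \<omega>'" ..
  qed
  then have "{\<omega> \<in> ?S. \<exists>i. P i \<omega>} \<in> coordinate_events p K"
    by (rule coordinate_eventsI[OF pred_intros_countable(2)[OF meas]])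
  moreover have "(\<Union>i. X i) = {\<omega> \<in> ?S. \<exists>i. P i \<omega>}" by (auto simp: eq)
  ultimately show "(\<Union>i. X i) \<in> coordinate_events p K" by (simp only:)
qed

lemma percolates_zero_one:
  assumes "measure (percolation \<mu> p) {\<omega> \<in> space (percolation \<mu> p). percolates \<omega>} \<noteq> 0"
  shows "AE \<omega> in percolation \<mu> p. percolates \<omega>"
proof -
  interpret P: prob_space "percolation \<mu> p" by (rule prob_space_percolation)
  let ?M = "percolation \<mu> p"
  let ?X = "{\<omega> \<in> space ?M. percolates \<omega>}"
  define num where "num = to_nat_on (edges \<mu>)"
  have num: "inj_on num (edges \<mu>)" unfolding num_def by (rule inj_on_to_nat_on[OF countable_edges])
  define K where "K i = {e \<in> edges \<mu>. num e = i}" for i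
  define A where "A i = coordinate_events p (K i)" for i
  have "P.prob ?X = 0 \<or> P.prob ?X = 1"
  proof (rule P.kolmogorov_0_1_law[of A])
    show "sigma_algebra (space ?M) (A i)" for i
      unfolding A_def by (rule sigma_algebra_coordinate_events)
    show "P.indep_sets A UNIV"
    proof (rule P.indep_setsI)
      show "A i \<subseteq> P.events" for i
        unfolding A_def by (rule subsetI, erule coordinate_eventsE) (simp only: sets_percolation_pred)
      fix B J assume J: "J \<noteq> {}" "finite J" "\<forall>j\<in>J. B j \<in> A j"
      then have "\<forall>j\<in>J. \<exists>Q. Measurable.pred ?M Q \<and> depends_on (K j) Q \<and> B j = {\<omega> \<in> space ?M. Q \<omega>}"
        by (simp only: A_def coordinate_events_def mem_Collect_eq)
      then obtain Q where Q': "\<forall>j\<in>J. Measurable.pred ?M (Q j) \<and> depends_on (K j) (Q j) \<and> B j = {\<omega> \<in> space ?M. Q j \<omega>}"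
        by (rule bchoice[THEN exE])
      have Q: "Measurable.pred ?M (Q j)" "depends_on (K j) (Q j)" "B j = {\<omega> \<in> space ?M. Q j \<omega>}" if "j \<in> J" for j
        using Q'[rule_format, OF that] by simp_all
      have "(\<Inter>j\<in>J. B j) = {\<omega> \<in> space ?M. \<forall>j\<in>J. Q j \<omega>}" using Q(3) J(1) by auto
      moreover have "P.prob {\<omega> \<in> space ?M. \<forall>j\<in>J. Q j \<omega>} = (\<Prod>j\<in>J. P.prob {\<omega> \<in> space ?M. Q j \<omega>})"
        by (rule prob_percolation_family[OF J(2) _ _ Q(1,2)]) (auto simp: K_def disjoint_family_on_def)
      moreover have "(\<Prod>j\<in>J. P.prob {\<omega> \<in> space ?M. Q j \<omega>}) = (\<Prod>j\<in>J. P.prob (B j))"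
        by (rule prod.cong[OF refl]) (simp only: Q(3))
      ultimately show "P.prob (\<Inter>j\<in>J. B j) = (\<Prod>j\<in>J. P.prob (B j))" by (simp only:)
    qed
    show "?X \<in> P.tail_events A"
      unfolding P.tail_events_def
    proof (rule INT_I)
      fix n
      let ?D = "{e \<in> edges \<mu>. num e < n}"
      have D: "finite ?D"
      proof (rule inj_on_finite)
        show "inj_on num ?D" by (rule inj_on_subset[OF num]) auto
        show "num ` ?D \<subseteq> {..<n}" by auto
      qed simp
      let ?N = "sigma (space ?M) (\<Union>(A ` {n..}))"
      have sub: "\<Union>(A ` {n..}) \<subseteq> Pow (space ?M)" by (auto simp: A_def elim!: coordinate_eventsE)
      \<comment> \<open>\<open>g\<close> closes the first \<open>n\<close> edges of the enumeration.
        It is measurable with respect to the later edges alone and does not affect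
        \<open>percolates\<close>, so \<open>?X\<close> equals its own preimage under
        \<open>g\<close> and is an event of the later edges.\<close>
      define g where "g \<omega> = (\<lambda>e\<in>edges \<mu>. if e \<in> ?D then False else \<omega> e)" for \<omega> :: "'a set \<Rightarrow> bool"
      have g: "g \<in> ?N \<rightarrow>\<^sub>M ?M"
        unfolding g_def percolation_def[of \<mu> p, abs_def]
      proof (rule measurable_restrict)
        fix e assume e: "e \<in> edges \<mu>"
        show "(\<lambda>\<omega>. if e \<in> ?D then False else \<omega> e) \<in> sigma (space (PiM (edges \<mu>) (\<lambda>_. measure_pmf (bernoulli_pmf p)))) (\<Union>(A ` {n..})) \<rightarrow>\<^sub>M measure_pmf (bernoulli_pmf p)"
          unfolding percolation_def[symmetric]
        proof (cases "e \<in> ?D")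
          case False
          then have n: "n \<le> num e" using e by auto
          show "(\<lambda>\<omega>. if e \<in> ?D then False else \<omega> e) \<in> ?N \<rightarrow>\<^sub>M measure_pmf (bernoulli_pmf p)"
          proof (rule measurableI)
            fix B :: "bool set"
            have "depends_on {e} (\<lambda>\<omega>. \<omega> e \<in> B)" by (rule depends_onI) auto
            then have "depends_on (K (num e)) (\<lambda>\<omega>. \<omega> e \<in> B)"
              by (rule depends_on_mono) (use e in \<open>simp add: K_def\<close>)
            moreover have "Measurable.pred ?M (\<lambda>\<omega>. \<omega> e \<in> B)"
              by (rule pred_finitely_many_edges[OF _ _ \<open>depends_on {e} (\<lambda>\<omega>. \<omega> e \<in> B)\<close>]) (use e in auto)
            ultimately have "{\<omega> \<in> space ?M. \<omega> e \<in> B} \<in> A (num e)"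
              unfolding A_def by (intro coordinate_eventsI)
            then have "{\<omega> \<in> space ?M. \<omega> e \<in> B} \<in> sets ?N"
              unfolding sets_measure_of[OF sub] using n by (intro sigma_sets.Basic) auto
            moreover have "(\<lambda>\<omega>. if e \<in> ?D then False else \<omega> e) -` B \<inter> space ?N = {\<omega> \<in> space ?M. \<omega> e \<in> B}"
              unfolding space_measure_of[OF sub] using False by auto
            ultimately show "(\<lambda>\<omega>. if e \<in> ?D then False else \<omega> e) -` B \<inter> space ?N \<in> sets ?N" by (simp only:)
          qed simp
        qed simp
      qed
      have "percolates (g \<omega>) \<longleftrightarrow> percolates \<omega>" for \<omega>
        by (rule depends_onD[OF depends_on_percolates[OF D]]) (simp add: g_def)
      then have "g -` ?X \<inter> space ?N = ?X"
        using measurable_space[OF g] unfolding space_measure_of[OF sub] by auto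
      moreover have "g -` ?X \<inter> space ?N \<in> sets ?N"
        by (rule measurable_sets[OF g sets_percolation_pred[OF pred_percolates]])
      ultimately show "?X \<in> sigma_sets (space ?M) (\<Union>(A ` {n..}))"
        unfolding sets_measure_of[OF sub] by (simp only:)
    qed
  qed
  then have "P.prob ?X = 1" using assms by blast
  then show ?thesis
    by (rule P.prob_Collect_eq_1[OF sets_percolation_pred[OF pred_percolates], THEN iffD1])
qed


text \<open>Guarantees that the set in \<open>critical_prob\<close> is nonempty, so that its
  supremum is meaningful.\<close>

lemma critical_prob_set_0:
  "measure (percolation \<mu> 0) {\<omega> \<in> space (percolation \<mu> 0). percolates \<omega>} = 0"
proof -
  interpret P: prob_space "percolation \<mu> 0" by (rule prob_space_percolation)
  have "AE \<omega> in percolation \<mu> 0. \<forall>e\<in>edges \<mu>. \<omega> e = False"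
  proof (subst AE_ball_countable[OF countable_edges], rule ballI)
    fix e assume e: "e \<in> edges \<mu>"
    have "Measurable.pred (percolation \<mu> 0) (\<lambda>\<omega>. \<omega> e = False)"
      using pred_open[OF e, of 0] by simp
    from P.prob_Collect_eq_1[OF sets_percolation_pred[OF this]] prob_edge[OF e, of 0 False]
    show "AE \<omega> in percolation \<mu> 0. \<omega> e = False" by simp
  qed
  then have "AE \<omega> in percolation \<mu> 0. \<not> percolates \<omega>"
  proof eventually_elim
    case (elim \<omega>)
    then have "open_edges \<mu> \<omega> = {}" by (auto simp: open_edges_def)
    then have "\<not> (\<exists>x. infinite ((adjacency (open_edges \<mu> \<omega>))\<^sup>* `` {x}))" by simp
    then show ?case by (simp only: percolates_def infinite_clusters_iff not_False_eq_True)
  qed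
  then show ?thesis
    by (rule P.prob_Collect_eq_0[OF sets_percolation_pred[OF pred_percolates], THEN iffD2])
qed

lemma bdd_above_nonpercolating:
  "bdd_above {p \<in> {0..1}. measure (percolation \<mu> p) {\<omega> \<in> space (percolation \<mu> p). percolates \<omega>} = 0}"
  by (rule bdd_aboveI[of _ 1]) simp

lemma critical_prob_nonneg: "0 \<le> critical_prob \<mu>"
proof -
  have "0 \<in> {p \<in> {0..1}. measure (percolation \<mu> p) {\<omega> \<in> space (percolation \<mu> p). percolates \<omega>} = 0}"
    using critical_prob_set_0 by simp
  then show ?thesis
    unfolding critical_prob_def percolates_def[symmetric] by (rule cSup_upper[OF _ bdd_above_nonpercolating])
qed

text \<open>Since \<open>p\<close> exceeds the supremum, it lies outside the set of parameters with
  zero probability; no monotonicity in \<open>p\<close> is involved. The zero-one law then gives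
  probability 1.\<close>

lemma AE_percolates:
  assumes "critical_prob \<mu> < p" "p \<le> 1"
  shows "AE \<omega> in percolation \<mu> p. infinite_clusters (open_edges \<mu> \<omega>) \<noteq> {}"
proof -
  let ?S = "{p \<in> {0..1}. measure (percolation \<mu> p) {\<omega> \<in> space (percolation \<mu> p). percolates \<omega>} = 0}"
  have "p \<notin> ?S"
  proof
    assume "p \<in> ?S"
    then have "p \<le> critical_prob \<mu>"
      unfolding critical_prob_def percolates_def[symmetric] by (rule cSup_upper[OF _ bdd_above_nonpercolating])
    then show False using assms(1) by simp
  qed
  then have "measure (percolation \<mu> p) {\<omega> \<in> space (percolation \<mu> p). percolates \<omega>} \<noteq> 0"
    using assms critical_prob_nonneg by simp
  from percolates_zero_one[OF this] show ?thesis by (simp only: percolates_def)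
qed

lemma critical_prob_le:
  assumes "\<And>p. q < p \<Longrightarrow> p \<le> 1 \<Longrightarrow> measure (percolation \<mu> p) {\<omega> \<in> space (percolation \<mu> p). percolates \<omega>} \<noteq> 0"
  shows "critical_prob \<mu> \<le> q"
  unfolding critical_prob_def percolates_def[symmetric]
proof (rule cSup_least)
  have "0 \<in> {p \<in> {0..1}. measure (percolation \<mu> p) {\<omega> \<in> space (percolation \<mu> p). percolates \<omega>} = 0}"
    using critical_prob_set_0 by simp
  then show "{p \<in> {0..1}. measure (percolation \<mu> p) {\<omega> \<in> space (percolation \<mu> p). percolates \<omega>} = 0} \<noteq> {}"
    by (intro notI) (simp only: empty_iff)
  fix p assume p: "p \<in> {p \<in> {0..1}. measure (percolation \<mu> p) {\<omega> \<in> space (percolation \<mu> p). percolates \<omega>} = 0}"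
  show "p \<le> q"
  proof (rule ccontr)
    assume "\<not> p \<le> q"
    then show False using p assms[of p] by simp
  qed
qed

subsection \<open>Exploring a cluster\<close>

text \<open>
  At stage \<open>j\<close> the edges in \<open>F j\<close> have been revealed, and \<open>sel j\<close> selects one of finitely many
  unrevealed patches \<open>W j v\<close>. A patch is fully open with a probability bounded below, whatever has
  been revealed, so the exploration does not go on forever without finding an open one.
\<close>

lemma AE_exploration:
  fixes sel :: "nat \<Rightarrow> ('a set \<Rightarrow> bool) \<Rightarrow> 'v" and W :: "nat \<Rightarrow> 'v \<Rightarrow> 'a set set"
  assumes p: "0 < p" "p \<le> 1"
    and F: "\<And>j. finite (F j)" "\<And>j. F j \<subseteq> edges \<mu>" "\<And>j. F j \<subseteq> F (Suc j)"
    and V: "\<And>j. finite (V j)" "\<And>j \<omega>. T j \<omega> \<Longrightarrow> sel j \<omega> \<in> V j"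
    and W: "\<And>j v. v \<in> V j \<Longrightarrow> W j v \<subseteq> F (Suc j) - F j" "\<And>j v. v \<in> V j \<Longrightarrow> card (W j v) \<le> c"
    and T: "\<And>j. depends_on (F j) (T j)"
    and sel: "\<And>j v. depends_on (F j) (\<lambda>\<omega>. sel j \<omega> = v)"
  shows "AE \<omega> in percolation \<mu> p. (\<forall>j. T j \<omega>) \<longrightarrow> (\<exists>j. \<forall>e\<in>W j (sel j \<omega>). \<omega> e)"
proof -
  interpret P: prob_space "percolation \<mu> p" by (rule prob_space_percolation)
  let ?M = "percolation \<mu> p"
  define Bad where "Bad J \<omega> \<longleftrightarrow> (\<forall>j<J. T j \<omega> \<and> \<not> (\<forall>e\<in>W j (sel j \<omega>). \<omega> e))" for J \<omega>
  have F_mono: "F i \<subseteq> F j" if "i \<le> j" for i j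
    using lift_Suc_mono_le[of F, OF F(3) that] .
  have dep_bad: "depends_on (F J) (Bad J)" for J
  proof (rule depends_onI)
    fix \<omega> \<omega>' :: "'a set \<Rightarrow> bool"
    assume eq: "\<And>e. e \<in> F J \<Longrightarrow> \<omega> e = \<omega>' e" and bad: "Bad J \<omega>"
    show "Bad J \<omega>'" unfolding Bad_def
    proof (intro allI impI)
      fix j assume j: "j < J"
      have eqj: "\<omega> e = \<omega>' e" if "e \<in> F (Suc j)" for e
        by (rule eq, rule subsetD[OF F_mono that]) (use j in simp)
      have eqj': "\<omega> e = \<omega>' e" if "e \<in> F j" for e by (rule eqj, rule subsetD[OF F(3) that])
      have Tj: "T j \<omega>" and not: "\<not> (\<forall>e\<in>W j (sel j \<omega>). \<omega> e)"
        using bad[unfolded Bad_def, rule_format, OF j] by simp_all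
      have "T j \<omega> = T j \<omega>'" by (rule depends_onD[OF T eqj'])
      moreover have "(sel j \<omega> = sel j \<omega>) = (sel j \<omega>' = sel j \<omega>)" by (rule depends_onD[OF sel eqj'])
      then have sel_eq: "sel j \<omega>' = sel j \<omega>" by simp
      moreover have W_eq: "\<omega> e = \<omega>' e" if "e \<in> W j (sel j \<omega>)" for e
        using subsetD[OF W(1)[OF V(2)[OF Tj]] that] by (intro eqj) simp
      have "\<not> (\<forall>e\<in>W j (sel j \<omega>'). \<omega>' e)"
        using not W_eq unfolding sel_eq by simp
      ultimately show "T j \<omega>' \<and> \<not> (\<forall>e\<in>W j (sel j \<omega>'). \<omega>' e)" using Tj by simp
    qed
  qed
  have mBad: "{\<omega> \<in> space ?M. Bad J \<omega>} \<in> sets ?M" for J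
    by (rule sets_percolation_pred[OF pred_finitely_many_edges[OF F(1,2) dep_bad]])
  have c: "0 \<le> 1 - p ^ c" using p by (simp add: power_le_one)
  have bound: "P.prob {\<omega> \<in> space ?M. Bad J \<omega>} \<le> (1 - p ^ c) ^ J" for J
  proof (induction J)
    case 0 show ?case by (simp add: P.prob_space)
  next
    case (Suc J)
    \<comment> \<open>Splitting by the value of \<open>sel J\<close> freezes the patch.
      \<open>B v\<close> reads only \<open>F J\<close>, which is disjoint from \<open>W J v\<close>,
      so the two events are independent; and the events \<open>B v\<close> are disjoint parts of
      \<open>Bad J\<close>.\<close>
    define B where "B v \<omega> \<longleftrightarrow> Bad J \<omega> \<and> T J \<omega> \<and> sel J \<omega> = v" for v \<omega>
    let ?C = "\<lambda>v \<omega>. \<not> (\<forall>e\<in>W J v. \<omega> e)"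
    have depB: "depends_on (F J) (B v)" for v
    proof (rule depends_onI)
      fix \<omega> \<omega>' :: "'a set \<Rightarrow> bool"
      assume eq: "\<And>e. e \<in> F J \<Longrightarrow> \<omega> e = \<omega>' e" and B: "B v \<omega>"
      have "Bad J \<omega> = Bad J \<omega>'" by (rule depends_onD[OF dep_bad eq])
      moreover have "T J \<omega> = T J \<omega>'" by (rule depends_onD[OF T eq])
      moreover have "(sel J \<omega> = v) = (sel J \<omega>' = v)" by (rule depends_onD[OF sel eq])
      ultimately show "B v \<omega>'" using B by (simp add: B_def)
    qed
    have mB: "Measurable.pred ?M (B v)" for v by (rule pred_finitely_many_edges[OF F(1,2) depB])
    have depC: "depends_on (W J v) (?C v)" for v by (rule depends_onI) auto
    have Wsub: "W J v \<subseteq> F (Suc J)" if "v \<in> V J" for v using W(1)[OF that] by auto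
    have Wfin: "finite (W J v)" "W J v \<subseteq> edges \<mu>" if "v \<in> V J" for v
      using finite_subset[OF Wsub[OF that] F(1)] order_trans[OF Wsub[OF that] F(2)] by simp_all
    have mC: "Measurable.pred ?M (?C v)" if "v \<in> V J" for v
      by (rule pred_finitely_many_edges[OF Wfin[OF that] depC])
    have C: "P.prob {\<omega> \<in> space ?M. ?C v \<omega>} \<le> 1 - p ^ c" if v: "v \<in> V J" for v
    proof -
      let ?B = "{\<omega> \<in> space ?M. \<forall>e\<in>W J v. \<omega> e = True}"
      have p01: "p \<in> {0..1}" using p by simp
      have "?B \<in> sets ?M"
        by (rule sets_percolation_pred, rule pred_finitely_many_edges[OF Wfin[OF v]]) (rule depends_onI, auto)
      then have "P.prob (space ?M - ?B) = 1 - P.prob ?B" by (rule P.prob_compl)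
      moreover have "{\<omega> \<in> space ?M. ?C v \<omega>} = space ?M - ?B" by auto
      moreover have "P.prob ?B = p ^ card (W J v)"
        unfolding prob_edges_state[OF Wfin[OF v] p01] by simp
      moreover have "p ^ c \<le> p ^ card (W J v)" using p W(2)[OF v] by (intro power_decreasing) auto
      ultimately show ?thesis by simp
    qed
    have cover: "{\<omega> \<in> space ?M. Bad (Suc J) \<omega>} \<subseteq> (\<Union>v\<in>V J. {\<omega> \<in> space ?M. B v \<omega> \<and> ?C v \<omega>})"
    proof
      fix \<omega> assume "\<omega> \<in> {\<omega> \<in> space ?M. Bad (Suc J) \<omega>}"
      then have \<omega>: "\<omega> \<in> space ?M" "Bad J \<omega>" "T J \<omega>" "?C (sel J \<omega>) \<omega>" by (simp_all add: Bad_def)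
      then show "\<omega> \<in> (\<Union>v\<in>V J. {\<omega> \<in> space ?M. B v \<omega> \<and> ?C v \<omega>})"
        by (intro UN_I[OF V(2)[OF \<omega>(3)]]) (simp add: B_def)
    qed
    have mBC: "{\<omega> \<in> space ?M. B v \<omega> \<and> ?C v \<omega>} \<in> sets ?M" if "v \<in> V J" for v
      by (rule sets_percolation_pred, rule pred_intros_logic(3)[OF mB mC[OF that]])
    have "P.prob {\<omega> \<in> space ?M. Bad (Suc J) \<omega>} \<le> P.prob (\<Union>v\<in>V J. {\<omega> \<in> space ?M. B v \<omega> \<and> ?C v \<omega>})"
      by (rule P.finite_measure_mono[OF cover], rule sets.finite_UN[OF V(1) mBC])
    also have "\<dots> \<le> (\<Sum>v\<in>V J. P.prob {\<omega> \<in> space ?M. B v \<omega> \<and> ?C v \<omega>})"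
      by (rule P.finite_measure_subadditive_finite[OF V(1)], rule image_subsetI, rule mBC)
    also have "\<dots> = (\<Sum>v\<in>V J. P.prob {\<omega> \<in> space ?M. B v \<omega>} * P.prob {\<omega> \<in> space ?M. ?C v \<omega>})"
    proof (rule sum.cong[OF refl])
      fix v assume v: "v \<in> V J"
      have "F J \<inter> W J v = {}" using W(1)[OF v] by auto
      then show "P.prob {\<omega> \<in> space ?M. B v \<omega> \<and> ?C v \<omega>} = P.prob {\<omega> \<in> space ?M. B v \<omega>} * P.prob {\<omega> \<in> space ?M. ?C v \<omega>}"
        by (rule prob_percolation_pair[OF F(2) Wfin(2)[OF v] _ mB depB mC[OF v] depC])
    qed
    also have "\<dots> \<le> (\<Sum>v\<in>V J. P.prob {\<omega> \<in> space ?M. B v \<omega>} * (1 - p ^ c))"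
      by (intro sum_mono mult_left_mono C measure_nonneg)
    also have "\<dots> = (\<Sum>v\<in>V J. P.prob {\<omega> \<in> space ?M. B v \<omega>}) * (1 - p ^ c)"
      by (simp only: sum_distrib_right)
    also have "(\<Sum>v\<in>V J. P.prob {\<omega> \<in> space ?M. B v \<omega>}) = P.prob (\<Union>v\<in>V J. {\<omega> \<in> space ?M. B v \<omega>})"
    proof (rule P.finite_measure_finite_Union[symmetric])
      show "disjoint_family_on (\<lambda>v. {\<omega> \<in> space ?M. B v \<omega>}) (V J)" by (auto simp: disjoint_family_on_def B_def)
    qed (rule V(1), rule image_subsetI, rule sets_percolation_pred[OF mB])
    also have "\<dots> * (1 - p ^ c) \<le> P.prob {\<omega> \<in> space ?M. Bad J \<omega>} * (1 - p ^ c)"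
      by (intro mult_right_mono c P.finite_measure_mono mBad) (auto simp: B_def)
    also have "\<dots> \<le> (1 - p ^ c) ^ J * (1 - p ^ c)"
      by (intro mult_right_mono c Suc.IH)
    finally show ?case by (simp only: power_Suc2)
  qed
  let ?Z = "{\<omega> \<in> space ?M. \<forall>J. Bad J \<omega>}"
  have Z: "?Z \<in> sets ?M"
    by (rule sets_percolation_pred, rule pred_intros_countable(1), rule pred_finitely_many_edges[OF F(1,2) dep_bad])
  have "P.prob ?Z \<le> (1 - p ^ c) ^ J" for J
    by (rule order_trans[OF P.finite_measure_mono[OF _ mBad] bound]) auto
  moreover have "(\<lambda>J. (1 - p ^ c) ^ J) \<longlonglongrightarrow> 0"
    by (rule LIMSEQ_realpow_zero) (use p in \<open>auto simp: power_le_one\<close>)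
  ultimately have "P.prob ?Z \<le> 0" by (intro LIMSEQ_le_const) auto
  then have "P.prob ?Z = 0" using measure_nonneg[of ?M ?Z] by linarith
  then have "AE \<omega> in ?M. \<not> (\<forall>J. Bad J \<omega>)" by (rule P.prob_Collect_eq_0[OF Z, THEN iffD1])
  then show ?thesis by eventually_elim (auto simp: Bad_def)
qed

end

section \<open>Cuts in the integer lattice\<close>

definition unit_step :: "int ^ 'd \<Rightarrow> bool" where
  "unit_step s \<longleftrightarrow> (\<exists>i c. s = axis i c \<and> \<bar>c\<bar> = 1)"

definition adj :: "int ^ 'd \<Rightarrow> int ^ 'd \<Rightarrow> bool" where
  "adj x y \<longleftrightarrow> unit_step (y - x)"

lemma adj_iff_sum: "adj x y \<longleftrightarrow> (\<Sum>i\<in>UNIV. \<bar>x $ i - y $ i\<bar>) = 1"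
proof
  assume "adj x y"
  then obtain i c where ic: "y - x = axis i c" "\<bar>c\<bar> = 1" by (auto simp: adj_def unit_step_def)
  have "\<bar>x $ k - y $ k\<bar> = (if k = i then 1 else 0)" for k
  proof -
    have "y $ k - x $ k = axis i c $ k" using ic(1) by (metis vector_minus_component)
    then show ?thesis using ic(2) by (auto simp: axis_def)
  qed
  then show "(\<Sum>i\<in>UNIV. \<bar>x $ i - y $ i\<bar>) = 1" by simp
next
  assume sum: "(\<Sum>i\<in>UNIV. \<bar>x $ i - y $ i\<bar>) = 1"
  then obtain i where i: "\<bar>x $ i - y $ i\<bar> \<noteq> 0" using sum.neutral by (metis (no_types, lifting) zero_neq_one)
  have split: "\<bar>x $ i - y $ i\<bar> + (\<Sum>k\<in>UNIV - {i}. \<bar>x $ k - y $ k\<bar>) = 1"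
    using sum by (subst (asm) sum.remove[of _ i]) simp_all
  moreover have rest: "0 \<le> (\<Sum>k\<in>UNIV - {i}. \<bar>x $ k - y $ k\<bar>)" by (rule sum_nonneg) simp
  ultimately have one: "\<bar>x $ i - y $ i\<bar> = 1" and "(\<Sum>k\<in>UNIV - {i}. \<bar>x $ k - y $ k\<bar>) = 0" using i by linarith+
  then have zero: "x $ k - y $ k = 0" if "k \<noteq> i" for k
    using that by (subst (asm) sum_nonneg_eq_0_iff) auto
  have "y - x = axis i (y $ i - x $ i)"
    using zero by (auto simp: vec_eq_iff axis_def)
  moreover have "\<bar>y $ i - x $ i\<bar> = 1" using one by (simp add: abs_minus_commute)
  ultimately show "adj x y" unfolding adj_def unit_step_def by (intro exI conjI)
qed

lemma unit_step_uminus: "unit_step s \<Longrightarrow> unit_step (- s)"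
proof -
  assume "unit_step s"
  then obtain i c where "s = axis i c" "\<bar>c\<bar> = 1" by (auto simp: unit_step_def)
  then have "- s = axis i (- c) \<and> \<bar>- c\<bar> = 1" by (simp add: vec_eq_iff axis_def)
  then show ?thesis unfolding unit_step_def by (intro exI)
qed

lemma adj_sym: "adj x y \<longleftrightarrow> adj y x"
  unfolding adj_def using unit_step_uminus[of "y - x"] unit_step_uminus[of "x - y"] by auto

lemma adj_add: "unit_step s \<Longrightarrow> adj x (x + s)"
  by (simp add: adj_def)

lemma adj_axis: "adj x (x + axis i 1)" "adj x (x - axis i 1)"
proof -
  have 1: "unit_step (axis i 1)" unfolding unit_step_def by (intro exI[of _ i] exI[of _ 1]) simp
  then show "adj x (x + axis i 1)" by (rule adj_add)
  show "adj x (x - axis i 1)" using adj_add[OF unit_step_uminus[OF 1], of x] by simp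
qed

lemma adj_component: "adj x y \<Longrightarrow> \<bar>x $ k - y $ k\<bar> \<le> 1"
  using member_le_sum[of k UNIV "\<lambda>i. \<bar>x $ i - y $ i\<bar>"] by (simp add: adj_iff_sum)

subsection \<open>Parity of walks\<close>

text \<open>
  A set \<open>P\<close> of edges meeting every elementary square in an even number of edges is a closed cochain
  modulo 2. Reordering the steps of a walk moves it across elementary squares and does not change
  the parity of the number of times it uses \<open>P\<close>; hence this parity is even along closed walks.
\<close>

primrec parity :: "(int ^ 'd) set set \<Rightarrow> int ^ 'd \<Rightarrow> (int ^ 'd) list \<Rightarrow> bool" where
  "parity P x [] = False"
| "parity P x (s # ss) = (({x, x + s} \<in> P) \<noteq> parity P (x + s) ss)"

definition even_on_squares :: "(int ^ 'd) set set \<Rightarrow> bool" where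
  "even_on_squares P \<longleftrightarrow> (\<forall>x s t. unit_step s \<longrightarrow> unit_step t \<longrightarrow> s \<noteq> t \<longrightarrow> s \<noteq> - t \<longrightarrow>
     (({x, x + s} \<in> P) \<noteq> ({x + s, x + s + t} \<in> P)) = (({x, x + t} \<in> P) \<noteq> ({x + t, x + t + s} \<in> P)))"

lemma parity_append: "parity P x (ss @ ts) = (parity P x ss \<noteq> parity P (x + sum_list ss) ts)"
  by (induction ss arbitrary: x) (auto simp: add.assoc)

text \<open>Degenerate squares are included: for \<open>s = - t\<close> each side runs through one
  edge and straight back, which contributes an even count.\<close>

lemma even_on_squaresD:
  assumes "even_on_squares P" "unit_step s" "unit_step t"
  shows "(({x, x + s} \<in> P) \<noteq> ({x + s, x + s + t} \<in> P)) = (({x, x + t} \<in> P) \<noteq> ({x + t, x + t + s} \<in> P))"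
proof -
  consider "s = t" | "s = - t" | "s \<noteq> t" "s \<noteq> - t" by blast
  then show ?thesis
  proof cases
    case 2
    then show ?thesis by (simp add: insert_commute)
  next
    case 3
    then show ?thesis using assms unfolding even_on_squares_def by blast
  qed simp
qed

lemma parity_move:
  assumes "even_on_squares P" "unit_step s" "\<forall>u\<in>set as. unit_step u"
  shows "parity P x (as @ s # bs) = parity P x (s # as @ bs)"
  using assms(3)
proof (induction as arbitrary: x)
  case (Cons a as)
  have IH: "parity P (x + a) (as @ s # bs) = parity P (x + a) (s # as @ bs)" using Cons by simp
  have comm: "x + a + s = x + s + a" by (simp add: add_ac)
  show ?case
    using even_on_squaresD[OF assms(1,2), of a x] Cons.prems IH by (simp add: comm) argo
qed simp

lemma sum_list_component: "sum_list ss $ i = sum_list (map (\<lambda>t. t $ i) ss)"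
  by (induction ss) auto

text \<open>A closed walk starting with \<open>s\<close> also contains \<open>- s\<close>, since
  otherwise the coordinate changed by \<open>s\<close> would drift in one direction. Move
  \<open>- s\<close> right behind \<open>s\<close>, cancel the pair, and induct on the
  length.\<close>

lemma parity_closed_walk:
  assumes "even_on_squares P" "\<forall>u\<in>set ss. unit_step u" "sum_list ss = 0"
  shows "\<not> parity P x ss"
  using assms(2,3)
proof (induction "length ss" arbitrary: ss x rule: less_induct)
  case less
  show ?case
  proof (cases ss)
    case (Cons s ss')
    obtain i c where ic: "s = axis i c" "\<bar>c\<bar> = 1" using less.prems Cons by (auto simp: unit_step_def)
    have "- s \<in> set ss'"
    proof (rule ccontr)
      assume notin: "- s \<notin> set ss'"
      have "0 \<le> c * t $ i" if "t \<in> set ss'" for t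
      proof -
        obtain j c' where t: "t = axis j c'" "\<bar>c'\<bar> = 1" using less.prems Cons \<open>t \<in> set ss'\<close> by (auto simp: unit_step_def)
        show ?thesis
        proof (cases "j = i")
          case True
          have "c' \<noteq> - c"
          proof
            assume "c' = - c"
            then have "t = - s" using t ic True by (simp add: vec_eq_iff axis_def)
            then show False using notin \<open>t \<in> set ss'\<close> by simp
          qed
          then have "c' = c" using t(2) ic(2) by linarith
          then show ?thesis using t True by (simp add: axis_def)
        next
          case False
          then show ?thesis using t by (simp add: axis_def)
        qed
      qed
      then have "0 \<le> sum_list (map (\<lambda>t. c * t $ i) ss')" by (intro sum_list_nonneg) auto
      then have "0 \<le> c * sum_list (map (\<lambda>t. t $ i) ss')" by (simp add: sum_list_const_mult)
      moreover have "c * (s $ i + sum_list (map (\<lambda>t. t $ i) ss')) = 0"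
        using less.prems(2) Cons sum_list_component[of ss i] by simp
      moreover have "c * s $ i = 1" using ic by (auto simp: axis_def abs_if split: if_splits)
      ultimately show False by (simp add: distrib_left)
    qed
    then obtain as bs where ss': "ss' = as @ - s # bs" by (meson split_list)
    have us: "unit_step s" "\<forall>u\<in>set as. unit_step u" "\<forall>u\<in>set (as @ bs). unit_step u" "unit_step (- s)"
      using less.prems(1) Cons ss' by auto
    have "sum_list (as @ bs) = 0" using less.prems(2) Cons ss' by (simp add: algebra_simps)
    then have "\<not> parity P x (as @ bs)"
      by (intro less.hyps us(3)) (simp_all add: Cons ss')
    moreover have "parity P x ss = parity P x (as @ bs)"
      using parity_move[OF assms(1) us(4,2), of "x + s" bs] by (simp add: Cons ss' insert_commute) argo
    ultimately show ?thesis by simp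
  qed simp
qed

subsection \<open>Connectedness of minimal cuts\<close>

definition connected_set :: "(int ^ 'd) set \<Rightarrow> bool" where
  "connected_set D \<longleftrightarrow> (\<forall>a\<in>D. \<forall>b\<in>D. (a, b) \<in> {(x, y). adj x y \<and> x \<in> D \<and> y \<in> D}\<^sup>*)"

definition edge_cut :: "(int ^ 'd) set \<Rightarrow> (int ^ 'd) set set" where
  "edge_cut D = {{a, b} | a b. adj a b \<and> a \<in> D \<and> b \<notin> D}"

lemma doubleton_in_cut: "{a, b} \<in> edge_cut D \<longleftrightarrow> adj a b \<and> (a \<in> D) \<noteq> (b \<in> D)"
proof
  assume "{a, b} \<in> edge_cut D"
  then obtain u v where "{a, b} = {u, v}" "adj u v" "u \<in> D" "v \<notin> D" unfolding edge_cut_def by blast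
  then show "adj a b \<and> (a \<in> D) \<noteq> (b \<in> D)" using adj_sym[of a b] by (auto simp: doubleton_eq_iff)
next
  assume ab: "adj a b \<and> (a \<in> D) \<noteq> (b \<in> D)"
  show "{a, b} \<in> edge_cut D"
  proof (cases "a \<in> D")
    case True
    then show ?thesis using ab unfolding edge_cut_def by blast
  next
    case False
    then have "{b, a} \<in> edge_cut D" using ab adj_sym[of a b] unfolding edge_cut_def by blast
    then show ?thesis by (simp add: insert_commute)
  qed
qed

lemma cut_compl: "edge_cut (- D) = edge_cut D"
proof -
  have "edge_cut (- D) \<subseteq> edge_cut D" for D :: "(int ^ 'd) set"
  proof
    fix e assume "e \<in> edge_cut (- D)"
    then obtain a b where "e = {a, b}" "adj a b" "a \<notin> D" "b \<in> D" by (auto simp: edge_cut_def)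
    then show "e \<in> edge_cut D" by (simp add: doubleton_in_cut)
  qed
  from this[of D] this[of "- D"] show ?thesis by auto
qed

text \<open>Coarser than lying on a common elementary square, yet easy to test coordinatewise, and
  each lattice edge still has boundedly many such neighbours.\<close>

definition star_adjacent :: "(int ^ 'd) set \<Rightarrow> (int ^ 'd) set \<Rightarrow> bool" where
  "star_adjacent f g \<longleftrightarrow> (\<forall>a\<in>f. \<forall>b\<in>g. \<forall>i. \<bar>a $ i - b $ i\<bar> \<le> 1)"

lemma star_square:
  assumes "unit_step s" "unit_step t" "s \<noteq> t" "s \<noteq> - t"
    and "f \<subseteq> {x, x + s, x + t, x + s + t}" "g \<subseteq> {x, x + s, x + t, x + s + t}"
  shows "star_adjacent f g"
  unfolding star_adjacent_def
proof (intro ballI allI)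
  fix a b k assume "a \<in> f" "b \<in> g"
  obtain i c where s: "s = axis i c" "\<bar>c\<bar> = 1" using assms(1) by (auto simp: unit_step_def)
  obtain j c' where t: "t = axis j c'" "\<bar>c'\<bar> = 1" using assms(2) by (auto simp: unit_step_def)
  have "i \<noteq> j"
  proof
    assume "i = j"
    have "c = c' \<or> c = - c'" using s(2) t(2) by linarith
    then have "s = t \<or> s = - t" using s t \<open>i = j\<close> by (auto simp: vec_eq_iff axis_def)
    then show False using assms(3,4) by simp
  qed
  then have zero: "s $ k = 0 \<or> t $ k = 0" using s t by (auto simp: axis_def)
  have le: "\<bar>s $ k\<bar> \<le> 1" "\<bar>t $ k\<bar> \<le> 1" using s t by (auto simp: axis_def)
  have a: "a $ k \<in> {x $ k, x $ k + s $ k, x $ k + t $ k, x $ k + s $ k + t $ k}"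
    using assms(5) \<open>a \<in> f\<close> by auto
  have b: "b $ k \<in> {x $ k, x $ k + s $ k, x $ k + t $ k, x $ k + s $ k + t $ k}"
    using assms(6) \<open>b \<in> g\<close> by auto
  show "\<bar>a $ k - b $ k\<bar> \<le> 1"
    using zero
  proof
    assume "s $ k = 0"
    then have "a $ k = x $ k \<or> a $ k = x $ k + t $ k" "b $ k = x $ k \<or> b $ k = x $ k + t $ k" using a b by auto
    then show ?thesis using le by auto
  next
    assume "t $ k = 0"
    then have "a $ k = x $ k \<or> a $ k = x $ k + s $ k" "b $ k = x $ k \<or> b $ k = x $ k + s $ k" using a b by auto
    then show ?thesis using le by auto
  qed
qed

lemma walk_avoiding:
  assumes "(x, y) \<in> {(x, y). adj x y \<and> x \<in> D \<and> y \<in> D}\<^sup>*"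
    and "\<And>u v. u \<in> D \<Longrightarrow> v \<in> D \<Longrightarrow> {u, v} \<notin> P"
  shows "\<exists>ss. (\<forall>u\<in>set ss. unit_step u) \<and> x + sum_list ss = y \<and> \<not> parity P x ss"
  using assms(1)
proof (induction rule: rtrancl_induct)
  case base show ?case by (intro exI[of _ "[]"]) simp
next
  case (step y z)
  then obtain ss where ss: "\<forall>u\<in>set ss. unit_step u" "x + sum_list ss = y" "\<not> parity P x ss" by auto
  have z: "unit_step (z - y)" "{y, z} \<notin> P" using step.hyps(2) assms(2) by (auto simp: adj_def)
  show ?case
  proof (intro exI conjI)
    have "x + sum_list (ss @ [z - y]) = (x + sum_list ss) + (z - y)" by (simp add: add.assoc)
    then show "x + sum_list (ss @ [z - y]) = z" using ss(2) by simp
  qed (use ss z in \<open>simp_all add: parity_append\<close>)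
qed

text \<open>
  If a cut between two connected sets split into two parts not sharing an elementary square, each
  part would be even on squares; but a closed walk crossing the edge_cut once through either part uses
  the first part exactly once.
\<close>

theorem cut_star_connected:
  fixes D :: "(int ^ 'd) set"
  assumes "connected_set D" "connected_set (- D)" "e \<in> edge_cut D" "g \<in> edge_cut D"
  shows "(e, g) \<in> {(f, f'). f \<in> edge_cut D \<and> f' \<in> edge_cut D \<and> star_adjacent f f'}\<^sup>*"
proof (rule ccontr)
  let ?R = "{(f, f'). f \<in> edge_cut D \<and> f' \<in> edge_cut D \<and> star_adjacent f f'}"
  assume not: "(e, g) \<notin> ?R\<^sup>*"
  define P where "P = {f \<in> edge_cut D. (e, f) \<in> ?R\<^sup>*}"
  have P_iff: "f \<in> P \<longleftrightarrow> f' \<in> P" if "f \<in> edge_cut D" "f' \<in> edge_cut D" "star_adjacent f f'" for f f'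
  proof -
    have "(f, f') \<in> ?R" "(f', f) \<in> ?R"
      using that by (auto simp: star_adjacent_def) (metis abs_minus_commute)+
    then show ?thesis unfolding P_def using that by (auto intro: rtrancl_into_rtrancl)
  qed
  have "even_on_squares P"
    unfolding even_on_squares_def
  proof (intro allI impI)
    fix x s t :: "int ^ 'd" assume st: "unit_step s" "unit_step t" "s \<noteq> t" "s \<noteq> - t"
    let ?e1 = "{x, x + s}" and ?e2 = "{x + s, x + s + t}" and ?e3 = "{x, x + t}" and ?e4 = "{x + t, x + t + s}"
    have comm: "x + t + s = x + s + t" by (simp add: add_ac)
    have star_adjacent: "star_adjacent f f'" if "f \<in> {?e1, ?e2, ?e3, ?e4}" "f' \<in> {?e1, ?e2, ?e3, ?e4}" for f f'
      by (rule star_square[OF st]) (use that comm in auto)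
    \<comment> \<open>The four edges of a square are mutually star adjacent, so \<open>P\<close>
      takes either all its cut edges or none. The full cut is even on squares because each of its
      edges flips membership in \<open>D\<close>.\<close>
    have all_or_none: "(\<forall>f\<in>{?e1, ?e2, ?e3, ?e4}. f \<in> P \<longleftrightarrow> f \<in> edge_cut D) \<or> (\<forall>f\<in>{?e1, ?e2, ?e3, ?e4}. f \<notin> P)"
    proof (cases "\<exists>f\<in>{?e1, ?e2, ?e3, ?e4}. f \<in> P")
      case True
      then obtain f where f: "f \<in> {?e1, ?e2, ?e3, ?e4}" "f \<in> P" by (rule bexE)
      have "f' \<in> P \<longleftrightarrow> f' \<in> edge_cut D" if "f' \<in> {?e1, ?e2, ?e3, ?e4}" for f'
        using P_iff[OF _ _ star_adjacent[OF f(1) that]] f(2) by (auto simp: P_def)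
      then show ?thesis by blast
    qed blast
    have adjs: "adj x (x + s)" "adj (x + s) (x + s + t)" "adj x (x + t)" "adj (x + t) (x + t + s)"
      using st by (simp_all add: adj_add)
    have cuts: "(?e1 \<in> edge_cut D) = ((x \<in> D) \<noteq> (x + s \<in> D))" "(?e2 \<in> edge_cut D) = ((x + s \<in> D) \<noteq> (x + s + t \<in> D))"
      "(?e3 \<in> edge_cut D) = ((x \<in> D) \<noteq> (x + t \<in> D))" "(?e4 \<in> edge_cut D) = ((x + t \<in> D) \<noteq> (x + t + s \<in> D))"
      using adjs by (simp_all add: doubleton_in_cut)
    from all_or_none show "((?e1 \<in> P) \<noteq> (?e2 \<in> P)) = ((?e3 \<in> P) \<noteq> (?e4 \<in> P))"
    proof
      assume "\<forall>f\<in>{?e1, ?e2, ?e3, ?e4}. f \<in> P \<longleftrightarrow> f \<in> edge_cut D"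
      then have "(?e1 \<in> P) = (?e1 \<in> edge_cut D)" "(?e2 \<in> P) = (?e2 \<in> edge_cut D)" "(?e3 \<in> P) = (?e3 \<in> edge_cut D)"
        "(?e4 \<in> P) = (?e4 \<in> edge_cut D)" by simp_all
      then show ?thesis unfolding comm cuts[unfolded comm] by argo
    next
      assume "\<forall>f\<in>{?e1, ?e2, ?e3, ?e4}. f \<notin> P"
      then have "?e1 \<notin> P" "?e2 \<notin> P" "?e3 \<notin> P" "?e4 \<notin> P" by simp_all
      then show ?thesis by simp
    qed
  qed
  obtain a b where ab: "e = {a, b}" "adj a b" "a \<in> D" "b \<notin> D" using assms(3) by (auto simp: edge_cut_def)
  obtain a' b' where ab': "g = {a', b'}" "adj a' b'" "a' \<in> D" "b' \<notin> D" using assms(4) by (auto simp: edge_cut_def)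
  have eP: "{a, b} \<in> P" using ab assms(3) by (simp add: P_def)
  have gP: "{b', a'} \<notin> P" using ab' not by (simp add: P_def insert_commute)
  have inP: "{u, v} \<notin> P" if "(u \<in> D) = (v \<in> D)" for u v using that by (simp add: P_def doubleton_in_cut)
  have "(b, b') \<in> {(x, y). adj x y \<and> x \<in> - D \<and> y \<in> - D}\<^sup>*"
    using assms(2) ab(4) ab'(4) by (simp add: connected_set_def)
  from walk_avoiding[OF this, of P] inP obtain ss where
    ss: "\<forall>u\<in>set ss. unit_step u" "b + sum_list ss = b'" "\<not> parity P b ss" by auto
  have "(a', a) \<in> {(x, y). adj x y \<and> x \<in> D \<and> y \<in> D}\<^sup>*"
    using assms(1) ab(3) ab'(3) by (simp add: connected_set_def)
  from walk_avoiding[OF this, of P] inP obtain ts where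
    ts: "\<forall>u\<in>set ts. unit_step u" "a' + sum_list ts = a" "\<not> parity P a' ts" by auto
  \<comment> \<open>Leave \<open>D\<close> through \<open>e\<close>, walk outside \<open>D\<close>
    to \<open>b'\<close>, re-enter through \<open>g\<close>, and return inside \<open>D\<close> to
    \<open>a\<close>. Only the crossing of \<open>e\<close> uses \<open>P\<close>, so the parity of
    this closed walk is odd.\<close>
  let ?w = "(b - a) # ss @ (a' - b') # ts"
  have "\<forall>u\<in>set ?w. unit_step u"
    using ss(1) ts(1) ab(2) ab'(2) adj_sym[of a' b'] by (auto simp: adj_def)
  moreover have "sum_list ?w = 0"
  proof -
    have "a + sum_list ?w = (b + sum_list ss) + ((a' - b') + sum_list ts)" by (simp add: algebra_simps)
    also have "\<dots> = a' + sum_list ts" using ss(2) by (simp add: algebra_simps)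
    also have "\<dots> = a" by (rule ts(2))
    finally show ?thesis by (simp only: add_cancel_left_right)
  qed
  ultimately have "\<not> parity P a ?w" by (rule parity_closed_walk[OF \<open>even_on_squares P\<close>])
  moreover have "parity P a ?w"
    using eP gP ss ts by (simp add: parity_append)
  ultimately show False by simp
qed

section \<open>Finite cuts in dimension at least two\<close>

lemma finite_int_box: "finite {x :: int ^ 'd. \<forall>i. \<bar>x $ i - z $ i\<bar> \<le> r}"
proof -
  let ?B = "\<Pi>\<^sub>E i\<in>UNIV. {z $ i - r..z $ i + r}"
  have "{x :: int ^ 'd. \<forall>i. \<bar>x $ i - z $ i\<bar> \<le> r} \<subseteq> (\<lambda>f. \<chi> i. f i) ` ?B"
  proof
    fix x :: "int ^ 'd" assume "x \<in> {x. \<forall>i. \<bar>x $ i - z $ i\<bar> \<le> r}"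
    then have le: "\<bar>x $ i - z $ i\<bar> \<le> r" for i by simp
    have "x $ i \<in> {z $ i - r..z $ i + r}" for i using le[of i] by (simp add: abs_le_iff)
    then show "x \<in> (\<lambda>f. \<chi> i. f i) ` ?B" by (intro image_eqI[of _ _ "\<lambda>i. x $ i"]) (simp_all add: PiE_iff)
  qed
  moreover have "finite ?B" by (intro finite_PiE) simp_all
  ultimately show ?thesis by (meson finite_imageI finite_subset)
qed

text \<open>Membership in \<open>D\<close> is constant along edges outside a box of radius
  \<open>N\<close> containing the cut, and the exterior of the box is connected: with a large
  coordinate \<open>k\<close> held fixed, set all others to \<open>N + 1\<close>, then move
  \<open>k\<close>, now protected by another large coordinate. So all exterior points agree with the
  corner \<open>q\<close>.\<close>

lemma finite_cut_separates:
  fixes D :: "(int ^ 'd) set"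
  assumes "CARD('d) \<ge> 2" "finite (edge_cut D)"
  shows "finite D \<or> finite (- D)"
proof -
  have "finite (\<Union>(edge_cut D))" using assms(2) by (auto simp: edge_cut_def)
  then have fin: "finite ((\<lambda>(v, k). \<bar>v $ k\<bar>) ` (\<Union>(edge_cut D) \<times> (UNIV :: 'd set)))"
    by (intro finite_imageI finite_cartesian_product finite)
  \<comment> \<open>The inserted 0 keeps \<open>Max\<close> meaningful for an empty cut and makes
    \<open>N\<close> nonnegative, so that \<open>N + 1\<close> lies outside the box.\<close>
  define N where "N = Max (insert 0 ((\<lambda>(v, k). \<bar>v $ k\<bar>) ` (\<Union>(edge_cut D) \<times> UNIV)))"
  have N: "\<bar>v $ k\<bar> \<le> N" if "f \<in> edge_cut D" "v \<in> f" for f v k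
    unfolding N_def
  proof (rule Max_ge)
    have "(v, k) \<in> \<Union>(edge_cut D) \<times> UNIV" using that by auto
    then have "(case (v, k) of (v, k) \<Rightarrow> \<bar>v $ k\<bar>) \<in> (\<lambda>(v, k). \<bar>v $ k\<bar>) ` (\<Union>(edge_cut D) \<times> UNIV)" by (rule imageI)
    then show "\<bar>v $ k\<bar> \<in> insert 0 ((\<lambda>(v, k). \<bar>v $ k\<bar>) ` (\<Union>(edge_cut D) \<times> UNIV))" by simp
  qed (use fin in simp)
  have step: "u \<in> D \<longleftrightarrow> v \<in> D" if "adj u v" "N < \<bar>u $ k\<bar>" for u v k
  proof (rule ccontr)
    assume "\<not> ?thesis"
    then have "{u, v} \<in> edge_cut D" using that(1) by (simp add: doubleton_in_cut)
    from N[OF this, of u k] that(2) show False by simp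
  qed
  have line: "x \<in> D \<longleftrightarrow> x + axis j t \<in> D" if "j \<noteq> k" "N < \<bar>x $ k\<bar>" for x j k t
  proof (induction t rule: int_induct[of _ 0])
    case base
    have "x + axis j 0 = x" by (simp add: vec_eq_iff axis_def)
    then show ?case by (simp only:)
  next
    case (step1 t)
    have eq: "x + axis j (t + 1) = (x + axis j t) + axis j 1" by (simp add: vec_eq_iff axis_def)
    have "N < \<bar>(x + axis j t) $ k\<bar>" using that by (simp add: axis_def)
    then show ?case unfolding eq by (rule trans[OF step1(2) step[OF adj_axis(1)]])
  next
    case (step2 t)
    have eq: "x + axis j (t - 1) = (x + axis j t) - axis j 1" by (simp add: vec_eq_iff axis_def)
    have "N < \<bar>(x + axis j t) $ k\<bar>" using that by (simp add: axis_def)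
    then show ?case unfolding eq by (rule trans[OF step2(2) step[OF adj_axis(2)]])
  qed
  have coords: "x \<in> D \<longleftrightarrow> (\<chi> l. if l \<in> K then N + 1 else x $ l) \<in> D"
    if "finite K" "k \<notin> K" "N < \<bar>x $ k\<bar>" for x K k
    using that(1,2)
  proof (induction K rule: finite_induct)
    case empty
    have "(\<chi> l. if l \<in> {} then N + 1 else x $ l) = x" by (simp add: vec_eq_iff)
    then show ?case by (simp only:)
  next
    case (insert j K)
    let ?y = "\<chi> l. if l \<in> K then N + 1 else x $ l"
    have "(\<chi> l. if l \<in> insert j K then N + 1 else x $ l) = ?y + axis j (N + 1 - x $ j)"
      using insert.hyps by (auto simp: vec_eq_iff axis_def)
    moreover have "N < \<bar>?y $ k\<bar>" using that(3) insert.prems by simp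
    ultimately show ?case using insert line[of j k ?y "N + 1 - x $ j"] by auto
  qed
  define q :: "int ^ 'd" where "q = (\<chi> l. N + 1)"
  have to_q: "x \<in> D \<longleftrightarrow> q \<in> D" if x: "N < \<bar>x $ k\<bar>" for x k
  proof -
    obtain j where j: "j \<noteq> k"
    proof -
      have "UNIV \<noteq> {k}"
      proof
        assume "UNIV = {k}"
        then have "CARD('d) = card {k}" by (rule arg_cong)
        then show False using assms(1) by simp
      qed
      then show ?thesis using that by auto
    qed
    let ?y = "\<chi> l. if l \<in> UNIV - {k} then N + 1 else x $ l"
    have "x \<in> D \<longleftrightarrow> ?y \<in> D" by (rule coords[OF _ _ x]) simp_all
    also have "\<dots> \<longleftrightarrow> ?y + axis k (N + 1 - x $ k) \<in> D"
      by (rule line[of k j]) (use j in simp_all)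
    also have "?y + axis k (N + 1 - x $ k) = q" by (auto simp: q_def vec_eq_iff axis_def)
    finally show ?thesis .
  qed
  let ?B = "{x :: int ^ 'd. \<forall>i. \<bar>x $ i - 0 $ i\<bar> \<le> N}"
  have out: "\<exists>k. N < \<bar>x $ k\<bar>" if "x \<notin> ?B" for x using that by (auto simp: not_le)
  have in_box: "x \<in> ?B" if "(x \<in> D) \<noteq> (q \<in> D)" for x
  proof (rule ccontr)
    assume "x \<notin> ?B"
    then obtain k where "N < \<bar>x $ k\<bar>" using out by auto
    from to_q[OF this] that show False by simp
  qed
  show ?thesis
  proof (cases "q \<in> D")
    case True
    have "- D \<subseteq> ?B" by (rule subsetI, rule in_box) (use True in simp)
    then have "finite (- D)" by (rule finite_subset[OF _ finite_int_box])
    then show ?thesis ..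
  next
    case False
    have "D \<subseteq> ?B" by (rule subsetI, rule in_box) (use False in simp)
    then have "finite D" by (rule finite_subset[OF _ finite_int_box])
    then show ?thesis ..
  qed
qed

subsection \<open>Separating a cluster from its complement\<close>

text \<open>\<open>D\<close> is the component of \<open>x\<close> in the complement of
  \<open>C\<close>. Its complement is connected because it consists of \<open>C\<close> and the
  remaining components, each joined to \<open>C\<close> by a lattice path. Both sides are then
  connected, as \<open>cut_star_connected\<close> requires.\<close>

lemma component_of_complement:
  fixes C :: "(int ^ 'd) set"
  assumes conn: "\<And>y z :: int ^ 'd. (y, z) \<in> {(x, y). adj x y}\<^sup>*"
    and C: "connected_set C" "c \<in> C" and x: "x \<notin> C"
  defines "D \<equiv> {y. (x, y) \<in> {(u, v). adj u v \<and> u \<notin> C \<and> v \<notin> C}\<^sup>*}"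
  shows "connected_set D" "connected_set (- D)" "x \<in> D" "D \<inter> C = {}"
    and "\<And>a b. adj a b \<Longrightarrow> a \<in> D \<Longrightarrow> b \<notin> D \<Longrightarrow> b \<in> C"
    and "\<And>a b. adj a b \<Longrightarrow> a \<in> D \<Longrightarrow> b \<notin> C \<Longrightarrow> b \<in> D"
proof -
  let ?R = "{(u, v). adj u v \<and> u \<notin> C \<and> v \<notin> C}"
  have "sym ?R" using adj_sym unfolding sym_def by blast
  then have symR: "(v, u) \<in> ?R\<^sup>*" if "(u, v) \<in> ?R\<^sup>*" for u v using symD[OF sym_rtrancl that] by blast
  have D_iff: "y \<in> D \<longleftrightarrow> (x, y) \<in> ?R\<^sup>*" for y by (simp add: D_def)
  show xD: "x \<in> D" by (simp add: D_iff)
  have notC: "y \<notin> C" if "y \<in> D" for y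
  proof -
    have "(x, y) \<in> ?R\<^sup>*" using that by (simp only: D_iff)
    then show ?thesis by (cases rule: rtranclE) (use x in auto)
  qed
  then show disj: "D \<inter> C = {}" by auto
  show ext: "b \<in> D" if "adj a b" "a \<in> D" "b \<notin> C" for a b
  proof -
    have "(a, b) \<in> ?R" using that(1,3) notC[OF that(2)] by simp
    with that(2) show ?thesis unfolding D_iff by (rule rtrancl_into_rtrancl)
  qed
  show out: "b \<in> C" if "adj a b" "a \<in> D" "b \<notin> D" for a b
    using ext[OF that(1,2)] that(3) by auto
  show "connected_set D"
    unfolding connected_set_def
  proof (intro ballI)
    fix a b assume a: "a \<in> D" and b: "b \<in> D"
    have "(a, b) \<in> ?R\<^sup>*"
      by (rule rtrancl_trans[OF symR[OF a[unfolded D_iff]] b[unfolded D_iff]])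
    then show "(a, b) \<in> {(x, y). adj x y \<and> x \<in> D \<and> y \<in> D}\<^sup>*"
    proof (induction rule: rtrancl_induct)
      case (step y z)
      have "y \<in> D" using a step.hyps(1) unfolding D_iff by (rule rtrancl_trans)
      then have "(y, z) \<in> {(x, y). adj x y \<and> x \<in> D \<and> y \<in> D}" using step.hyps(2) ext[of y z] by simp
      with step.IH show ?case by (rule rtrancl_into_rtrancl)
    qed simp
  qed
  let ?S = "{(x, y). adj x y \<and> x \<in> - D \<and> y \<in> - D}"
  have "sym ?S" using adj_sym unfolding sym_def by blast
  then have symS: "(v, u) \<in> ?S\<^sup>*" if "(u, v) \<in> ?S\<^sup>*" for u v using symD[OF sym_rtrancl that] by blast
  have toC: "\<exists>c'\<in>C. (y, c') \<in> ?S\<^sup>*" if "y \<notin> D" for y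
    using conn[of y c] that
  proof (induction rule: converse_rtrancl_induct)
    case base show ?case by (intro bexI[of _ c] rtrancl.rtrancl_refl C(2))
  next
    case (step y z)
    show ?case
    proof (cases "y \<in> C")
      case False
      have yz: "adj y z" using step.hyps(1) by simp
      have "z \<notin> D"
      proof
        assume "z \<in> D"
        then have "y \<in> C" using out[of z y] yz adj_sym[of y z] step.prems by simp
        then show False using False by simp
      qed
      with step.IH obtain c' where "c' \<in> C" "(z, c') \<in> ?S\<^sup>*" by auto
      moreover have "(y, z) \<in> ?S" using yz step.prems \<open>z \<notin> D\<close> by simp
      ultimately show ?thesis by (intro bexI[of _ c'] converse_rtrancl_into_rtrancl[of y z])
    next
      case True
      then show ?thesis by (intro bexI[of _ y] rtrancl.rtrancl_refl)
    qed
  qed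
  show "connected_set (- D)"
    unfolding connected_set_def
  proof (intro ballI)
    fix a b assume "a \<in> - D" "b \<in> - D"
    then obtain ca cb where c: "ca \<in> C" "(a, ca) \<in> ?S\<^sup>*" "cb \<in> C" "(b, cb) \<in> ?S\<^sup>*"
      using toC[of a] toC[of b] by auto
    have "(ca, cb) \<in> {(x, y). adj x y \<and> x \<in> C \<and> y \<in> C}\<^sup>*" using C(1) c by (simp add: connected_set_def)
    moreover have "{(x, y). adj x y \<and> x \<in> C \<and> y \<in> C} \<subseteq> ?S" using notC by auto
    ultimately have "(ca, cb) \<in> ?S\<^sup>*" by (rule subsetD[OF rtrancl_mono, rotated])
    from rtrancl_trans[OF rtrancl_trans[OF c(2) this] symS[OF c(4)]] show "(a, b) \<in> ?S\<^sup>*" .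
  qed
qed

subsection \<open>Chains of edges\<close>

definition lattice_edges :: "(int ^ 'd) set set" where
  "lattice_edges = {{x, y} | x y. adj x y}"

lemma lattice_edgesE:
  assumes "e \<in> lattice_edges"
  obtains x y where "e = {x, y}" "adj x y"
  using assms unfolding lattice_edges_def by blast

primrec edge_chains :: "nat \<Rightarrow> (int ^ 'd) set \<Rightarrow> (int ^ 'd) set list set" where
  "edge_chains 0 e = {[e]}"
| "edge_chains (Suc k) e = (\<Union>g\<in>{g \<in> lattice_edges. star_adjacent e g}. (#) e ` edge_chains k g)"

lemma chains_properties:
  assumes "xs \<in> edge_chains k e" "e \<in> lattice_edges"
  shows "length xs = Suc k \<and> set xs \<subseteq> lattice_edges"
  using assms
proof (induction k arbitrary: e xs)
  case (Suc k)
  from Suc.prems(1) obtain g ys where g: "g \<in> lattice_edges" "ys \<in> edge_chains k g" "xs = e # ys"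
    unfolding edge_chains.simps by auto
  then show ?case using Suc.IH[OF g(2,1)] Suc.prems(2) by simp
qed simp

lemma in_chains:
  assumes "successively star_adjacent xs" "set xs \<subseteq> lattice_edges" "length xs = Suc k"
  shows "xs \<in> edge_chains k (hd xs)"
  using assms
proof (induction k arbitrary: xs)
  case 0
  then obtain e where "xs = [e]" by (auto simp: length_Suc_conv)
  then show ?case by simp
next
  case (Suc k)
  then obtain e g ys where xs: "xs = e # g # ys" by (auto simp: length_Suc_conv)
  have "g # ys \<in> edge_chains k (hd (g # ys))" by (rule Suc.IH) (use Suc.prems xs in simp_all)
  then show ?case using Suc.prems unfolding xs edge_chains.simps by (intro UN_I[of g]) simp_all
qed

text \<open>Both endpoints of an edge star adjacent to \<open>e\<close> lie in the cube of radius 1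
  around a fixed endpoint of \<open>e\<close>; the square counts pairs of such points.\<close>

definition chain_degree :: "'d::finite itself \<Rightarrow> nat" where
  "chain_degree _ = (card {z :: int ^ 'd. \<forall>i. \<bar>z $ i - 0 $ i\<bar> \<le> 1})\<^sup>2"

lemma star_neighbours:
  fixes e :: "(int ^ 'd) set"
  assumes "e \<in> lattice_edges"
  shows "finite {g \<in> lattice_edges. star_adjacent e g}" "card {g \<in> lattice_edges. star_adjacent e g} \<le> chain_degree TYPE('d)"
proof -
  let ?Q = "{z :: int ^ 'd. \<forall>i. \<bar>z $ i - 0 $ i\<bar> \<le> 1}"
  obtain a where a: "a \<in> e" using assms by (auto elim: lattice_edgesE)
  have sub: "{g \<in> lattice_edges. star_adjacent e g} \<subseteq> (\<lambda>(u, v). {a + u, a + v}) ` (?Q \<times> ?Q)"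
  proof
    fix g assume "g \<in> {g \<in> lattice_edges. star_adjacent e g}"
    then obtain x y where g: "g = {x, y}" "star_adjacent e {x, y}" by (auto elim: lattice_edgesE)
    have "\<bar>a $ i - x $ i\<bar> \<le> 1" "\<bar>a $ i - y $ i\<bar> \<le> 1" for i
      using g(2) a by (auto simp: star_adjacent_def)
    then have "x - a \<in> ?Q" "y - a \<in> ?Q" by (auto simp: abs_minus_commute)
    then show "g \<in> (\<lambda>(u, v). {a + u, a + v}) ` (?Q \<times> ?Q)"
      by (intro image_eqI[of _ _ "(x - a, y - a)"]) (auto simp: g(1))
  qed
  have fin: "finite (?Q \<times> ?Q)" by (intro finite_cartesian_product finite_int_box)
  show "finite {g \<in> lattice_edges. star_adjacent e g}" by (rule finite_subset[OF sub finite_imageI[OF fin]])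
  have "card {g \<in> lattice_edges. star_adjacent e g} \<le> card (?Q \<times> ?Q)"
    using card_mono[OF finite_imageI[OF fin] sub] card_image_le[OF fin] by (rule order_trans)
  then show "card {g \<in> lattice_edges. star_adjacent e g} \<le> chain_degree TYPE('d)"
    by (simp add: chain_degree_def card_cartesian_product power2_eq_square)
qed

lemma finite_chains:
  fixes e :: "(int ^ 'd) set"
  assumes "e \<in> lattice_edges"
  shows "finite (edge_chains k e) \<and> card (edge_chains k e) \<le> chain_degree TYPE('d) ^ k"
  using assms
proof (induction k arbitrary: e)
  case (Suc k)
  let ?N = "{g \<in> lattice_edges. star_adjacent e g}"
  have N: "finite ?N" "card ?N \<le> chain_degree TYPE('d)" using star_neighbours[OF Suc.prems] by auto
  have IH: "finite (edge_chains k g)" "card (edge_chains k g) \<le> chain_degree TYPE('d) ^ k" if "g \<in> ?N" for g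
    using Suc.IH[of g] that by auto
  have "card (edge_chains (Suc k) e) \<le> (\<Sum>g\<in>?N. card ((#) e ` edge_chains k g))"
    unfolding edge_chains.simps by (rule card_UN_le[OF N(1)])
  also have "\<dots> \<le> (\<Sum>g\<in>?N. chain_degree TYPE('d) ^ k)"
    by (intro sum_mono order_trans[OF card_image_le IH(2)] IH(1))
  also have "\<dots> = card ?N * chain_degree TYPE('d) ^ k" by simp
  also have "\<dots> \<le> chain_degree TYPE('d) * chain_degree TYPE('d) ^ k" by (rule mult_right_mono[OF N(2)]) simp
  finally have "card (edge_chains (Suc k) e) \<le> chain_degree TYPE('d) ^ Suc k" by simp
  moreover have "finite (edge_chains (Suc k) e)" unfolding edge_chains.simps by (intro finite_UN_I N(1) finite_imageI IH(1))
  ultimately show ?case by simp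
qed simp

text \<open>Loops are erased as they close. Distinct edges are needed later, because only these
  contribute independent factors \<open>1 - p\<close>.\<close>

lemma rtrancl_distinct_path:
  assumes "(a, b) \<in> R\<^sup>*"
  shows "\<exists>xs. xs \<noteq> [] \<and> hd xs = a \<and> last xs = b \<and> distinct xs \<and> successively (\<lambda>x y. (x, y) \<in> R) xs"
  using assms
proof (induction rule: rtrancl_induct)
  case base show ?case by (intro exI[of _ "[a]"]) simp
next
  case (step y z)
  then obtain xs where xs: "xs \<noteq> []" "hd xs = a" "last xs = y" "distinct xs"
    "successively (\<lambda>x y. (x, y) \<in> R) xs" by blast
  show ?case
  proof (cases "z \<in> set xs")
    case True
    then obtain ys zs where eq: "xs = (ys @ [z]) @ zs" by (metis append.assoc append_Cons append_Nil split_list)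
    have "hd (ys @ [z]) = a" using xs(2) eq by (cases ys) auto
    moreover have "successively (\<lambda>x y. (x, y) \<in> R) (ys @ [z])"
      using xs(5) unfolding eq successively_append_iff by blast
    ultimately show ?thesis using xs(4) eq by (intro exI[of _ "ys @ [z]"]) auto
  next
    case False
    have "successively (\<lambda>x y. (x, y) \<in> R) (xs @ [z])"
      unfolding successively_append_iff using xs step.hyps(2) by simp
    then show ?thesis using xs False by (intro exI[of _ "xs @ [z]"]) auto
  qed
qed

text \<open>Each further edge changes a coordinate by at most 1. That \<open>hd xs\<close> is star
  adjacent to itself says that the first edge has diameter at most 1, which settles chains of one
  edge. Two distant points thus force a long chain.\<close>

lemma chain_position:
  assumes "successively star_adjacent xs" "\<forall>f\<in>set xs. f \<noteq> {}" "xs \<noteq> []" "star_adjacent (hd xs) (hd xs)" "a \<in> hd xs" "b \<in> last xs"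
  shows "a $ i - b $ i \<le> int (length xs)"
  using assms
proof (induction xs arbitrary: b rule: rev_induct)
  case (snoc f xs)
  show ?case
  proof (cases "xs = []")
    case True
    then have "\<bar>a $ i - b $ i\<bar> \<le> 1" using snoc.prems by (auto simp: star_adjacent_def)
    then show ?thesis using True by simp
  next
    case False
    then have "last xs \<in> set xs" by simp
    then obtain v where v: "v \<in> last xs" using snoc.prems(2) by fastforce
    have s: "successively star_adjacent xs" "star_adjacent (last xs) f"
      using snoc.prems(1) False by (auto simp: successively_append_iff)
    have "a $ i - v $ i \<le> int (length xs)"
      using snoc.IH[OF s(1) _ False _ _ v] snoc.prems False by (auto simp: hd_append2)
    moreover have "\<bar>v $ i - b $ i\<bar> \<le> 1" using s(2) v snoc.prems(6) by (auto simp: star_adjacent_def)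
    ultimately show ?thesis by simp
  qed
qed simp

text \<open>The contours of the Peierls argument.\<close>

definition closed_chain :: "nat \<Rightarrow> (int ^ 'd) set \<Rightarrow> ((int ^ 'd) set \<Rightarrow> bool) \<Rightarrow> bool" where
  "closed_chain k e \<omega> \<longleftrightarrow> (\<exists>xs\<in>edge_chains k e. distinct xs \<and> (\<forall>f\<in>set xs. \<omega> f = False))"

lemma cut_subset_edges: "edge_cut D \<subseteq> lattice_edges"
  unfolding edge_cut_def lattice_edges_def by blast

lemma successively_subset:
  assumes "successively (\<lambda>f f'. f \<in> S \<and> f' \<in> S \<and> Q f f') xs" "xs \<noteq> []" "hd xs \<in> S"
  shows "set xs \<subseteq> S"
  using assms
proof (induction xs)
  case (Cons f xs)
  then show ?case by (cases xs) auto
qed simp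

lemma closed_chain_if_path:
  assumes xs: "distinct xs" "xs \<noteq> []" "successively (\<lambda>f f'. f \<in> edge_cut D \<and> f' \<in> edge_cut D \<and> star_adjacent f f') xs"
    and "hd xs \<in> edge_cut D" "Suc k \<le> length xs" "\<forall>f\<in>edge_cut D. \<not> \<omega> f"
  shows "closed_chain k (hd xs) \<omega>"
proof -
  have sub: "set xs \<subseteq> edge_cut D" by (rule successively_subset[OF xs(3,2) assms(4)])
  let ?ys = "take (Suc k) xs"
  have split: "xs = ?ys @ drop (Suc k) xs" by simp
  have "successively star_adjacent xs" by (rule successively_mono[OF xs(3)]) simp
  then have "successively star_adjacent ?ys" by (metis split successively_append_iff)
  moreover have "set ?ys \<subseteq> lattice_edges" using set_take_subset[of "Suc k" xs] sub cut_subset_edges by (meson subset_trans)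
  moreover have "length ?ys = Suc k" using assms(5) by simp
  ultimately have "?ys \<in> edge_chains k (hd ?ys)" by (rule in_chains)
  moreover have "hd ?ys = hd xs" using xs(2) by (cases xs) auto
  moreover have "distinct ?ys" using xs(1) by (rule distinct_take)
  moreover have "\<forall>f\<in>set ?ys. \<omega> f = False" using set_take_subset[of "Suc k" xs] sub assms(6) by auto
  ultimately show ?thesis unfolding closed_chain_def by (intro bexI[of _ ?ys]) simp_all
qed

text \<open>Otherwise every cut edge would be reached from \<open>e\<close> by a chain of at most
  \<open>k\<close> edges, and only finitely many edges can be reached in this way.\<close>

lemma infinite_cut_closed_chain:
  assumes "connected_set D" "connected_set (- D)" "\<forall>f\<in>edge_cut D. \<not> \<omega> f" "e \<in> edge_cut D" "infinite (edge_cut D)"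
  shows "closed_chain k e \<omega>"
proof (rule ccontr)
  assume not: "\<not> closed_chain k e \<omega>"
  have e: "e \<in> lattice_edges" using assms(4) cut_subset_edges by blast
  have "edge_cut D \<subseteq> (\<Union>j<k. last ` edge_chains j e)"
  proof
    fix g assume g: "g \<in> edge_cut D"
    from rtrancl_distinct_path[OF cut_star_connected[OF assms(1,2,4) g]]
    obtain xs where xs: "xs \<noteq> []" "hd xs = e" "last xs = g" "distinct xs"
      "successively (\<lambda>f f'. f \<in> edge_cut D \<and> f' \<in> edge_cut D \<and> star_adjacent f f') xs" by auto
    have "length xs \<le> k"
      using closed_chain_if_path[OF xs(4,1,5) _ _ assms(3), of k] xs(2) assms(4) not by (metis not_less_eq_eq)
    then obtain j where j: "length xs = Suc j" "j < k" using xs(1) by (cases "length xs") auto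
    have "set xs \<subseteq> edge_cut D" by (rule successively_subset[OF xs(5,1)]) (simp add: xs(2) assms(4))
    then have "xs \<in> edge_chains j (hd xs)"
      by (intro in_chains j(1) successively_mono[OF xs(5)] order_trans[OF _ cut_subset_edges]) simp_all
    then show "g \<in> (\<Union>j<k. last ` edge_chains j e)" using j(2) xs(2,3) by auto
  qed
  moreover have "finite (\<Union>j<k. last ` edge_chains j e)" using finite_chains[OF e] by auto
  ultimately show False using assms(5) finite_subset by blast
qed

section \<open>Contours around the origin\<close>

definition axis_edge :: "'d \<Rightarrow> nat \<Rightarrow> (int ^ 'd) set" where
  "axis_edge i m = {axis i (int m), axis i (int (Suc m))}"

lemma adj_axis_Suc: "adj (axis i (int m)) (axis i (int (Suc m)))"
proof -
  have "axis i (int m) + axis i 1 = axis i (int (Suc m))" by (simp add: vec_eq_iff axis_def)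
  then show ?thesis using adj_axis(1)[of "axis i (int m)" i] by (simp only:)
qed

lemma axis_edge_in: "axis_edge i m \<in> lattice_edges"
  unfolding axis_edge_def lattice_edges_def using adj_axis_Suc by blast

lemma axis_exit:
  fixes A :: "(int ^ 'd) set"
  assumes "finite A" "0 \<in> A"
  obtains m where "axis_edge i m \<in> edge_cut A"
proof -
  let ?M = "{m::nat. axis i (int m) \<in> A}"
  have inj: "inj (\<lambda>m. axis i (int m) :: int ^ 'd)" by (auto simp: inj_def axis_eq_axis)
  have fin: "finite ?M" using finite_vimageI[OF assms(1) inj] by (simp add: vimage_def)
  have zero: "axis i (int 0) = (0 :: int ^ 'd)" by (simp add: vec_eq_iff axis_def)
  then have "0 \<in> ?M" using assms(2) by (simp only: mem_Collect_eq)
  then have "?M \<noteq> {}" by (intro notI) (simp only: empty_iff)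
  with fin have "Max ?M \<in> ?M" by (rule Max_in)
  moreover have "Suc (Max ?M) \<notin> ?M" using Max_ge[OF fin] by (metis Suc_n_not_le_n)
  moreover have "adj (axis i (int (Max ?M))) (axis i (int (Suc (Max ?M))))" by (rule adj_axis_Suc)
  ultimately have "axis_edge i (Max ?M) \<in> edge_cut A"
    unfolding axis_edge_def doubleton_in_cut by simp
  then show ?thesis by (rule that)
qed

text \<open>The cut around \<open>A\<close> crosses the axes \<open>i\<close> and \<open>j\<close>.
  A chain inside it from one crossing to the other must bring coordinate \<open>i\<close> from
  \<open>m + 1\<close> down to 0, so it has at least \<open>m + 1\<close> edges. The length is thus
  controlled by the starting point, and the sum over \<open>m\<close> converges.\<close>

lemma finite_set_closed_chain:
  fixes A :: "(int ^ 'd) set"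
  assumes "finite A" "0 \<in> A" "connected_set A" "connected_set (- A)" "\<forall>f\<in>edge_cut A. \<not> \<omega> f" "i \<noteq> j"
  shows "\<exists>m. closed_chain m (axis_edge i m) \<omega>"
proof -
  obtain m where m: "axis_edge i m \<in> edge_cut A" by (rule axis_exit[OF assms(1,2)])
  obtain l where l: "axis_edge j l \<in> edge_cut A" by (rule axis_exit[OF assms(1,2)])
  from rtrancl_distinct_path[OF cut_star_connected[OF assms(3,4) m l]]
  obtain xs where xs: "xs \<noteq> []" "hd xs = axis_edge i m" "last xs = axis_edge j l" "distinct xs"
    "successively (\<lambda>f f'. f \<in> edge_cut A \<and> f' \<in> edge_cut A \<and> star_adjacent f f') xs" by auto
  have sub: "set xs \<subseteq> edge_cut A" by (rule successively_subset[OF xs(5,1)]) (simp add: xs(2) m)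
  have "axis i (int (Suc m)) $ i - axis j (int l) $ i \<le> int (length xs)"
  proof (rule chain_position)
    show "successively star_adjacent xs" by (rule successively_mono[OF xs(5)]) simp
    show "\<forall>f\<in>set xs. f \<noteq> {}" using sub by (auto simp: edge_cut_def)
    show "star_adjacent (hd xs) (hd xs)" unfolding xs(2) by (auto simp: star_adjacent_def axis_edge_def axis_def)
  qed (use xs in \<open>simp_all add: axis_edge_def\<close>)
  then have "Suc m \<le> length xs" using assms(6) by (simp add: axis_def)
  then have "closed_chain m (hd xs) \<omega>"
    by (intro closed_chain_if_path[OF xs(4,1,5) _ _ assms(5)]) (simp_all add: xs(2) m)
  then show ?thesis unfolding xs(2) by blast
qed

section \<open>Percolation on the integer lattice\<close>

locale lattice_graph = weighted_graph \<mu> for \<mu> :: "int ^ 'd \<Rightarrow> int ^ 'd \<Rightarrow> real" +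
  assumes nearest: "nearest_neighbour \<mu>" and dim: "CARD('d) \<ge> 2"
begin

lemma pos_iff: "0 < \<mu> x y \<longleftrightarrow> adj x y"
  using nearest by (simp add: nearest_neighbour_def adj_iff_sum)

lemma edges_eq: "edges \<mu> = lattice_edges"
  by (simp add: edges_def lattice_edges_def pos_iff)

lemma lattice_path: "(y :: int ^ 'd, z) \<in> {(x, y). adj x y}\<^sup>*"
  using positive_path[of y z] by (simp only: pos_iff)

lemma distinct_directions: "\<exists>j. j \<noteq> (i :: 'd)"
proof (rule ccontr)
  assume "\<not> ?thesis"
  then have "UNIV = {i}" by auto
  then have "CARD('d) = card {i}" by (rule arg_cong)
  then show False using dim by simp
qed

subsection \<open>The Peierls argument\<close>

text \<open>The first alternative is produced by a finite contour around the origin that crosses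
  axis \<open>i\<close> at distance \<open>m\<close>, the second by an unbounded contour through
  \<open>e\<close>.\<close>

definition peierls_bad :: "'d \<Rightarrow> ((int ^ 'd) set \<Rightarrow> bool) \<Rightarrow> bool" where
  "peierls_bad i \<omega> \<longleftrightarrow>
     (\<exists>m. closed_chain m (axis_edge i m) \<omega>) \<or> (\<exists>e\<in>lattice_edges. \<forall>k. closed_chain k e \<omega>)"

lemma connected_cluster:
  assumes "F \<subseteq> edges \<mu>"
  shows "connected_set ((adjacency F)\<^sup>* `` {x})"
  unfolding connected_set_def
proof (intro ballI)
  let ?C = "(adjacency F)\<^sup>* `` {x}"
  fix a b assume a: "a \<in> ?C" and b: "b \<in> ?C"
  have "(a, b) \<in> (adjacency F)\<^sup>*"
    using component_eq[OF cluster_in_components a] b by blast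
  then show "(a, b) \<in> {(x, y). adj x y \<and> x \<in> ?C \<and> y \<in> ?C}\<^sup>*"
  proof (induction rule: rtrancl_induct)
    case (step y z)
    have y: "y \<in> ?C" using a step.hyps(1) by (auto intro: rtrancl_trans)
    have e: "{y, z} \<in> F" using step.hyps(2) by simp
    have "z \<in> ?C" by (rule component_closed[OF cluster_in_components y e])
    moreover have "adj y z" using subsetD[OF assms e] by (simp only: edge_pos pos_iff)
    ultimately have "(y, z) \<in> {(x, y). adj x y \<and> x \<in> ?C \<and> y \<in> ?C}" using y by simp
    with step.IH show ?case by (rule rtrancl_into_rtrancl)
  qed simp
qed

text \<open>
  The closed edges separating a cluster from a component of its complement form a star_adjacent-connected
  edge_cut. If the edge_cut is infinite, it contains closed chains of every length. If it is finite, it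
  encloses a finite region, and when this region contains the origin it produces a chain starting on
  the axis whose length is at least the distance to the origin.
\<close>

lemma not_peierls_bad:
  assumes "\<not> peierls_bad i \<omega>"
  defines "C \<equiv> \<lambda>x. (adjacency (open_edges \<mu> \<omega>))\<^sup>* `` {x}"
  shows "infinite (C 0)" and "infinite (C x) \<Longrightarrow> 0 \<in> C x"
proof -
  have F: "open_edges \<mu> \<omega> \<subseteq> edges \<mu>" by (rule open_edges_subset)
  obtain j where j: "j \<noteq> i" using distinct_directions[of i] ..
  have finite_if: "finite D \<or> finite (- D)"
    if "connected_set D" "connected_set (- D)" "\<forall>f\<in>edge_cut D. \<not> \<omega> f" for D
  proof (rule finite_cut_separates[OF dim], rule ccontr)
    assume inf: "infinite (edge_cut D)"
    obtain e where e: "e \<in> edge_cut D" using infinite_imp_nonempty[OF inf] by auto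
    have "\<forall>k. closed_chain k e \<omega>" by (intro allI infinite_cut_closed_chain[OF that e inf])
    then have "peierls_bad i \<omega>"
      unfolding peierls_bad_def using subsetD[OF cut_subset_edges e] by (intro disjI2 bexI[of _ e])
    then show False using assms(1) by simp
  qed
  have no_finite: "infinite A"
    if "0 \<in> A" "connected_set A" "connected_set (- A)" "\<forall>f\<in>edge_cut A. \<not> \<omega> f" for A
  proof
    assume "finite A"
    from finite_set_closed_chain[OF this that j[symmetric]] have "peierls_bad i \<omega>"
      unfolding peierls_bad_def by (rule disjI1)
    then show False using assms(1) by simp
  qed
  have closed: "\<forall>f\<in>edge_cut D. \<not> \<omega> f"
    if D: "D \<inter> C x = {}" "\<And>a b. adj a b \<Longrightarrow> a \<in> D \<Longrightarrow> b \<notin> D \<Longrightarrow> b \<in> C x" for D x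
  proof
    fix f assume f: "f \<in> edge_cut D"
    then obtain a b where ab: "f = {a, b}" "adj a b" "a \<in> D" "b \<notin> D" by (auto simp: edge_cut_def)
    have b: "b \<in> C x" by (rule D(2)[OF ab(2-4)])
    have a: "a \<notin> C x" using D(1) ab(3) by auto
    show "\<not> \<omega> f"
    proof
      assume "\<omega> f"
      then have "{b, a} \<in> open_edges \<mu> \<omega>"
        using subsetD[OF cut_subset_edges f] by (simp add: open_edges_def edges_eq ab(1) insert_commute)
      then have "a \<in> C x" using component_closed[OF cluster_in_components b[unfolded C_def]] by (simp add: C_def)
      then show False using a by simp
    qed
  qed
  have conn: "connected_set (C x)" for x unfolding C_def by (rule connected_cluster[OF F])
  have self: "x \<in> C x" for x by (simp add: C_def)
  show "infinite (C 0)"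
  proof
    assume fin: "finite (C 0)"
    have "inj (\<lambda>m. axis i (int m) :: int ^ 'd)" by (auto simp: inj_def axis_eq_axis)
    then have "finite {m. axis i (int m) \<in> C 0}" using finite_vimageI[OF fin] by (simp add: vimage_def)
    then obtain N where N: "\<forall>m\<in>{m. axis i (int m) \<in> C 0}. m < N" using finite_nat_set_iff_bounded by blast
    then have out: "axis i (int (N + k)) \<notin> C 0" for k using N[rule_format, of "N + k"] by auto
    \<comment> \<open>The complement component containing the far part of the axis is infinite. Its
      closed cut therefore leaves a finite rest, and this rest contains the origin, which
      \<open>no_finite\<close> forbids.\<close>
    let ?D = "{y. (axis i (int N), y) \<in> {(u, v). adj u v \<and> u \<notin> C 0 \<and> v \<notin> C 0}\<^sup>*}"
    have x: "axis i (int N) \<notin> C 0" using out[of 0] by simp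
    note D = component_of_complement[OF lattice_path conn self x]
    have ray: "axis i (int (N + k)) \<in> ?D" for k
    proof (induction k)
      case (Suc k)
      have "adj (axis i (int (N + k))) (axis i (int (N + Suc k)))" using adj_axis_Suc[of i "N + k"] by simp
      from D(6)[OF this Suc out] show ?case .
    qed simp
    have "inj (\<lambda>k. axis i (int (N + k)) :: int ^ 'd)" by (auto simp: inj_def axis_eq_axis)
    then have "infinite (range (\<lambda>k. axis i (int (N + k)) :: int ^ 'd))" by (rule range_inj_infinite)
    moreover have "range (\<lambda>k. axis i (int (N + k))) \<subseteq> ?D" using ray by auto
    ultimately have infD: "infinite ?D" by (rule infinite_super[rotated])
    have cl: "\<forall>f\<in>edge_cut ?D. \<not> \<omega> f" by (rule closed[OF D(4,5)])
    have "finite (- ?D)" using finite_if[OF D(1,2) cl] infD by simp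
    moreover have "infinite (- ?D)"
    proof (rule no_finite)
      show "0 \<in> - ?D" using D(4) self[of 0] by auto
      show "connected_set (- (- ?D))" using D(1) by simp
      show "\<forall>f\<in>edge_cut (- ?D). \<not> \<omega> f" unfolding cut_compl by (rule cl)
    qed (rule D(2))
    ultimately show False by simp
  qed
  show "0 \<in> C x" if inf: "infinite (C x)"
  proof (rule ccontr)
    assume x: "0 \<notin> C x"
    \<comment> \<open>The complement component of the origin is infinite by
      \<open>no_finite\<close>, and its complement contains the infinite cluster of
      \<open>x\<close>; the closed cut between them would have two infinite sides.\<close>
    let ?D = "{y. (0, y) \<in> {(u, v). adj u v \<and> u \<notin> C x \<and> v \<notin> C x}\<^sup>*}"
    note D = component_of_complement[OF lattice_path conn self x]
    have cl: "\<forall>f\<in>edge_cut ?D. \<not> \<omega> f" by (rule closed[OF D(4,5)])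
    have "infinite ?D" by (rule no_finite[OF D(3,1,2) cl])
    moreover have "C x \<subseteq> - ?D" using D(4) by auto
    then have "infinite (- ?D)" using inf by (rule infinite_super)
    ultimately show False using finite_if[OF D(1,2) cl] by simp
  qed
qed

lemma pred_closed_chain:
  assumes "e \<in> lattice_edges"
  shows "Measurable.pred (percolation \<mu> p) (closed_chain k e)"
proof (rule pred_finitely_many_edges)
  let ?E = "\<Union>xs\<in>edge_chains k e. set xs"
  show "finite ?E" using finite_chains[OF assms, of k] by simp
  show "?E \<subseteq> edges \<mu>" unfolding edges_eq by (intro UN_least) (use chains_properties[OF _ assms] in blast)
  show "depends_on ?E (closed_chain k e)"
  proof (rule depends_onI)
    fix \<omega> \<omega>' :: "(int ^ 'd) set \<Rightarrow> bool"
    assume eq: "\<And>f. f \<in> ?E \<Longrightarrow> \<omega> f = \<omega>' f" and "closed_chain k e \<omega>"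
    then obtain xs where xs: "xs \<in> edge_chains k e" "distinct xs" "\<forall>f\<in>set xs. \<omega> f = False"
      by (auto simp: closed_chain_def)
    have "\<omega>' f = False" if f: "f \<in> set xs" for f
    proof -
      have "f \<in> ?E" using xs(1) f by auto
      from eq[OF this] show ?thesis using xs(3) f by simp
    qed
    then show "closed_chain k e \<omega>'" unfolding closed_chain_def using xs(1,2) by (intro bexI[of _ xs]) simp_all
  qed
qed

lemma prob_closed_chain:
  assumes "e \<in> lattice_edges" "p \<in> {0..1}"
  shows "measure (percolation \<mu> p) {\<omega> \<in> space (percolation \<mu> p). closed_chain k e \<omega>}
    \<le> real (chain_degree TYPE('d)) ^ k * (1 - p) ^ Suc k"
proof -
  interpret P: prob_space "percolation \<mu> p" by (rule prob_space_percolation)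
  let ?L = "{xs \<in> edge_chains k e. distinct xs}"
  let ?A = "\<lambda>xs. {\<omega> \<in> space (percolation \<mu> p). \<forall>f\<in>set xs. \<omega> f = False}"
  have fin: "finite (edge_chains k e)" and card: "card (edge_chains k e) \<le> chain_degree TYPE('d) ^ k"
    using finite_chains[OF assms(1), of k] by auto
  have finL: "finite ?L" using fin by simp
  have sub: "set xs \<subseteq> edges \<mu>" if "xs \<in> ?L" for xs
    using chains_properties[of xs k e] assms(1) that by (simp add: edges_eq)
  have A: "?A xs \<in> sets (percolation \<mu> p)" if "xs \<in> ?L" for xs
    by (rule sets_percolation_pred, rule pred_finitely_many_edges[OF finite_set sub[OF that]]) (rule depends_onI, auto)
  have "{\<omega> \<in> space (percolation \<mu> p). closed_chain k e \<omega>} = (\<Union>xs\<in>?L. ?A xs)"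
    by (auto simp: closed_chain_def)
  then have "measure (percolation \<mu> p) {\<omega> \<in> space (percolation \<mu> p). closed_chain k e \<omega>} \<le> (\<Sum>xs\<in>?L. P.prob (?A xs))"
    using P.finite_measure_subadditive_finite[OF finL, of ?A] A by (simp add: image_subset_iff)
  also have "\<dots> = (\<Sum>xs\<in>?L. (1 - p) ^ Suc k)"
  proof (rule sum.cong[OF refl])
    fix xs assume xs: "xs \<in> ?L"
    have "card (set xs) = Suc k"
      using chains_properties[of xs k e] assms(1) xs by (simp add: distinct_card)
    then show "P.prob (?A xs) = (1 - p) ^ Suc k"
      unfolding prob_edges_state[OF finite_set sub[OF xs] assms(2)] by simp
  qed
  also have "\<dots> = real (card ?L) * (1 - p) ^ Suc k" by simp
  also have "\<dots> \<le> real (chain_degree TYPE('d)) ^ k * (1 - p) ^ Suc k"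
  proof (rule mult_right_mono)
    have "card ?L \<le> card (edge_chains k e)" by (rule card_mono[OF fin]) auto
    also note card
    finally show "real (card ?L) \<le> real (chain_degree TYPE('d)) ^ k" by (simp flip: of_nat_power)
  qed (use assms(2) in simp)
  finally show ?thesis .
qed

lemma pred_peierls_bad: "Measurable.pred (percolation \<mu> p) (peierls_bad i)"
proof -
  have 1: "Measurable.pred (percolation \<mu> p) (\<lambda>\<omega>. \<exists>m. closed_chain m (axis_edge i m) \<omega>)"
    by (rule pred_intros_countable(2)) (rule pred_closed_chain[OF axis_edge_in])
  have 2: "Measurable.pred (percolation \<mu> p) (\<lambda>\<omega>. \<exists>e\<in>lattice_edges. \<forall>k. closed_chain k e \<omega>)"
  proof -
    have eq: "(\<lambda>\<omega>. \<exists>e\<in>lattice_edges. \<forall>k. closed_chain k e \<omega>) = (\<lambda>\<omega>. \<exists>x y :: int ^ 'd. adj x y \<and> (\<forall>k. closed_chain k {x, y} \<omega>))"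
      by (rule ext) (auto simp: lattice_edges_def)
    have "Measurable.pred (percolation \<mu> p) (\<lambda>\<omega>. adj x y \<and> (\<forall>k. closed_chain k {x, y} \<omega>))" for x y :: "int ^ 'd"
    proof (cases "adj x y")
      case True
      have e: "{x, y} \<in> lattice_edges" using True by (auto simp: lattice_edges_def)
      have "Measurable.pred (percolation \<mu> p) (\<lambda>\<omega>. \<forall>k. closed_chain k {x, y} \<omega>)"
        by (rule pred_intros_countable(1)) (rule pred_closed_chain[OF e])
      then show ?thesis using True by simp
    qed simp
    then show ?thesis unfolding eq by (rule pred_intros_countable(2)[OF pred_intros_countable(2)])
  qed
  have "peierls_bad i = (\<lambda>\<omega>. (\<exists>m. closed_chain m (axis_edge i m) \<omega>) \<or> (\<exists>e\<in>lattice_edges. \<forall>k. closed_chain k e \<omega>))"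
    by (rule ext) (rule peierls_bad_def)
  then show ?thesis using pred_intros_logic(5)[OF 1 2] by (simp only:)
qed

text \<open>Under \<open>small\<close> a closed chain with \<open>k + 1\<close> edges from a given
  edge has probability at most \<open>1 - p\<close> times the \<open>k\<close>-th power of 1/2. So
  arbitrarily long chains from one edge form a null event, and the sum over the axis is
  \<open>2 * (1 - p)\<close>. This bound is linear in \<open>1 - p\<close>, so summability of
  \<open>1 - p n\<close> is what Borel-Cantelli requires.\<close>

lemma prob_peierls_bad:
  assumes p: "p \<in> {0..1}" and small: "real (chain_degree TYPE('d)) * (1 - p) \<le> 1 / 2"
  shows "measure (percolation \<mu> p) {\<omega> \<in> space (percolation \<mu> p). peierls_bad i \<omega>} \<le> 2 * (1 - p)"
proof -
  interpret P: prob_space "percolation \<mu> p" by (rule prob_space_percolation)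
  let ?M = "percolation \<mu> p"
  have bound: "P.prob {\<omega> \<in> space ?M. closed_chain k e \<omega>} \<le> (1 - p) * (1 / 2) ^ k" if "e \<in> lattice_edges" for k e
  proof -
    have "P.prob {\<omega> \<in> space ?M. closed_chain k e \<omega>} \<le> (1 - p) * (real (chain_degree TYPE('d)) * (1 - p)) ^ k"
      using prob_closed_chain[OF that p, of k] by (simp add: power_mult_distrib mult_ac)
    also have "\<dots> \<le> (1 - p) * (1 / 2) ^ k"
      using p by (intro mult_left_mono power_mono small) simp_all
    finally show ?thesis .
  qed
  have sums: "(\<lambda>k. (1 - p) * (1 / 2) ^ k) sums ((1 - p) * 2)"
    using sums_mult[OF geometric_sums[of "1 / 2 :: real"], of "1 - p"] by simp
  let ?A = "\<lambda>m. {\<omega> \<in> space ?M. closed_chain m (axis_edge i m) \<omega>}"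
  have A: "?A m \<in> sets ?M" for m by (rule sets_percolation_pred[OF pred_closed_chain[OF axis_edge_in]])
  have le: "P.prob (?A m) \<le> (1 - p) * (1 / 2) ^ m" for m by (rule bound[OF axis_edge_in])
  have summ: "summable (\<lambda>m. P.prob (?A m))"
    by (rule summable_comparison_test'[OF sums_summable[OF sums], of 0]) (use le in simp)
  have null: "AE \<omega> in ?M. \<not> (\<forall>k. closed_chain k e \<omega>)" if e: "e \<in> lattice_edges" for e
  proof -
    let ?B = "{\<omega> \<in> space ?M. \<forall>k. closed_chain k e \<omega>}"
    have B: "?B \<in> sets ?M"
      by (rule sets_percolation_pred, rule pred_intros_countable(1), rule pred_closed_chain[OF e])
    have "P.prob ?B \<le> (1 - p) * (1 / 2) ^ k" for k
      by (rule order_trans[OF P.finite_measure_mono[OF _ sets_percolation_pred[OF pred_closed_chain[OF e]]] bound[OF e]]) auto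
    moreover have "(\<lambda>k. (1 - p) * (1 / 2) ^ k) \<longlonglongrightarrow> 0"
      by (rule summable_LIMSEQ_zero[OF sums_summable[OF sums]])
    ultimately have "P.prob ?B \<le> 0" by (intro LIMSEQ_le_const) auto
    then have "P.prob ?B = 0" using measure_nonneg[of ?M ?B] by linarith
    then show ?thesis by (rule P.prob_Collect_eq_0[OF B, THEN iffD1])
  qed
  have "AE \<omega> in ?M. \<forall>e\<in>lattice_edges. \<not> (\<forall>k. closed_chain k e \<omega>)"
    by (subst AE_ball_countable) (use countable_edges[unfolded edges_eq] null in auto)
  then have "AE \<omega> in ?M. \<omega> \<in> {\<omega> \<in> space ?M. peierls_bad i \<omega>} \<longrightarrow> \<omega> \<in> (\<Union>m. ?A m)"
  proof eventually_elim
    case (elim \<omega>)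
    show ?case
    proof
      assume \<omega>: "\<omega> \<in> {\<omega> \<in> space ?M. peierls_bad i \<omega>}"
      have "\<not> (\<exists>e\<in>lattice_edges. \<forall>k. closed_chain k e \<omega>)" using elim by simp
      then obtain m where "closed_chain m (axis_edge i m) \<omega>" using \<omega> unfolding peierls_bad_def by auto
      then show "\<omega> \<in> (\<Union>m. ?A m)" using \<omega> by auto
    qed
  qed
  then have "P.prob {\<omega> \<in> space ?M. peierls_bad i \<omega>} \<le> P.prob (\<Union>m. ?A m)"
    by (rule P.finite_measure_mono_AE) (rule sets.countable_UN, rule image_subsetI, rule A)
  also have "\<dots> \<le> (\<Sum>m. P.prob (?A m))"
    by (rule P.finite_measure_subadditive_countably[OF _ summ]) (rule image_subsetI, rule A)
  also have "\<dots> \<le> (\<Sum>m. (1 - p) * (1 / 2) ^ m)"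
    by (rule suminf_le[OF le summ sums_summable[OF sums]])
  also have "\<dots> = 2 * (1 - p)" using sums_unique[OF sums] by simp
  finally show ?thesis .
qed

lemma critical_prob_less_1: "critical_prob \<mu> < 1"
proof -
  \<comment> \<open>Small enough for the hypothesis of \<open>prob_peierls_bad\<close> and for its
    bound to stay below 1, whatever the degree is.\<close>
  define \<epsilon> where "\<epsilon> = 1 / (2 * (real (chain_degree TYPE('d)) + 2))"
  have \<epsilon>: "0 < \<epsilon>" "real (chain_degree TYPE('d)) * \<epsilon> \<le> 1 / 2" "2 * \<epsilon> < 1"
    by (simp_all add: \<epsilon>_def field_simps)
  have "critical_prob \<mu> \<le> 1 - \<epsilon>"
  proof (rule critical_prob_le)
    fix p assume p: "1 - \<epsilon> < p" "p \<le> 1"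
    interpret P: prob_space "percolation \<mu> p" by (rule prob_space_percolation)
    have p01: "p \<in> {0..1}" using p \<epsilon> by simp
    obtain i :: 'd where True by simp
    have "real (chain_degree TYPE('d)) * (1 - p) \<le> real (chain_degree TYPE('d)) * \<epsilon>"
      using p by (intro mult_left_mono) simp_all
    then have small: "real (chain_degree TYPE('d)) * (1 - p) \<le> 1 / 2" using \<epsilon>(2) by simp
    let ?B = "{\<omega> \<in> space (percolation \<mu> p). peierls_bad i \<omega>}"
    have B: "?B \<in> sets (percolation \<mu> p)" by (rule sets_percolation_pred[OF pred_peierls_bad])
    have "P.prob ?B < 1" using prob_peierls_bad[OF p01 small, of i] p \<epsilon>(3) by simp
    then have "0 < P.prob (space (percolation \<mu> p) - ?B)" unfolding P.prob_compl[OF B] by simp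
    also have "\<dots> \<le> P.prob {\<omega> \<in> space (percolation \<mu> p). percolates \<omega>}"
    proof (rule P.finite_measure_mono)
      show "space (percolation \<mu> p) - ?B \<subseteq> {\<omega> \<in> space (percolation \<mu> p). percolates \<omega>}"
      proof
        fix \<omega> assume \<omega>: "\<omega> \<in> space (percolation \<mu> p) - ?B"
        then have "\<not> peierls_bad i \<omega>" by simp
        from not_peierls_bad(1)[OF this] have "percolates \<omega>"
          unfolding percolates_def infinite_clusters_iff by (rule exI)
        then show "\<omega> \<in> {\<omega> \<in> space (percolation \<mu> p). percolates \<omega>}" using \<omega> by simp
      qed
    qed (rule sets_percolation_pred[OF pred_percolates])
    finally show "P.prob {\<omega> \<in> space (percolation \<mu> p). percolates \<omega>} \<noteq> 0" by simp
  qed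
  then show ?thesis using \<epsilon>(1) by simp
qed

section \<open>The lattice with parameters tending to one\<close>

lemma eventually_supercritical:
  assumes "summable (\<lambda>n. 1 - p n)"
  shows "\<forall>\<^sub>F n in sequentially. critical_prob \<mu> < p n"
proof -
  have "(\<lambda>n. 1 - p n) \<longlonglongrightarrow> 0" by (rule summable_LIMSEQ_zero[OF assms])
  from order_tendstoD(2)[OF this, of "1 - critical_prob \<mu>"] critical_prob_less_1
  have "\<forall>\<^sub>F n in sequentially. 1 - p n < 1 - critical_prob \<mu>" by simp
  then show ?thesis by eventually_elim simp
qed

text \<open>Eventually each infinite cluster contains the origin, hence there is just one, and the
  pattern based at the origin suffices even though the weights may vary from place to place. The
  claim is made for an arbitrary selection \<open>Y\<close> of infinite clusters.\<close>

theorem strong_critical_infinite_cluster_tendsto: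
  assumes p: "\<And>n. p n \<in> {0..1}" "summable (\<lambda>n. 1 - p n)"
  shows "AE \<omega> in percolation_seq \<mu> p.
     (\<forall>\<^sub>F n in sequentially. infinite_clusters (open_edges \<mu> (\<omega> n)) \<noteq> {}) \<and>
     (\<forall>Y. (\<forall>\<^sub>F n in sequentially. Y n \<in> infinite_clusters (open_edges \<mu> (\<omega> n))) \<longrightarrow>
        (\<lambda>n. strong_critical_component \<mu> (open_edges \<mu> (\<omega> n)) (Y n)) \<longlonglongrightarrow> strong_critical UNIV \<mu>)"
proof -
  obtain i :: 'd where True by simp
  have "AE \<omega> in percolation_seq \<mu> p. \<forall>\<^sub>F n in sequentially. \<not> peierls_bad i (\<omega> n)"
  proof (rule percolation_seq_borel_cantelli[OF pred_peierls_bad])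
    have "(\<lambda>n. real (chain_degree TYPE('d)) * (1 - p n)) \<longlonglongrightarrow> real (chain_degree TYPE('d)) * 0"
      by (intro tendsto_mult tendsto_const summable_LIMSEQ_zero[OF p(2)])
    from order_tendstoD(2)[OF this, of "1 / 2"]
    have "\<forall>\<^sub>F n in sequentially. real (chain_degree TYPE('d)) * (1 - p n) < 1 / 2" by simp
    then have "\<forall>\<^sub>F n in sequentially. norm (measure (percolation \<mu> (p n)) {\<eta> \<in> space (percolation \<mu> (p n)). peierls_bad i \<eta>}) \<le> 2 * (1 - p n)"
    proof eventually_elim
      case (elim n)
      show ?case using prob_peierls_bad[OF p(1) less_imp_le[OF elim], of i] by simp
    qed
    then show "summable (\<lambda>n. measure (percolation \<mu> (p n)) {\<eta> \<in> space (percolation \<mu> (p n)). peierls_bad i \<eta>})"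
      by (rule summable_comparison_test_ev[OF _ summable_mult[OF p(2)]])
  qed
  with AE_eventually_open[OF p] show ?thesis
  proof eventually_elim
    case (elim \<omega>)
    let ?F = "\<lambda>n. open_edges \<mu> (\<omega> n)"
    show ?case
    proof (intro conjI allI impI)
      show "\<forall>\<^sub>F n in sequentially. infinite_clusters (?F n) \<noteq> {}"
        using elim(2)
      proof (rule eventually_mono)
        fix n assume "\<not> peierls_bad i (\<omega> n)"
        from not_peierls_bad(1)[OF this] show "infinite_clusters (?F n) \<noteq> {}"
          unfolding infinite_clusters_iff by (rule exI)
      qed
      fix Y assume Y: "\<forall>\<^sub>F n in sequentially. Y n \<in> infinite_clusters (?F n)"
      have Y0: "\<forall>\<^sub>F n in sequentially. Y n \<in> components (?F n) \<and> 0 \<in> Y n"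
        using elim(2) Y
      proof eventually_elim
        case (elim n)
        have comp: "Y n \<in> components (?F n)" and inf: "infinite (Y n)"
          using elim(2) by (auto simp: infinite_clusters_def)
        obtain x where x: "x \<in> Y n" using component_nonempty[OF comp] ..
        have eq: "Y n = (adjacency (?F n))\<^sup>* `` {x}" by (rule component_eq[OF comp x])
        have "0 \<in> Y n" unfolding eq by (rule not_peierls_bad(2)[OF elim(1)]) (use inf eq in simp)
        then show ?case using comp by simp
      qed
      show "(\<lambda>n. strong_critical_component \<mu> (?F n) (Y n)) \<longlonglongrightarrow> strong_critical UNIV \<mu>"
      proof (rule order_tendstoI)
        fix a assume a: "a < strong_critical UNIV \<mu>"
        show "\<forall>\<^sub>F n in sequentially. a < strong_critical_component \<mu> (?F n) (Y n)"
          using Y0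
        proof (rule eventually_mono)
          fix n assume "Y n \<in> components (?F n) \<and> 0 \<in> Y n"
          then show "a < strong_critical_component \<mu> (?F n) (Y n)"
            by (intro less_le_trans[OF a strong_critical_component_ge[OF open_edges_subset]]) simp
        qed
      next
        fix a assume "strong_critical UNIV \<mu> < a"
        then obtain lam n where lam: "0 < lam" "ereal lam < a" "1 < lam ^ n * weight_power \<mu> n 0 0"
          by (rule strong_critical_less_witness)
        have "\<forall>\<^sub>F k in sequentially. walk_edges \<mu> n 0 \<subseteq> ?F k"
          by (rule eventually_finite_open[OF elim(1) finite_walk_edges[OF rows] walk_edges_subset])
        with Y0 show "\<forall>\<^sub>F k in sequentially. strong_critical_component \<mu> (?F k) (Y k) < a"
        proof eventually_elim
          case (elim k)
          from strong_critical_component_le[OF open_edges_subset _ _ elim(2) lam(1,3), of "Y k"] elim(1)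
          have "strong_critical_component \<mu> (?F k) (Y k) \<le> ereal lam" by simp
          then show ?case using lam(2) by (rule le_less_trans)
        qed
      qed
    qed
  qed
qed

subsection \<open>Patterns in infinite clusters\<close>

lemma walk_edges_component_bound:
  assumes "e \<in> walk_edges \<mu> n y" "v \<in> e"
  shows "\<bar>v $ k - y $ k\<bar> \<le> int n"
proof -
  have rel: "\<bar>v $ k - y $ k\<bar> \<le> int m" if "(v, y) \<in> {(a, b). 0 < \<mu> a b} ^^ m" for m y
    using that
  proof (induction m arbitrary: y)
    case (Suc m)
    then obtain z where z: "(v, z) \<in> {(a, b). 0 < \<mu> a b} ^^ m" "0 < \<mu> z y" by auto
    have "\<bar>z $ k - y $ k\<bar> \<le> 1" using z(2) by (intro adj_component) (simp add: pos_iff)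
    with Suc.IH[OF z(1)] show ?case by simp
  qed simp
  obtain m where "m \<le> n" "(v, y) \<in> {(a, b). 0 < \<mu> a b} ^^ m" using walk_edges_near[OF assms] by auto
  with rel[of y m] show ?thesis by simp
qed

lemma translation:
  assumes "translation_invariant \<mu>"
  shows "weight_power \<mu> n z z = weight_power \<mu> n 0 0" "card (walk_edges \<mu> n z) \<le> card (walk_edges \<mu> n 0)"
proof -
  have bij: "bij (\<lambda>x. x + z)" by (rule bij_plus_right)
  have inv: "\<mu> (a + z) (b + z) = \<mu> a b" for a b using assms by (simp add: translation_invariant_def)
  show "weight_power \<mu> n z z = weight_power \<mu> n 0 0"
    using weight_power_automorphism[of "\<lambda>x. x + z" \<mu> n 0 0, OF bij inv] by simp
  show "card (walk_edges \<mu> n z) \<le> card (walk_edges \<mu> n 0)"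
    using walk_edges_automorphism[of "\<lambda>x. x + z" \<mu> n 0, OF bij inv]
      card_image_le[OF finite_walk_edges[OF rows], of "(`) (\<lambda>x. x + z)" n 0] by simp
qed

text \<open>Boxes \<open>L j\<close> around \<open>x0\<close> are revealed one after another. An
  infinite cluster reaches the boundary \<open>V j\<close> of each box inside that box. The patch of
  a reached boundary point is a straight segment leading outwards, followed by the pattern at its
  end, all in edges that are still unrevealed; once the patch is open, the pattern belongs to the
  cluster.\<close>

lemma AE_infinite_cluster_pattern:
  assumes "translation_invariant \<mu>" "0 < p" "p \<le> 1"
  shows "AE \<omega> in percolation \<mu> p. infinite ((adjacency (open_edges \<mu> \<omega>))\<^sup>* `` {x0}) \<longrightarrow>
    (\<exists>y \<in> (adjacency (open_edges \<mu> \<omega>))\<^sup>* `` {x0}. walk_edges \<mu> n y \<subseteq> open_edges \<mu> \<omega>)"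
proof -
  \<comment> \<open>The segment takes \<open>n + 1\<close> steps outwards and the pattern at its end
    extends \<open>n\<close> further, so one layer of width \<open>2 * n + 1\<close> holds a
    patch.\<close>
  define R where "R = 2 * int n + 1"
  define L where "L j = {y. \<forall>i. \<bar>y $ i - x0 $ i\<bar> \<le> int j * R}" for j
  define F where "F j = {e \<in> edges \<mu>. e \<subseteq> L j}" for j
  define reach where "reach j \<omega> = (adjacency (open_edges \<mu> \<omega> \<inter> F j))\<^sup>* `` {x0}" for j \<omega>
  define V where "V j = {v \<in> L j. \<exists>i. \<bar>v $ i - x0 $ i\<bar> = int j * R}" for j
  define T where "T j \<omega> \<longleftrightarrow> (\<exists>v. v \<in> reach j \<omega> \<inter> V j)" for j \<omega>
  define sel where "sel j \<omega> = (SOME v. v \<in> reach j \<omega> \<inter> V j)" for j \<omega>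
  define dir where "dir j v = (SOME i. \<bar>v $ i - x0 $ i\<bar> = int j * R)" for j and v :: "int ^ 'd"
  define sg :: "nat \<Rightarrow> int ^ 'd \<Rightarrow> int"
    \<comment> \<open>The sign points away from \<open>x0\<close>; in box 0, where
      \<open>v = x0\<close>, either direction leads outwards.\<close>
    where "sg j v = (if x0 $ dir j v \<le> v $ dir j v then 1 else - 1)" for j v
  define pt where "pt j v m = v + axis (dir j v) (sg j v * int m)" for j v and m :: nat
  \<comment> \<open>The pattern is based \<open>n + 1\<close> steps outside the box because it may
    reach back by \<open>n\<close>, and it must not use revealed edges.\<close>
  define W where "W j v = (\<lambda>m. {pt j v m, pt j v (Suc m)}) ` {..n} \<union> walk_edges \<mu> n (pt j v (Suc n))" for j v
  have R: "0 < R" by (simp add: R_def)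
  have finL: "finite (L j)" for j unfolding L_def by (rule finite_int_box)
  have pt0: "pt j v 0 = v" for j v by (simp add: pt_def vec_eq_iff axis_def)
  have adj_pt: "adj (pt j v m) (pt j v (Suc m))" for j v m
  proof -
    have eq: "pt j v (Suc m) = pt j v m + axis (dir j v) (sg j v)"
      by (auto simp: pt_def vec_eq_iff axis_def algebra_simps)
    have "unit_step (axis (dir j v) (sg j v))"
      unfolding unit_step_def by (intro exI[of _ "dir j v"] exI[of _ "sg j v"]) (simp add: sg_def)
    then show ?thesis unfolding eq by (rule adj_add)
  qed
  have pt_edge: "{pt j v m, pt j v (Suc m)} \<in> edges \<mu>" for j v m
    using adj_pt[of j v m] by (simp add: edge_pos pos_iff)
  have pt_dir: "\<bar>pt j v m $ dir j v - x0 $ dir j v\<bar> = int j * R + int m" if "v \<in> V j" for j v m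
  proof -
    have "\<exists>i. \<bar>v $ i - x0 $ i\<bar> = int j * R" using that by (simp add: V_def)
    then have "\<bar>v $ dir j v - x0 $ dir j v\<bar> = int j * R" unfolding dir_def by (rule someI_ex)
    then show ?thesis by (auto simp: pt_def sg_def axis_def abs_if split: if_splits)
  qed
  have pt_le: "\<bar>pt j v m $ k - x0 $ k\<bar> \<le> int j * R + int m" if "v \<in> V j" for j v m k
  proof (cases "k = dir j v")
    case True
    then show ?thesis using pt_dir[OF that, of m] by simp
  next
    case False
    have "\<bar>v $ k - x0 $ k\<bar> \<le> int j * R" using that by (simp add: V_def L_def)
    then show ?thesis using False by (simp add: pt_def axis_def)
  qed
  have next_le: "int (Suc j) * R = int j * R + 2 * int n + 1" for j by (simp add: R_def algebra_simps)
  have W_near: "u \<in> L (Suc j)" if v: "v \<in> V j" and e: "e \<in> W j v" and u: "u \<in> e" for j v e u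
    unfolding L_def mem_Collect_eq next_le
  proof
    fix k
    from e consider m where "m \<le> n" "e = {pt j v m, pt j v (Suc m)}" | "e \<in> walk_edges \<mu> n (pt j v (Suc n))"
      unfolding W_def by auto
    then show "\<bar>u $ k - x0 $ k\<bar> \<le> int j * R + 2 * int n + 1"
    proof cases
      case 1
      then have "u = pt j v m \<or> u = pt j v (Suc m)" using u by simp
      then show ?thesis using pt_le[OF v, of m k] pt_le[OF v, of "Suc m" k] 1(1) by auto
    next
      case 2
      from walk_edges_component_bound[OF 2 u, of k] pt_le[OF v, of "Suc n" k] show ?thesis by simp
    qed
  qed
  have W_far: "\<not> e \<subseteq> L j" if v: "v \<in> V j" and e: "e \<in> W j v" for j v e
  proof -
    have "\<exists>u\<in>e. int j * R < \<bar>u $ dir j v - x0 $ dir j v\<bar>"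
    proof -
      from e consider m where "m \<le> n" "e = {pt j v m, pt j v (Suc m)}" | "e \<in> walk_edges \<mu> n (pt j v (Suc n))"
        unfolding W_def by auto
      then show ?thesis
      proof cases
        case 1
        then show ?thesis using pt_dir[OF v, of "Suc m"] by (intro bexI[of _ "pt j v (Suc m)"]) simp_all
      next
        case 2
        then obtain u where u: "u \<in> e" using subsetD[OF walk_edges_subset 2] by (auto simp: edges_def)
        from walk_edges_component_bound[OF 2 u, of "dir j v"] pt_dir[OF v, of "Suc n"]
        show ?thesis by (intro bexI[OF _ u]) simp
      qed
    qed
    then obtain u where u: "u \<in> e" "int j * R < \<bar>u $ dir j v - x0 $ dir j v\<bar>" by (rule bexE)
    show ?thesis
    proof
      assume "e \<subseteq> L j"
      then have "u \<in> L j" using u(1) by (rule subsetD)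
      then have "\<bar>u $ dir j v - x0 $ dir j v\<bar> \<le> int j * R" by (simp add: L_def)
      with u(2) show False by simp
    qed
  qed
  have W_edges: "W j v \<subseteq> edges \<mu>" for j v
    unfolding W_def using pt_edge walk_edges_subset by (intro Un_least image_subsetI) simp_all
  have Fopen: "open_edges \<mu> \<omega> \<inter> F j = {e \<in> F j. \<omega> e}" for \<omega> j
    by (auto simp: open_edges_def F_def)
  have reach_cong: "reach j \<omega> = reach j \<omega>'" if "\<And>e. e \<in> F j \<Longrightarrow> \<omega> e = \<omega>' e" for j \<omega> \<omega>'
  proof -
    have "{e \<in> F j. \<omega> e} = {e \<in> F j. \<omega>' e}" using that by (intro Collect_cong) (simp cong: conj_cong)
    then show ?thesis unfolding reach_def Fopen by (simp only:)
  qed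
  have "AE \<omega> in percolation \<mu> p. (\<forall>j. T j \<omega>) \<longrightarrow> (\<exists>j. \<forall>e\<in>W j (sel j \<omega>). \<omega> e)"
  proof (rule AE_exploration[OF assms(2,3), where F = F and V = V and c = "Suc n + card (walk_edges \<mu> n 0)"])
    show "finite (F j)" for j
      by (rule finite_subset[of _ "Pow (L j)"]) (use finL in \<open>auto simp: F_def\<close>)
    show "F j \<subseteq> edges \<mu>" for j by (auto simp: F_def)
    have "L j \<subseteq> L (Suc j)" for j
    proof -
      have "int j * R \<le> int (Suc j) * R" using R by (simp add: algebra_simps)
      then show ?thesis unfolding L_def by (auto intro: order_trans)
    qed
    then show "F j \<subseteq> F (Suc j)" for j unfolding F_def by (auto dest: subset_trans)
    show "finite (V j)" for j by (rule finite_subset[OF _ finL[of j]]) (auto simp: V_def)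
    show "sel j \<omega> \<in> V j" if "T j \<omega>" for j \<omega>
      using someI_ex[OF that[unfolded T_def]] unfolding sel_def by simp
    show "W j v \<subseteq> F (Suc j) - F j" if "v \<in> V j" for j v
    proof
      fix e assume e: "e \<in> W j v"
      have "e \<subseteq> L (Suc j)" using W_near[OF that e] by (rule subsetI)
      then show "e \<in> F (Suc j) - F j" using W_far[OF that e] subsetD[OF W_edges e] by (simp add: F_def)
    qed
    show "card (W j v) \<le> Suc n + card (walk_edges \<mu> n 0)" for j v
    proof -
      have "card (W j v) \<le> card ((\<lambda>m. {pt j v m, pt j v (Suc m)}) ` {..n}) + card (walk_edges \<mu> n (pt j v (Suc n)))"
        unfolding W_def by (rule card_Un_le)
      also have "\<dots> \<le> Suc n + card (walk_edges \<mu> n 0)"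
        using card_image_le[of "{..n}" "\<lambda>m. {pt j v m, pt j v (Suc m)}"] translation(2)[OF assms(1)]
        by (intro add_mono) simp_all
      finally show ?thesis .
    qed
    show "depends_on (F j) (T j)" for j
    proof (rule depends_onI)
      fix \<omega> \<omega>' :: "(int ^ 'd) set \<Rightarrow> bool"
      assume "\<And>e. e \<in> F j \<Longrightarrow> \<omega> e = \<omega>' e" and "T j \<omega>"
      then show "T j \<omega>'" using reach_cong[of j \<omega> \<omega>'] by (simp add: T_def)
    qed
    show "depends_on (F j) (\<lambda>\<omega>. sel j \<omega> = v)" for j v
    proof (rule depends_onI)
      fix \<omega> \<omega>' :: "(int ^ 'd) set \<Rightarrow> bool"
      assume "\<And>e. e \<in> F j \<Longrightarrow> \<omega> e = \<omega>' e" and "sel j \<omega> = v"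
      then show "sel j \<omega>' = v" using reach_cong[of j \<omega> \<omega>'] by (simp add: sel_def)
    qed
  qed
  then show ?thesis
  proof eventually_elim
    case (elim \<omega>)
    let ?C = "(adjacency (open_edges \<mu> \<omega>))\<^sup>* `` {x0}"
    show ?case
    proof
      assume inf: "infinite ?C"
      \<comment> \<open>If no boundary point of the box were reached inside it, the cluster could
        never step out and would be finite.\<close>
      have T: "T j \<omega>" for j
      proof -
        have "T j \<omega> \<or> (y \<in> reach j \<omega> \<and> y \<in> L j)" if "(x0, y) \<in> (adjacency (open_edges \<mu> \<omega>))\<^sup>*" for y
          using that
        proof (induction rule: rtrancl_induct)
          case base
          have "0 \<le> int j * R" using R by simp
          then show ?case by (simp add: reach_def L_def)
        next
          case (step y z)
          show ?case
          proof (cases "T j \<omega>")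
            case False
            then have y: "y \<in> reach j \<omega>" "y \<in> L j" using step.IH by simp_all
            have e: "{y, z} \<in> open_edges \<mu> \<omega>" using step.hyps(2) by simp
            have "z \<in> L j"
            proof (rule ccontr)
              assume "z \<notin> L j"
              then obtain k where k: "int j * R < \<bar>z $ k - x0 $ k\<bar>" by (auto simp: L_def not_le)
              have "adj y z" using subsetD[OF open_edges_subset e] by (simp only: edge_pos pos_iff)
              then have "\<bar>y $ k - z $ k\<bar> \<le> 1" by (rule adj_component)
              moreover have "\<bar>y $ k - x0 $ k\<bar> \<le> int j * R" using y(2) by (simp add: L_def)
              ultimately have "\<bar>y $ k - x0 $ k\<bar> = int j * R" using k by linarith
              then have "y \<in> V j" using y(2) by (auto simp: V_def)
              then have "T j \<omega>" using y(1) unfolding T_def by (intro exI[of _ y]) simp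
              then show False using False by simp
            qed
            moreover have "z \<in> reach j \<omega>"
            proof -
              have "{y, z} \<in> open_edges \<mu> \<omega> \<inter> F j"
                using e y(2) \<open>z \<in> L j\<close> open_edges_subset by (auto simp: F_def)
              then have "(y, z) \<in> adjacency (open_edges \<mu> \<omega> \<inter> F j)" by simp
              with y(1) show ?thesis unfolding reach_def by (auto intro: rtrancl_into_rtrancl)
            qed
            ultimately show ?thesis by simp
          qed simp
        qed
        moreover have "\<not> ?C \<subseteq> L j" using inf finite_subset[OF _ finL[of j]] by auto
        ultimately show ?thesis by auto
      qed
      then obtain j where j: "\<forall>e\<in>W j (sel j \<omega>). \<omega> e" using elim by auto
      let ?v = "sel j \<omega>"
      have v: "?v \<in> reach j \<omega>" using someI_ex[OF T[of j, unfolded T_def]] unfolding sel_def by simp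
      have W_open: "W j ?v \<subseteq> open_edges \<mu> \<omega>" using j W_edges by (auto simp: open_edges_def)
      have "reach j \<omega> \<subseteq> ?C" unfolding reach_def by (intro Image_mono rtrancl_mono order_refl) auto
      then have vC: "?v \<in> ?C" using v by (rule subsetD)
      have "pt j ?v m \<in> ?C" if "m \<le> Suc n" for m
        using that
      proof (induction m)
        case 0 then show ?case using vC by (simp only: pt0)
      next
        case (Suc m)
        have "{pt j ?v m, pt j ?v (Suc m)} \<in> open_edges \<mu> \<omega>"
          by (rule subsetD[OF W_open]) (use Suc.prems in \<open>simp add: W_def\<close>)
        then show ?case by (rule component_closed[OF cluster_in_components Suc.IH[OF Suc_leD[OF Suc.prems]]])
      qed
      then have "pt j ?v (Suc n) \<in> ?C" by simp
      moreover have "walk_edges \<mu> n (pt j ?v (Suc n)) \<subseteq> open_edges \<mu> \<omega>" using W_open unfolding W_def by simp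
      ultimately show "\<exists>y\<in>?C. walk_edges \<mu> n y \<subseteq> open_edges \<mu> \<omega>" by (rule bexI[rotated])
    qed
  qed
qed

theorem strong_critical_infinite_cluster:
  assumes "translation_invariant \<mu>" "critical_prob \<mu> < p" "p \<le> 1"
  shows "AE \<omega> in percolation \<mu> p. infinite_clusters (open_edges \<mu> \<omega>) \<noteq> {} \<and>
    (\<forall>Y\<in>infinite_clusters (open_edges \<mu> \<omega>).
       strong_critical_component \<mu> (open_edges \<mu> \<omega>) Y = strong_critical UNIV \<mu>)"
proof -
  have p: "0 < p" using assms(2) critical_prob_nonneg by simp
  let ?C = "\<lambda>\<omega> x. (adjacency (open_edges \<mu> \<omega>))\<^sup>* `` {x}"
  \<comment> \<open>Taking all of the countably many pairs \<open>x\<close>, \<open>n\<close> at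
    once covers every infinite cluster outside a single null set.\<close>
  have "AE \<omega> in percolation \<mu> p. \<forall>x n. infinite (?C \<omega> x) \<longrightarrow> (\<exists>y\<in>?C \<omega> x. walk_edges \<mu> n y \<subseteq> open_edges \<mu> \<omega>)"
    unfolding AE_all_countable by (intro allI AE_infinite_cluster_pattern assms p)
  with AE_percolates[OF assms(2,3)] show ?thesis
  proof eventually_elim
    case (elim \<omega>)
    show ?case
    proof (intro conjI ballI elim(1))
      fix Y assume "Y \<in> infinite_clusters (open_edges \<mu> \<omega>)"
      then have comp: "Y \<in> components (open_edges \<mu> \<omega>)" and inf: "infinite Y" by (simp_all add: infinite_clusters_def)
      obtain x where x: "x \<in> Y" using component_nonempty[OF comp] ..
      have eq: "Y = ?C \<omega> x" by (rule component_eq[OF comp x])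
      show "strong_critical_component \<mu> (open_edges \<mu> \<omega>) Y = strong_critical UNIV \<mu>"
      proof (rule antisym)
        show "strong_critical_component \<mu> (open_edges \<mu> \<omega>) Y \<le> strong_critical UNIV \<mu>"
        proof (rule dense_ge)
          fix a assume "strong_critical UNIV \<mu> < a"
          then obtain lam n where lam: "0 < lam" "ereal lam < a" "1 < lam ^ n * weight_power \<mu> n 0 0"
            by (rule strong_critical_less_witness)
          have "infinite (?C \<omega> x)" using inf eq by simp
          then obtain y where y: "y \<in> Y" "walk_edges \<mu> n y \<subseteq> open_edges \<mu> \<omega>"
            using elim(2)[rule_format, of x n] eq by auto
          have "strong_critical_component \<mu> (open_edges \<mu> \<omega>) Y \<le> ereal lam"
            by (rule strong_critical_component_le[OF open_edges_subset comp y lam(1)])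
               (simp only: translation(1)[OF assms(1), of n y] lam(3))
          then show "strong_critical_component \<mu> (open_edges \<mu> \<omega>) Y \<le> a"
            using less_imp_le[OF lam(2)] by (rule order_trans)
        qed
      qed (rule strong_critical_component_ge[OF open_edges_subset comp])
    qed
  qed
qed

end

section \<open>The four claims together\<close>

lemma finite_rows_if_bounded_geometry: "bounded_geometry w \<Longrightarrow> finite_rows w"
  by (auto simp: bounded_geometry_def finite_rows_def)

theorem theorem7p1:
  fixes \<mu> :: "'a::countable \<Rightarrow> 'a \<Rightarrow> real"
    and \<nu> :: "int ^ 'd \<Rightarrow> int ^ 'd \<Rightarrow> real"
  assumes "infinite (UNIV :: 'a set)"
    and "nonneg_weights \<mu>" and "connected_weights \<mu>" and "non_oriented \<mu>"
    and "bounded_geometry \<mu>" and "bounded_rates \<mu>"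
  shows
    "(\<forall>p :: nat \<Rightarrow> real.
        (\<forall>n. p n \<in> {0..1}) \<and> summable (\<lambda>n. 1 - p n) \<longrightarrow>
        (AE \<omega> in percolation_seq \<mu> p.
           (\<lambda>n. strong_critical_all \<mu> (open_edges \<mu> (\<omega> n))) \<longlonglongrightarrow> strong_critical UNIV \<mu>))
   \<and> (\<forall>p :: real.
        0 < p \<and> p \<le> 1 \<and> quasi_transitive \<mu> \<longrightarrow>
        (AE \<omega> in percolation \<mu> p.
           strong_critical_all \<mu> (open_edges \<mu> \<omega>) = strong_critical UNIV \<mu>))
   \<and> (CARD('d) \<ge> 2 \<and> nearest_neighbour \<nu> \<and> nonneg_weights \<nu> \<and> connected_weights \<nu> \<and>
      non_oriented \<nu> \<and> bounded_geometry \<nu> \<and> bounded_rates \<nu> \<longrightarrow>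
        (\<forall>p :: nat \<Rightarrow> real.
          (\<forall>n. p n \<in> {0..1}) \<and> summable (\<lambda>n. 1 - p n) \<longrightarrow>
          (\<forall>\<^sub>F n in sequentially. critical_prob \<nu> < p n) \<and>
          (AE \<omega> in percolation_seq \<nu> p.
             (\<forall>\<^sub>F n in sequentially. infinite_clusters (open_edges \<nu> (\<omega> n)) \<noteq> {}) \<and>
             (\<forall>Y. (\<forall>\<^sub>F n in sequentially. Y n \<in> infinite_clusters (open_edges \<nu> (\<omega> n))) \<longrightarrow>
                (\<lambda>n. strong_critical_component \<nu> (open_edges \<nu> (\<omega> n)) (Y n))
                  \<longlonglongrightarrow> strong_critical UNIV \<nu>)))
      \<and> (\<forall>p :: real.
          translation_invariant \<nu> \<and> critical_prob \<nu> < p \<and> p \<le> 1 \<longrightarrow>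
          (AE \<omega> in percolation \<nu> p.
             infinite_clusters (open_edges \<nu> \<omega>) \<noteq> {} \<and>
             (\<forall>Y \<in> infinite_clusters (open_edges \<nu> \<omega>).
                strong_critical_component \<nu> (open_edges \<nu> \<omega>) Y = strong_critical UNIV \<nu>))))"
proof (intro conjI allI impI)
  interpret X: weighted_graph \<mu>
    by (intro weighted_graph.intro assms finite_rows_if_bounded_geometry)
  fix p :: "nat \<Rightarrow> real" assume p: "(\<forall>n. p n \<in> {0..1}) \<and> summable (\<lambda>n. 1 - p n)"
  show "AE \<omega> in percolation_seq \<mu> p.
      (\<lambda>n. strong_critical_all \<mu> (open_edges \<mu> (\<omega> n))) \<longlonglongrightarrow> strong_critical UNIV \<mu>"
    by (rule X.strong_critical_all_tendsto) (simp_all only: p)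
next
  interpret X: weighted_graph \<mu>
    by (intro weighted_graph.intro assms finite_rows_if_bounded_geometry)
  fix p :: real assume p: "0 < p \<and> p \<le> 1 \<and> quasi_transitive \<mu>"
  show "AE \<omega> in percolation \<mu> p. strong_critical_all \<mu> (open_edges \<mu> \<omega>) = strong_critical UNIV \<mu>"
    by (rule X.strong_critical_all_quasi_transitive[OF assms(1)]) (simp_all only: p)
next
  assume "CARD('d) \<ge> 2 \<and> nearest_neighbour \<nu> \<and> nonneg_weights \<nu> \<and> connected_weights \<nu> \<and>
    non_oriented \<nu> \<and> bounded_geometry \<nu> \<and> bounded_rates \<nu>"
  then interpret Z: lattice_graph \<nu>
    by (simp add: lattice_graph_def lattice_graph_axioms_def weighted_graph_def finite_rows_if_bounded_geometry)
  fix p :: "nat \<Rightarrow> real" assume p: "(\<forall>n. p n \<in> {0..1}) \<and> summable (\<lambda>n. 1 - p n)"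
  show "\<forall>\<^sub>F n in sequentially. critical_prob \<nu> < p n"
    by (rule Z.eventually_supercritical) (simp only: p)
  show "AE \<omega> in percolation_seq \<nu> p.
      (\<forall>\<^sub>F n in sequentially. infinite_clusters (open_edges \<nu> (\<omega> n)) \<noteq> {}) \<and>
      (\<forall>Y. (\<forall>\<^sub>F n in sequentially. Y n \<in> infinite_clusters (open_edges \<nu> (\<omega> n))) \<longrightarrow>
         (\<lambda>n. strong_critical_component \<nu> (open_edges \<nu> (\<omega> n)) (Y n)) \<longlonglongrightarrow> strong_critical UNIV \<nu>)"
    by (rule Z.strong_critical_infinite_cluster_tendsto) (simp_all only: p)
next
  assume "CARD('d) \<ge> 2 \<and> nearest_neighbour \<nu> \<and> nonneg_weights \<nu> \<and> connected_weights \<nu> \<and>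
    non_oriented \<nu> \<and> bounded_geometry \<nu> \<and> bounded_rates \<nu>"
  then interpret Z: lattice_graph \<nu>
    by (simp add: lattice_graph_def lattice_graph_axioms_def weighted_graph_def finite_rows_if_bounded_geometry)
  fix p :: real assume p: "translation_invariant \<nu> \<and> critical_prob \<nu> < p \<and> p \<le> 1"
  show "AE \<omega> in percolation \<nu> p. infinite_clusters (open_edges \<nu> \<omega>) \<noteq> {} \<and>
      (\<forall>Y \<in> infinite_clusters (open_edges \<nu> \<omega>).
         strong_critical_component \<nu> (open_edges \<nu> \<omega>) Y = strong_critical UNIV \<nu>)"
    by (rule Z.strong_critical_infinite_cluster) (simp_all only: p)
qed

end
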